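(* Let $p=p_n$ be a sequence of dimensions and, for each $n$, let $X_1,\dots,X_n$ be i.i.d. from the uniform distribution $\mu_0$ on $\mathbb{S}^{p-1}$. Let $(B_t)_{0\le t\le 1}$ be a standard Brownian bridge on $[0,1]$. If $\min\{n,p\}\to\infty$, then $$\sqrt{\frac{n(n-1)}{2}}\,T_n \xrightarrow{d} \max_{t\in[0,1]}|B_t|,$$ where $$T_n=\sup_{t\in[-1,1]}\Big|\frac{2}{n(n-1)}\sum_{1\le i<j\le n}\mathbf 1_{\{X_i^\top X_j\le t\}}-m(t)\Big| .$$
   Context: $\mathbb{S}^{p-1}=\{x\in\mathbb{R}^p:\|x\|_2=1\}$. The function $m$ is $m(t)=\mathbb{P}(X^\top Y\le t)$ for $X,Y$ i.i.d. uniform on $\mathbb{S}^{p-1}$; equivalently $m(t)=\mathbb{P}(1-2U\le t)$ with $U\sim\mathrm{Beta}(\frac{p-1}{2},\frac{p-1}{2})$. *)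

theory Defs
  imports "HOL-Probability.Probability"
begin

text \<open>Points of \<open>\<real>\<^sup>p\<close>, with \<open>p\<close> a varying natural number, are extensional functions on
  \<open>{..<p}\<close>; the Borel sigma-algebra of \<open>\<real>\<^sup>p\<close> is the product sigma-algebra.\<close>

definition rspace :: "nat \<Rightarrow> (nat \<Rightarrow> real) measure" where
  "rspace p = (\<Pi>\<^sub>M i\<in>{..<p}. borel)"

definition dot :: "nat \<Rightarrow> (nat \<Rightarrow> real) \<Rightarrow> (nat \<Rightarrow> real) \<Rightarrow> real" where
  "dot p x y = (\<Sum>i<p. x i * y i)"

definition unit_sphere :: "nat \<Rightarrow> (nat \<Rightarrow> real) set" where
  "unit_sphere p = {x \<in> space (rspace p). L2_set x {..<p} = 1}"

definition orthogonal_mat :: "nat \<Rightarrow> (nat \<Rightarrow> nat \<Rightarrow> real) \<Rightarrow> bool" where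
  "orthogonal_mat p Q \<longleftrightarrow>
     (\<forall>i<p. \<forall>j<p. (\<Sum>k<p. Q k i * Q k j) = (if i = j then 1 else 0))"

definition mat_app :: "nat \<Rightarrow> (nat \<Rightarrow> nat \<Rightarrow> real) \<Rightarrow> (nat \<Rightarrow> real) \<Rightarrow> (nat \<Rightarrow> real)" where
  "mat_app p Q x = (\<lambda>i\<in>{..<p}. \<Sum>j<p. Q i j * x j)"

text \<open>The uniform distribution on the sphere is the (unique) Borel probability measure on the
  sphere that is invariant under the orthogonal group, i.e. the normalised surface measure.
  It is regarded as a law on \<open>\<real>\<^sup>p\<close> concentrated on the sphere. For \<open>p = 0\<close> the sphere is empty
  and no measure satisfies the predicate.\<close>

definition uniform_on_sphere :: "nat \<Rightarrow> (nat \<Rightarrow> real) measure \<Rightarrow> bool" where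
  "uniform_on_sphere p \<mu> \<longleftrightarrow>
     prob_space \<mu> \<and> sets \<mu> = sets (rspace p) \<and> (AE x in \<mu>. x \<in> unit_sphere p) \<and>
     (\<forall>Q. orthogonal_mat p Q \<longrightarrow> distr \<mu> (rspace p) (mat_app p Q) = \<mu>)"

definition inner_cdf :: "nat \<Rightarrow> (nat \<Rightarrow> real) measure \<Rightarrow> real \<Rightarrow> real" where
  "inner_cdf p \<mu> t =
     measure (\<mu> \<Otimes>\<^sub>M \<mu>) {z \<in> space (\<mu> \<Otimes>\<^sub>M \<mu>). dot p (fst z) (snd z) \<le> t}"

definition T_stat :: "nat \<Rightarrow> nat \<Rightarrow> (nat \<Rightarrow> real) measure \<Rightarrow> (nat \<Rightarrow> (nat \<Rightarrow> real)) \<Rightarrow> real" where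
  "T_stat n p \<mu> x =
     (SUP t\<in>{-1..1}.
        \<bar>2 / (real n * (real n - 1)) *
           (\<Sum>(i, j)\<in>{(i, j). 1 \<le> i \<and> i < j \<and> j \<le> n}. of_bool (dot p (x i) (x j) \<le> t))
         - inner_cdf p \<mu> t\<bar>)"

text \<open>Gaussian laws include the point masses (standard deviation \<open>0\<close>), as needed for the bridge
  at times \<open>0\<close> and \<open>1\<close>.\<close>

definition gaussian_law :: "real \<Rightarrow> real \<Rightarrow> real measure" where
  "gaussian_law \<mu> \<sigma> =
     (if \<sigma> = 0 then return borel \<mu> else density lborel (\<lambda>x. ennreal (normal_density \<mu> \<sigma> x)))"

definition gaussian_rv :: "'b measure \<Rightarrow> ('b \<Rightarrow> real) \<Rightarrow> bool" where
  "gaussian_rv N Y \<longleftrightarrow>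
     Y \<in> borel_measurable N \<and> (\<exists>\<mu> \<sigma>. 0 \<le> \<sigma> \<and> distr N borel Y = gaussian_law \<mu> \<sigma>)"

definition gaussian_process_on :: "real set \<Rightarrow> 'b measure \<Rightarrow> (real \<Rightarrow> 'b \<Rightarrow> real) \<Rightarrow> bool" where
  "gaussian_process_on S N B \<longleftrightarrow>
     (\<forall>I c. finite I \<and> I \<subseteq> S \<longrightarrow> gaussian_rv N (\<lambda>\<omega>. \<Sum>t\<in>I. c t * B t \<omega>))"

definition brownian_bridge :: "'b measure \<Rightarrow> (real \<Rightarrow> 'b \<Rightarrow> real) \<Rightarrow> bool" where
  "brownian_bridge N B \<longleftrightarrow>
     prob_space N \<and> gaussian_process_on {0..1} N B \<and>
     (\<forall>t\<in>{0..1}. (\<integral>\<omega>. B t \<omega> \<partial>N) = 0) \<and>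
     (\<forall>s\<in>{0..1}. \<forall>t\<in>{0..1}. (\<integral>\<omega>. B s \<omega> * B t \<omega> \<partial>N) = min s t - s * t) \<and>
     (\<forall>\<omega>\<in>space N. continuous_on {0..1} (\<lambda>t. B t \<omega>))"

end

theory Submission
  imports Defs
begin

text \<open>
  Put \<open>m (q u) = u\<close> and \<open>h\<^sub>u x y = of_bool (x \<bullet> y \<le> q u) - u\<close>. By rotation invariance \<open>h\<^sub>u\<close> integrates to \<open>0\<close>
  in each variable separately, so \<open>emp u = sqrt (2 / (n (n - 1))) (\<Sum>i<j. h\<^sub>u X\<^sub>i X\<^sub>j)\<close> is a degenerate
  U-statistic whose covariance is exactly that of the bridge.

  Central limit theorem: let \<open>W\<close> be a linear combination of values of \<open>emp\<close>, with kernel \<open>h\<close>, let \<open>D\<^sub>j\<close> be the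
  part of \<open>W\<close> that involves \<open>X\<^sub>j\<close>, and \<open>V\<^sub>j = W - D\<^sub>j\<close>. Since \<open>D\<^sub>j\<close> is centred given the other points,
  \<open>2 E [W exp (i t W)] = (\<Sum>j. E [D\<^sub>j (exp (i t W) - exp (i t V\<^sub>j))])\<close>, and a second-order expansion turns this
  into the differential equation of a Gaussian characteristic function. The error is governed by
  \<open>E [G (X, Y)\<^sup>2]\<close> for \<open>G (x, y) = E [h x Z * h y Z]\<close>, i.e. by the expectation of \<open>h\<close> around a 4-cycle of sample
  points. It tends to \<open>0\<close> as \<open>p\<close> grows because the inner products along a 4-cycle, scaled by \<open>sqrt p\<close>, become
  independent normals.

  Tightness: \<open>E [(emp v - emp u)\<^sup>4] \<le> C ((v - u) / n + (v - u)\<^sup>2)\<close>, which is enough for dyadic chaining up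
  to level \<open>O (log n)\<close>; beyond that level monotonicity of the distribution functions takes over.
\<close>

section \<open>Bounded measurable functions\<close>

text \<open>The growth rates of \<open>n\<close> and \<open>p\<close> are unrelated, so no step may
  trade one against the other. The error of the characteristic function therefore splits into a term
  in \<open>cov_norm\<close>, which has to vanish as \<open>p\<close> grows but at no particular
  rate, and a term \<open>C ^ 3 / sqrt n\<close>. This is why weak convergence along the 4-cycle is
  enough, with thresholds replaced by continuous functions in mean. The uniform law is known only
  through orthogonal invariance. Reflections show that the law of u . X depends only on |u|, and
  this one fact yields the moments, the characteristic function, the absence of atoms (hence
  \<open>q\<close>) and the degeneracy of the kernels. The factor 2 in the identity for
  \<open>W\<close> arises because each pair of points is seen from both its ends. Second moments
  would not suffice for chaining: 2^l increments of variance 2^-l have total variance of order 1,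
  whereas the squared variances add up to 2^-l. The linear term (v - u) / n costs a constant
  n^(-1/4) at every level, so the number of levels must be small against n^(1/4).\<close>

definition bdd_meas :: "'a measure \<Rightarrow> ('a \<Rightarrow> 'b::{banach, second_countable_topology}) \<Rightarrow> bool" where
  "bdd_meas M f \<longleftrightarrow> f \<in> borel_measurable M \<and> (\<exists>B. \<forall>x\<in>space M. norm (f x) \<le> B)"

lemma bdd_measI:
  "f \<in> borel_measurable M \<Longrightarrow> (\<And>x. x \<in> space M \<Longrightarrow> norm (f x) \<le> B) \<Longrightarrow> bdd_meas M f"
  unfolding bdd_meas_def by blast

lemma bdd_meas_measurable: "bdd_meas M f \<Longrightarrow> f \<in> borel_measurable M"
  unfolding bdd_meas_def by blast

lemma bdd_meas_const: "bdd_meas M (\<lambda>_. c)"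
  by (rule bdd_measI[of _ _ "norm c"]) auto

lemma bdd_meas_add:
  assumes "bdd_meas M f" "bdd_meas M g"
  shows "bdd_meas M (\<lambda>x. f x + g x)"
proof -
  from assms obtain B C where "\<forall>x\<in>space M. norm (f x) \<le> B" "\<forall>x\<in>space M. norm (g x) \<le> C"
    unfolding bdd_meas_def by blast
  then have "\<And>x. x \<in> space M \<Longrightarrow> norm (f x + g x) \<le> B + C"
    by (meson add_mono norm_triangle_ineq order_trans)
  then show ?thesis
    using assms by (intro bdd_measI borel_measurable_add) (auto dest: bdd_meas_measurable)
qed

lemma bdd_meas_mult:
  fixes f g :: "'a \<Rightarrow> 'b::{real_normed_algebra, banach, second_countable_topology}"
  assumes "bdd_meas M f" "bdd_meas M g"
  shows "bdd_meas M (\<lambda>x. f x * g x)"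
proof -
  from assms obtain B C where BC: "\<forall>x\<in>space M. norm (f x) \<le> B" "\<forall>x\<in>space M. norm (g x) \<le> C"
    unfolding bdd_meas_def by blast
  have "norm (f x * g x) \<le> B * C" if "x \<in> space M" for x
  proof -
    have "norm (f x * g x) \<le> norm (f x) * norm (g x)" by (rule norm_mult_ineq)
    also have "\<dots> \<le> B * C"
      using BC that by (intro mult_mono) (auto intro: order_trans[OF norm_ge_zero])
    finally show ?thesis .
  qed
  then show ?thesis
    using assms by (intro bdd_measI borel_measurable_times) (auto dest: bdd_meas_measurable)
qed

lemma bdd_meas_uminus: "bdd_meas M f \<Longrightarrow> bdd_meas M (\<lambda>x. - f x)"
  unfolding bdd_meas_def by auto

lemma bdd_meas_diff: "bdd_meas M f \<Longrightarrow> bdd_meas M g \<Longrightarrow> bdd_meas M (\<lambda>x. f x - g x)"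
  using bdd_meas_add[of M f "\<lambda>x. - g x"] bdd_meas_uminus[of M g] by simp

lemma bdd_meas_sum: "(\<And>i. i \<in> I \<Longrightarrow> bdd_meas M (f i)) \<Longrightarrow> bdd_meas M (\<lambda>x. \<Sum>i\<in>I. f i x)"
  by (induction I rule: infinite_finite_induct) (auto intro: bdd_meas_const bdd_meas_add)

lemma bdd_meas_prod:
  fixes f :: "'i \<Rightarrow> 'a \<Rightarrow> 'b::{real_normed_field, banach, second_countable_topology}"
  shows "(\<And>i. i \<in> I \<Longrightarrow> bdd_meas M (f i)) \<Longrightarrow> bdd_meas M (\<lambda>x. \<Prod>i\<in>I. f i x)"
  by (induction I rule: infinite_finite_induct) (auto intro: bdd_meas_const bdd_meas_mult)

lemma bdd_meas_power:
  fixes f :: "'a \<Rightarrow> 'b::{real_normed_field, banach, second_countable_topology}"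
  shows "bdd_meas M f \<Longrightarrow> bdd_meas M (\<lambda>x. f x ^ k)"
  by (induction k) (auto intro: bdd_meas_const bdd_meas_mult)

lemma bdd_meas_norm: "bdd_meas M f \<Longrightarrow> bdd_meas M (\<lambda>x. norm (f x))"
  unfolding bdd_meas_def by auto

lemma bdd_meas_abs: "bdd_meas M f \<Longrightarrow> bdd_meas M (\<lambda>x. \<bar>f x :: real\<bar>)"
  using bdd_meas_norm[of M f] by simp

lemma bdd_meas_of_real: "bdd_meas M f \<Longrightarrow> bdd_meas M (\<lambda>x. complex_of_real (f x))"
  unfolding bdd_meas_def by auto

lemma bdd_meas_iexp: "f \<in> borel_measurable M \<Longrightarrow> bdd_meas M (\<lambda>x. iexp (f x))"
  by (rule bdd_measI[of _ _ 1]) auto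

lemma bdd_meas_iexp': "bdd_meas M f \<Longrightarrow> bdd_meas M (\<lambda>x. iexp (f x))"
  by (rule bdd_meas_iexp[OF bdd_meas_measurable])

lemma bdd_meas_compose: "bdd_meas N g \<Longrightarrow> f \<in> measurable M N \<Longrightarrow> bdd_meas M (\<lambda>x. g (f x))"
  unfolding bdd_meas_def by (auto intro!: measurable_compose[of f M N g] dest: measurable_space)

lemma bdd_meas_component:
  "bdd_meas M g \<Longrightarrow> i \<in> I \<Longrightarrow> bdd_meas (PiM I (\<lambda>_. M)) (\<lambda>x. g (x i))"
  by (rule bdd_meas_compose[where N = M]) auto

lemma bdd_meas_component2:
  assumes "bdd_meas (M \<Otimes>\<^sub>M M) (\<lambda>(x, y). h x y)" "i \<in> I" "j \<in> I"
  shows "bdd_meas (PiM I (\<lambda>_. M)) (\<lambda>x. h (x i) (x j))"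
  using bdd_meas_compose[OF assms(1), of "\<lambda>x. (x i, x j)" "PiM I (\<lambda>_. M)"] assms(2,3)
  by simp

text \<open>The bound holds at every point of the space, so it survives freezing one variable; an
  almost-everywhere bound would be lost for exceptional frozen values.\<close>

lemma bdd_meas_section:
  assumes "bdd_meas (M \<Otimes>\<^sub>M N) (\<lambda>(x, y). h x y)" "x \<in> space M"
  shows "bdd_meas N (h x)"
  using bdd_meas_compose[OF assms(1), of "\<lambda>y. (x, y)" N] assms(2) by simp

lemma bdd_meas_section':
  assumes "bdd_meas (M \<Otimes>\<^sub>M N) (\<lambda>(x, y). h x y)" "y \<in> space N"
  shows "bdd_meas M (\<lambda>x. h x y)"
  using bdd_meas_compose[OF assms(1), of "\<lambda>x. (x, y)" M] assms(2) by simp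

lemmas bdd_meas_intros = bdd_meas_const bdd_meas_add bdd_meas_mult bdd_meas_uminus bdd_meas_diff
  bdd_meas_sum bdd_meas_prod bdd_meas_power bdd_meas_norm bdd_meas_abs bdd_meas_of_real
  bdd_meas_iexp'

lemma (in prob_space) integrable_bdd_meas: "bdd_meas M f \<Longrightarrow> integrable M f"
  unfolding bdd_meas_def by (auto intro: integrable_const_bound)

lemma (in prob_space) bdd_meas_integral:
  assumes "bdd_meas (N \<Otimes>\<^sub>M M) (\<lambda>(x, y). h x y)"
  shows "bdd_meas N (\<lambda>x. \<integral>y. h x y \<partial>M)"
proof -
  from assms obtain B where B: "\<And>x y. x \<in> space N \<Longrightarrow> y \<in> space M \<Longrightarrow> norm (h x y) \<le> B"
    and m: "(\<lambda>(x, y). h x y) \<in> borel_measurable (N \<Otimes>\<^sub>M M)"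
    unfolding bdd_meas_def by (force simp: space_pair_measure)
  show ?thesis
  proof (rule bdd_measI[of _ _ B])
    show "(\<lambda>x. \<integral>y. h x y \<partial>M) \<in> borel_measurable N"
      using m by (rule borel_measurable_lebesgue_integral)
    fix x assume x: "x \<in> space N"
    have "norm (\<integral>y. h x y \<partial>M) \<le> (\<integral>y. norm (h x y) \<partial>M)" by (rule integral_norm_bound)
    also have "\<dots> \<le> (\<integral>y. B \<partial>M)"
      using x B by (intro integral_mono integrable_bdd_meas bdd_meas_norm bdd_meas_const
        bdd_meas_section[OF assms]) auto
    finally show "norm (\<integral>y. h x y \<partial>M) \<le> B" by (simp add: prob_space)
  qed
qed

lemma (in prob_space) integral_le_const:
  fixes f :: "'a \<Rightarrow> real"
  assumes "bdd_meas M f" "\<And>x. x \<in> space M \<Longrightarrow> f x \<le> B"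
  shows "(\<integral>x. f x \<partial>M) \<le> B"
proof -
  have "(\<integral>x. f x \<partial>M) \<le> (\<integral>x. B \<partial>M)"
    using assms by (intro integral_mono integrable_bdd_meas bdd_meas_const) auto
  then show ?thesis by (simp add: prob_space)
qed

lemma (in prob_space) norm_integral_le:
  assumes "bdd_meas M f" "bdd_meas M g" "\<And>x. x \<in> space M \<Longrightarrow> norm (f x) \<le> g x"
  shows "norm (\<integral>x. f x \<partial>M) \<le> (\<integral>x. g x \<partial>M)"
proof -
  have "norm (\<integral>x. f x \<partial>M) \<le> (\<integral>x. norm (f x) \<partial>M)" by (rule integral_norm_bound)
  also have "\<dots> \<le> (\<integral>x. g x \<partial>M)"
    using assms by (intro integral_mono integrable_bdd_meas bdd_meas_norm) auto
  finally show ?thesis .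
qed

text \<open>This is nonnegativity of the variance of |f|; \<open>m\<close> is the mean of
  |f|.\<close>

lemma (in prob_space) integral_abs_le_sqrt:
  fixes f :: "'a \<Rightarrow> real"
  assumes f: "bdd_meas M f"
  shows "(\<integral>x. \<bar>f x\<bar> \<partial>M) \<le> sqrt (\<integral>x. (f x)\<^sup>2 \<partial>M)"
proof (rule real_le_rsqrt)
  define m where "m = (\<integral>x. \<bar>f x\<bar> \<partial>M)"
  have "0 \<le> (\<integral>x. (\<bar>f x\<bar> - m)\<^sup>2 \<partial>M)" by simp
  also have "\<dots> = (\<integral>x. (f x)\<^sup>2 - 2 * m * \<bar>f x\<bar> + m\<^sup>2 \<partial>M)"
    by (simp add: power2_diff algebra_simps)
  also have "\<dots> = (\<integral>x. (f x)\<^sup>2 \<partial>M) - 2 * m * m + m\<^sup>2"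
    using integrable_bdd_meas[OF bdd_meas_abs[OF f]] integrable_bdd_meas[OF bdd_meas_power[OF f]]
    by (simp add: prob_space m_def)
  finally show "(\<integral>x. \<bar>f x\<bar> \<partial>M)\<^sup>2 \<le> (\<integral>x. (f x)\<^sup>2 \<partial>M)"
    by (simp add: m_def power2_eq_square)
qed

text \<open>Conditioning on all coordinates but \<open>j\<close>: the inner integral runs over the
  value \<open>y\<close> put back at \<open>j\<close>. The inductions over sample points rest on
  it.\<close>

lemma (in prob_space) integral_PiM_insert:
  fixes f :: "('i \<Rightarrow> 'a) \<Rightarrow> 'b::{banach, second_countable_topology}"
  assumes "finite J" "j \<notin> J" "bdd_meas (PiM (insert j J) (\<lambda>_. M)) f"
  shows "(\<integral>x. f x \<partial>PiM (insert j J) (\<lambda>_. M)) = (\<integral>x. \<integral>y. f (x(j := y)) \<partial>M \<partial>PiM J (\<lambda>_. M))"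
proof -
  interpret product_prob_space "\<lambda>_. M" "insert j J" by unfold_locales
  interpret P: prob_space "PiM (insert j J) (\<lambda>_. M)" by (rule prob_space_PiM) unfold_locales
  show ?thesis
    using assms by (intro product_integral_insert P.integrable_bdd_meas)
qed

text \<open>One summand is added at a time and integrated out first; its zero mean removes the terms
  linear in it. The cross term 4 t S then vanishes because S has mean 0, and 3 m^2 + 6 m <= 3 (m +
  1)^2 closes the fourth moment.\<close>

lemma (in prob_space) iid_sum_moments:
  fixes \<eta> :: "'a \<Rightarrow> real"
  assumes \<eta>: "bdd_meas M \<eta>" and mean: "expectation \<eta> = 0" and J: "finite (J :: 'i set)"
  shows "(\<integral>x. (\<Sum>i\<in>J. \<eta> (x i)) \<partial>PiM J (\<lambda>_. M)) = 0" (is ?A)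
    and "(\<integral>x. (\<Sum>i\<in>J. \<eta> (x i))\<^sup>2 \<partial>PiM J (\<lambda>_. M)) = card J * expectation (\<lambda>y. (\<eta> y)\<^sup>2)" (is ?B)
    and "(\<integral>x. (\<Sum>i\<in>J. \<eta> (x i)) ^ 4 \<partial>PiM J (\<lambda>_. M))
      \<le> card J * expectation (\<lambda>y. \<eta> y ^ 4) + 3 * (real (card J))\<^sup>2 * (expectation (\<lambda>y. (\<eta> y)\<^sup>2))\<^sup>2" (is ?C)
proof -
  define v where "v = expectation (\<lambda>y. (\<eta> y)\<^sup>2)"
  define f where "f = expectation (\<lambda>y. \<eta> y ^ 4)"
  define t where "t = expectation (\<lambda>y. \<eta> y ^ 3)"
  have "?A \<and> ?B \<and> ?C"
    using J
  proof induction
    case empty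
    interpret P: prob_space "PiM {} (\<lambda>_. M)" by (rule prob_space_PiM) unfold_locales
    show ?case by simp
  next
    case (insert j J)
    interpret P: prob_space "PiM J (\<lambda>_. M)" by (rule prob_space_PiM) unfold_locales
    define S where "S x = (\<Sum>i\<in>J. \<eta> (x i))" for x :: "'i \<Rightarrow> 'a"
    have S: "bdd_meas (PiM J (\<lambda>_. M)) S"
      unfolding S_def by (intro bdd_meas_intros bdd_meas_component[OF \<eta>])
    note iS = P.integrable_bdd_meas[OF bdd_meas_power[OF S]] P.integrable_bdd_meas[OF S]
    note i\<eta> = integrable_bdd_meas[OF bdd_meas_power[OF \<eta>]] integrable_bdd_meas[OF \<eta>]
    have upd: "(\<Sum>i\<in>insert j J. \<eta> ((x(j := y)) i)) = S x + \<eta> y" for x y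
      using insert unfolding S_def by (auto intro!: sum.cong)
    have eq: "(\<integral>x. (\<Sum>i\<in>insert j J. \<eta> (x i)) ^ k \<partial>PiM (insert j J) (\<lambda>_. M))
        = (\<integral>x. \<integral>y. (S x + \<eta> y) ^ k \<partial>M \<partial>PiM J (\<lambda>_. M))" for k
      unfolding upd[symmetric] using insert(1,2)
      by (intro integral_PiM_insert bdd_meas_intros bdd_meas_component[OF \<eta>])
    have IH: "(\<integral>x. S x \<partial>PiM J (\<lambda>_. M)) = 0" "(\<integral>x. (S x)\<^sup>2 \<partial>PiM J (\<lambda>_. M)) = card J * v"
      "(\<integral>x. (S x) ^ 4 \<partial>PiM J (\<lambda>_. M)) \<le> card J * f + 3 * (real (card J))\<^sup>2 * v\<^sup>2"
      using insert unfolding S_def v_def f_def by auto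
    have c: "card (insert j J) = Suc (card J)" using insert by simp
    have 1: "(\<integral>x. (\<Sum>i\<in>insert j J. \<eta> (x i)) \<partial>PiM (insert j J) (\<lambda>_. M)) = 0"
      using eq[of 1] IH mean i\<eta> iS by (simp add: prob_space P.prob_space)
    have "(\<integral>y. (s + \<eta> y)\<^sup>2 \<partial>M) = s\<^sup>2 + v" for s
    proof -
      have "(\<integral>y. (s + \<eta> y)\<^sup>2 \<partial>M) = (\<integral>y. s\<^sup>2 + 2 * s * \<eta> y + (\<eta> y)\<^sup>2 \<partial>M)"
        by (simp add: power2_sum algebra_simps)
      also have "\<dots> = s\<^sup>2 + v"
        using i\<eta> mean by (simp add: v_def prob_space)
      finally show ?thesis .
    qed
    then have 2: "(\<integral>x. (\<Sum>i\<in>insert j J. \<eta> (x i))\<^sup>2 \<partial>PiM (insert j J) (\<lambda>_. M)) = card (insert j J) * v"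
      using eq[of 2] IH iS by (simp add: c algebra_simps P.prob_space)
    have "(\<integral>y. (s + \<eta> y) ^ 4 \<partial>M) = s ^ 4 + 6 * v * s\<^sup>2 + 4 * t * s + f" for s
    proof -
      have "(s + \<eta> y) ^ 4 = s ^ 4 + 4 * s ^ 3 * \<eta> y + 6 * s\<^sup>2 * (\<eta> y)\<^sup>2 + 4 * s * \<eta> y ^ 3 + \<eta> y ^ 4" for y
        by (simp add: eval_nat_numeral algebra_simps)
      then have "(\<integral>y. (s + \<eta> y) ^ 4 \<partial>M)
        = (\<integral>y. s ^ 4 + 4 * s ^ 3 * \<eta> y + 6 * s\<^sup>2 * (\<eta> y)\<^sup>2 + 4 * s * \<eta> y ^ 3 + \<eta> y ^ 4 \<partial>M)"
        by simp
      also have "\<dots> = s ^ 4 + 6 * v * s\<^sup>2 + 4 * t * s + f"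
        using i\<eta> mean by (simp add: v_def t_def f_def prob_space)
      finally show ?thesis .
    qed
    then have "(\<integral>x. (\<Sum>i\<in>insert j J. \<eta> (x i)) ^ 4 \<partial>PiM (insert j J) (\<lambda>_. M))
      = (\<integral>x. S x ^ 4 + 6 * v * (S x)\<^sup>2 + 4 * t * S x + f \<partial>PiM J (\<lambda>_. M))"
      using eq[of 4] by simp
    also have "\<dots> = (\<integral>x. S x ^ 4 \<partial>PiM J (\<lambda>_. M)) + 6 * v * (card J * v) + f"
      using iS IH by (simp add: P.prob_space)
    also have "\<dots> \<le> card (insert j J) * f + 3 * (real (card (insert j J)))\<^sup>2 * v\<^sup>2"
    proof -
      have "3 * (real (card (insert j J)))\<^sup>2 * v\<^sup>2 = 3 * (real (card J))\<^sup>2 * v\<^sup>2 + 6 * v * (card J * v) + 3 * v\<^sup>2"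
        unfolding c by (simp add: power2_eq_square algebra_simps)
      moreover have "real (card (insert j J)) * f = card J * f + f"
        unfolding c by (simp add: algebra_simps)
      ultimately show ?thesis using IH(3) zero_le_power2[of v] by linarith
    qed
    finally have 4: "(\<integral>x. (\<Sum>i\<in>insert j J. \<eta> (x i)) ^ 4 \<partial>PiM (insert j J) (\<lambda>_. M))
      \<le> card (insert j J) * f + 3 * (real (card (insert j J)))\<^sup>2 * v\<^sup>2" .
    show ?case using 1 2 4 unfolding v_def f_def by auto
  qed
  then show ?A ?B ?C by auto
qed

lemma bdd_meas_indicator: "A \<in> sets M \<Longrightarrow> bdd_meas M (indicator A :: _ \<Rightarrow> real)"
  by (rule bdd_measI[of _ _ 1]) (auto simp: indicator_def)

lemma (in prob_space) integral_affine:
  fixes f :: "'a \<Rightarrow> real"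
  shows "bdd_meas M f \<Longrightarrow> (\<integral>x. a + b * f x \<partial>M) = a + b * (\<integral>x. f x \<partial>M)"
  using integrable_bdd_meas[of f] by (simp add: prob_space)

lemma (in prob_space) integral_pair_bdd:
  fixes f :: "'a \<times> 'c \<Rightarrow> 'b::{banach, second_countable_topology}"
  assumes "prob_space N" "bdd_meas (M \<Otimes>\<^sub>M N) f"
  shows "(\<integral>z. f z \<partial>(M \<Otimes>\<^sub>M N)) = (\<integral>x. \<integral>y. f (x, y) \<partial>N \<partial>M)"
proof -
  interpret N: prob_space N by fact
  interpret MN: pair_prob_space M N ..
  show ?thesis
    by (rule MN.integral_fst'[symmetric]) (rule MN.integrable_bdd_meas[OF assms(2)])
qed

lemma bdd_meas_pair_section:
  assumes "bdd_meas (M \<Otimes>\<^sub>M N) f" "x \<in> space M"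
  shows "bdd_meas N (\<lambda>y. f (x, y))"
  using bdd_meas_compose[OF assms(1), of "\<lambda>y. (x, y)" N] assms(2) by simp

lemma bdd_meas_of_bool_le:
  fixes f :: "'a \<Rightarrow> real"
  assumes "f \<in> borel_measurable M"
  shows "bdd_meas M (\<lambda>x. of_bool (f x \<le> t) :: real)"
proof (rule bdd_measI[of _ _ 1])
  have "(\<lambda>x. of_bool (f x \<le> t) :: real) = (\<lambda>x. indicator {..t} (f x))"
    by (auto simp: indicator_def)
  then show "(\<lambda>x. of_bool (f x \<le> t) :: real) \<in> borel_measurable M"
    using assms by simp
qed simp

lemma (in prob_space) integral_of_bool_le:
  fixes f :: "'a \<Rightarrow> real"
  shows "(\<integral>x. of_bool (f x \<le> t) \<partial>M) = prob {x \<in> space M. f x \<le> t}"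
proof -
  have "(\<integral>x. of_bool (f x \<le> t) \<partial>M) = (\<integral>x. indicator {x \<in> space M. f x \<le> t} x \<partial>M)"
    by (rule Bochner_Integration.integral_cong) (auto simp: indicator_def)
  also have "\<dots> = prob ({x \<in> space M. f x \<le> t} \<inter> space M)"
    by (rule Bochner_Integration.integral_indicator)
  also have "{x \<in> space M. f x \<le> t} \<inter> space M = {x \<in> space M. f x \<le> t}" by auto
  finally show ?thesis .
qed

section \<open>Degenerate U-statistics\<close>

text \<open>Ordered pairs are summed, which avoids an order on the index type; for a symmetric
  kernel each unordered pair counts twice, and a new point contributes twice its row sum.\<close>

definition ustat :: "('a \<Rightarrow> 'a \<Rightarrow> real) \<Rightarrow> 'i set \<Rightarrow> ('i \<Rightarrow> 'a) \<Rightarrow> real" where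
  "ustat h I x = (\<Sum>i\<in>I. \<Sum>j\<in>I - {i}. h (x i) (x j))"

lemma ustat_insert:
  assumes "finite J" "j \<notin> J" and sym: "\<And>x y. h x y = h y x"
  shows "ustat h (insert j J) x = ustat h J x + 2 * (\<Sum>i\<in>J. h (x i) (x j))"
proof -
  have "(\<Sum>k\<in>insert j J - {i}. h (x i) (x k)) = (\<Sum>k\<in>J - {i}. h (x i) (x k)) + h (x i) (x j)"
    if "i \<in> J" for i
  proof -
    have "insert j J - {i} = insert j (J - {i})" using that assms by auto
    then show ?thesis using assms that by simp
  qed
  moreover have "insert j J - {j} = J" using assms by auto
  moreover have "(\<Sum>k\<in>J. h (x j) (x k)) = (\<Sum>k\<in>J. h (x k) (x j))" by (simp add: sym)
  ultimately show ?thesis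
    using assms unfolding ustat_def by (simp add: sum.distrib)
qed

lemma ustat_upd: "j \<notin> J \<Longrightarrow> ustat h J (x(j := y)) = ustat h J x"
  unfolding ustat_def by (intro sum.cong) auto

lemma bdd_meas_ustat:
  "bdd_meas (M \<Otimes>\<^sub>M M) (\<lambda>(x, y). h x y) \<Longrightarrow> J \<subseteq> I \<Longrightarrow> bdd_meas (PiM I (\<lambda>_. M)) (ustat h J)"
  unfolding ustat_def[abs_def]
  by (intro bdd_meas_intros bdd_meas_component2) auto

text \<open>Kept apart from \<open>degenerate_kernel\<close> because the second-moment bound must
  also apply to \<open>cov_kernel\<close>, whose row variance need not be constant.\<close>

locale mean_zero_kernel = prob_space M for M :: "'a measure" +
  fixes h :: "'a \<Rightarrow> 'a \<Rightarrow> real"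
  assumes h_bdd: "bdd_meas (M \<Otimes>\<^sub>M M) (\<lambda>(x, y). h x y)"
    and h_sym: "h x y = h y x"
    and h_mean: "x \<in> space M \<Longrightarrow> (\<integral>y. h x y \<partial>M) = 0"
begin

lemma h_mean': "y \<in> space M \<Longrightarrow> (\<integral>x. h x y \<partial>M) = 0"
  using h_mean[of y] h_sym[of y] by simp

text \<open>The added row sum D is centred given the other points, hence orthogonal to S; with the
  new point frozen instead, D is an i.i.d. sum. Its contribution is 4 m times the second moment of
  \<open>h\<close>, and 2 m^2 + 4 m <= 2 (m + 1)^2.\<close>

lemma ustat_second_moment:
  assumes "finite (J :: 'i set)"
  shows "(\<integral>x. (ustat h J x)\<^sup>2 \<partial>PiM J (\<lambda>_. M)) \<le> 2 * (real (card J))\<^sup>2 * (\<integral>x. \<integral>y. (h x y)\<^sup>2 \<partial>M \<partial>M)"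
  using assms
proof induction
  case empty
  then show ?case by (simp add: ustat_def)
next
  case (insert j J)
  let ?\<gamma> = "\<integral>x. \<integral>y. (h x y)\<^sup>2 \<partial>M \<partial>M"
  interpret J: prob_space "PiM J (\<lambda>_. M)" by (rule prob_space_PiM) unfold_locales
  interpret I: prob_space "PiM (insert j J) (\<lambda>_. M)" by (rule prob_space_PiM) unfold_locales
  interpret MM: pair_sigma_finite M M ..
  interpret MJ: pair_sigma_finite "PiM J (\<lambda>_. M)" M ..
  interpret MM': pair_prob_space M M ..
  define S where "S = ustat h J"
  define D where "D x y = (\<Sum>i\<in>J. h (x i) y)" for x :: "'i \<Rightarrow> 'a" and y
  have D: "bdd_meas (PiM (insert j J) (\<lambda>_. M)) (\<lambda>x. D x (x j))"
    unfolding D_def by (intro bdd_meas_intros bdd_meas_component2[OF h_bdd]) auto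
  have DJ: "bdd_meas M (D x)" if "x \<in> space (PiM J (\<lambda>_. M))" for x
    unfolding D_def using that
    by (intro bdd_meas_intros bdd_meas_section[OF h_bdd]) (auto simp: space_PiM PiE_iff)
  have DJ': "bdd_meas (PiM J (\<lambda>_. M)) (\<lambda>x. D x y)" if "y \<in> space M" for y
    unfolding D_def using that
    by (intro bdd_meas_intros bdd_meas_component bdd_meas_section'[OF h_bdd])
  have D2: "bdd_meas (PiM J (\<lambda>_. M) \<Otimes>\<^sub>M M) (\<lambda>(x, y). (D x y)\<^sup>2)"
    unfolding D_def case_prod_beta
    by (intro bdd_meas_intros bdd_meas_compose[OF h_bdd[unfolded case_prod_beta],
      of "\<lambda>x. (fst x i, snd x)" for i, simplified]) auto
  have SI: "bdd_meas (PiM (insert j J) (\<lambda>_. M)) S"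
    unfolding S_def by (rule bdd_meas_ustat[OF h_bdd]) auto
  have SJ: "bdd_meas (PiM J (\<lambda>_. M)) S"
    unfolding S_def by (rule bdd_meas_ustat[OF h_bdd]) auto
  have S_upd: "S (x(j := y)) = S x" for x y
    unfolding S_def using insert by (simp add: ustat_upd)
  have D_upd: "D (x(j := y)) z = D x z" for x y z
    unfolding D_def using insert by (auto intro!: sum.cong)
  have mean_D: "(\<integral>y. D x y \<partial>M) = 0" if "x \<in> space (PiM J (\<lambda>_. M))" for x
    unfolding D_def using that
    by (subst Bochner_Integration.integral_sum)
      (auto intro!: integrable_bdd_meas bdd_meas_section[OF h_bdd] sum.neutral h_mean
        simp: space_PiM PiE_iff)
  have "(\<integral>x. (ustat h (insert j J) x)\<^sup>2 \<partial>PiM (insert j J) (\<lambda>_. M))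
    = (\<integral>x. (S x + 2 * D x (x j))\<^sup>2 \<partial>PiM (insert j J) (\<lambda>_. M))"
    using insert by (simp add: S_def D_def ustat_insert h_sym)
  also have "\<dots> = (\<integral>x. \<integral>y. (S x + 2 * D x y)\<^sup>2 \<partial>M \<partial>PiM J (\<lambda>_. M))"
    using insert SI D
    by (subst integral_PiM_insert) (auto intro!: bdd_meas_intros simp: S_upd D_upd)
  also have "\<dots> = (\<integral>x. (S x)\<^sup>2 + 4 * (\<integral>y. (D x y)\<^sup>2 \<partial>M) \<partial>PiM J (\<lambda>_. M))"
  proof (rule Bochner_Integration.integral_cong[OF refl])
    fix x assume x: "x \<in> space (PiM J (\<lambda>_. M))"
    note i = integrable_bdd_meas[OF DJ[OF x]] integrable_bdd_meas[OF bdd_meas_power[OF DJ[OF x]]]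
    have "(\<integral>y. (S x + 2 * D x y)\<^sup>2 \<partial>M) = (\<integral>y. (S x)\<^sup>2 + 4 * S x * D x y + 4 * (D x y)\<^sup>2 \<partial>M)"
      by (simp add: power2_eq_square algebra_simps)
    then show "(\<integral>y. (S x + 2 * D x y)\<^sup>2 \<partial>M) = (S x)\<^sup>2 + 4 * (\<integral>y. (D x y)\<^sup>2 \<partial>M)"
      using i mean_D[OF x] by (simp add: prob_space)
  qed
  also have "\<dots> = (\<integral>x. (S x)\<^sup>2 \<partial>PiM J (\<lambda>_. M)) + 4 * (\<integral>x. \<integral>y. (D x y)\<^sup>2 \<partial>M \<partial>PiM J (\<lambda>_. M))"
    using J.integrable_bdd_meas[OF bdd_meas_power[OF SJ]]
      J.integrable_bdd_meas[OF bdd_meas_integral[OF D2]] by simp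
  also have "(\<integral>x. \<integral>y. (D x y)\<^sup>2 \<partial>M \<partial>PiM J (\<lambda>_. M)) = (\<integral>y. \<integral>x. (D x y)\<^sup>2 \<partial>PiM J (\<lambda>_. M) \<partial>M)"
  proof -
    interpret MJp: pair_prob_space "PiM J (\<lambda>_. M)" M ..
    show ?thesis
      by (rule MJ.Fubini_integral[symmetric]) (rule MJp.integrable_bdd_meas[OF D2])
  qed
  also have "\<dots> = (\<integral>y. card J * (\<integral>x. (h x y)\<^sup>2 \<partial>M) \<partial>M)"
    unfolding D_def
    by (rule Bochner_Integration.integral_cong[OF refl], rule iid_sum_moments)
      (auto intro!: bdd_meas_section'[OF h_bdd] h_mean' insert)
  also have "\<dots> = card J * ?\<gamma>"
    by (simp add: h_sym)
  finally have "(\<integral>x. (ustat h (insert j J) x)\<^sup>2 \<partial>PiM (insert j J) (\<lambda>_. M))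
    \<le> 2 * (real (card J))\<^sup>2 * ?\<gamma> + 4 * (card J * ?\<gamma>)"
    using insert.IH by (simp add: S_def)
  also have "\<dots> \<le> 2 * (real (card (insert j J)))\<^sup>2 * ?\<gamma>"
    using insert by (simp add: power2_eq_square algebra_simps)
  finally show ?case .
qed

end


section \<open>Characteristic function of a degenerate U-statistic\<close>

lemma (in prob_space) char_approx_derivative:
  assumes U: "bdd_meas M U"
  shows "((\<lambda>t. \<integral>x. iexp (t * U x) \<partial>M) has_vector_derivative (\<integral>x. \<i> * U x * iexp (t * U x) \<partial>M)) (at t)"
proof -
  define \<phi> where "\<phi> t = (\<integral>x. iexp (t * U x) \<partial>M)" for t
  define \<phi>' where "\<phi>' = (\<integral>x. \<i> * U x * iexp (t * U x) \<partial>M)"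
  have iE: "bdd_meas M (\<lambda>x. iexp (t * U x))" for t
    by (intro bdd_meas_intros U)
  have i': "bdd_meas M (\<lambda>x. \<i> * U x * iexp (t * U x))"
    by (intro bdd_meas_intros U)
  have est: "norm (\<phi> u - \<phi> t - (u - t) *\<^sub>R \<phi>') \<le> (\<integral>x. (U x)\<^sup>2 \<partial>M) * (u - t)\<^sup>2" for u
  proof -
    have "\<phi> u - \<phi> t - (u - t) *\<^sub>R \<phi>'
        = (\<integral>x. iexp (u * U x) - iexp (t * U x) - (u - t) *\<^sub>R (\<i> * U x * iexp (t * U x)) \<partial>M)"
      unfolding \<phi>_def \<phi>'_def using integrable_bdd_meas[OF iE] integrable_bdd_meas[OF i'] by simp
    also have "norm \<dots> \<le> (\<integral>x. (U x)\<^sup>2 * (u - t)\<^sup>2 \<partial>M)"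
    proof (rule norm_integral_le)
      show "bdd_meas M (\<lambda>x. iexp (u * U x) - iexp (t * U x) - (u - t) *\<^sub>R (\<i> * U x * iexp (t * U x)))"
        unfolding scaleR_conv_of_real by (intro bdd_meas_intros U)
      show "bdd_meas M (\<lambda>x. (U x)\<^sup>2 * (u - t)\<^sup>2)"
        by (intro bdd_meas_intros U)
      fix x
      let ?d = "(u - t) * U x"
      have "iexp (u * U x) = iexp (t * U x) * iexp ?d"
        by (simp add: exp_add[symmetric] algebra_simps)
      then have "norm (iexp (u * U x) - iexp (t * U x) - (u - t) *\<^sub>R (\<i> * U x * iexp (t * U x)))
          = norm (iexp (t * U x) * (iexp ?d - (1 + \<i> * ?d)))"
        by (simp add: algebra_simps scaleR_conv_of_real)
      also have "\<dots> = norm (iexp ?d - (1 + \<i> * ?d))"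
        by (simp add: norm_mult)
      also have "\<dots> \<le> ?d\<^sup>2 / 2"
        using iexp_approx1[of ?d 1] by (simp add: numeral_2_eq_2)
      also have "\<dots> \<le> (U x)\<^sup>2 * (u - t)\<^sup>2"
        by (simp add: power_mult_distrib)
      finally show "norm (iexp (u * U x) - iexp (t * U x) - (u - t) *\<^sub>R (\<i> * U x * iexp (t * U x)))
        \<le> (U x)\<^sup>2 * (u - t)\<^sup>2" .
    qed
    finally show ?thesis by simp
  qed
  have "((\<lambda>u. norm ((\<phi> u - \<phi> t - (u - t) *\<^sub>R \<phi>') /\<^sub>R norm (u - t))) \<longlongrightarrow> 0) (at t)"
  proof (rule tendsto_sandwich[OF _ _ tendsto_const])
    have "norm ((\<phi> u - \<phi> t - (u - t) *\<^sub>R \<phi>') /\<^sub>R norm (u - t)) \<le> (\<integral>x. (U x)\<^sup>2 \<partial>M) * \<bar>u - t\<bar>" for u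
    proof (cases "u = t")
      case False
      then have "0 < \<bar>u - t\<bar>" by simp
      have "norm ((\<phi> u - \<phi> t - (u - t) *\<^sub>R \<phi>') /\<^sub>R norm (u - t))
          \<le> ((\<integral>x. (U x)\<^sup>2 \<partial>M) * \<bar>u - t\<bar>\<^sup>2) / \<bar>u - t\<bar>"
        using est[of u] by (simp add: divide_inverse mult_left_mono mult.commute)
      also have "\<dots> = (\<integral>x. (U x)\<^sup>2 \<partial>M) * \<bar>u - t\<bar>"
        using \<open>0 < \<bar>u - t\<bar>\<close> unfolding power2_eq_square[of "\<bar>u - t\<bar>"]
        by (simp del: abs_mult_self_eq)
      finally show ?thesis .
    qed simp
    then show "\<forall>\<^sub>F u in at t. norm ((\<phi> u - \<phi> t - (u - t) *\<^sub>R \<phi>') /\<^sub>R norm (u - t)) \<le> (\<integral>x. (U x)\<^sup>2 \<partial>M) * \<bar>u - t\<bar>"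
      by simp
    show "((\<lambda>u. (\<integral>x. (U x)\<^sup>2 \<partial>M) * \<bar>u - t\<bar>) \<longlongrightarrow> 0) (at t)"
      by (auto intro!: tendsto_eq_intros)
  qed auto
  then have "(\<phi> has_vector_derivative \<phi>') (at t)"
    unfolding has_vector_derivative_def has_derivative_at_within
    by (auto intro!: bounded_linear_scaleR_left simp: tendsto_norm_zero_iff algebra_simps)
  then show ?thesis unfolding \<phi>_def[abs_def] \<phi>'_def .
qed

lemma cmod_iexp_diff_le: "cmod (iexp a - iexp b) \<le> \<bar>a - b\<bar>"
proof -
  have "iexp a - iexp b = iexp b * (iexp (a - b) - 1)"
    by (simp add: exp_add[symmetric] algebra_simps)
  then have "cmod (iexp a - iexp b) = cmod (iexp (a - b) - 1)"
    by (simp add: norm_mult)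
  also have "\<dots> \<le> \<bar>a - b\<bar>"
    using iexp_approx1[of "a - b" 0] by simp
  finally show ?thesis .
qed

text \<open>Expand 0 <= (a - |d|)^2 d^2. This bounds a third absolute moment by the second and the
  fourth; \<open>a\<close> will be the typical size of \<open>d\<close>, which balances the two
  terms.\<close>

lemma abs_power3_le:
  fixes d a :: real
  assumes "a > 0"
  shows "\<bar>d\<bar> ^ 3 \<le> (a * d\<^sup>2 + d ^ 4 / a) / 2"
proof -
  have "0 \<le> (a - \<bar>d\<bar>)\<^sup>2 * d\<^sup>2" by simp
  also have "\<dots> = a\<^sup>2 * d\<^sup>2 + d ^ 4 - 2 * a * \<bar>d\<bar> ^ 3"
    by (cases "d \<ge> 0") (auto simp: eval_nat_numeral algebra_simps)
  finally show ?thesis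
    using assms by (simp add: field_simps eval_nat_numeral)
qed

text \<open>A row variance \<open>s\<close> common to all \<open>x\<close> is what rotation
  invariance provides. It makes the diagonal of \<open>cov_kernel\<close> constant, so the leading
  term of the conditional variance of a row sum is deterministic.\<close>

locale degenerate_kernel = mean_zero_kernel +
  fixes C s :: real
  assumes C_pos: "0 < C"
    and h_bound: "\<bar>h x y\<bar> \<le> C"
    and h_var: "x \<in> space M \<Longrightarrow> (\<integral>y. (h x y)\<^sup>2 \<partial>M) = s"
begin

text \<open>The function \<open>G\<close> of the overview; on the diagonal it equals
  \<open>s\<close>.\<close>

definition cov_kernel :: "'a \<Rightarrow> 'a \<Rightarrow> real" where
  "cov_kernel x y = (\<integral>z. h x z * h y z \<partial>M)"

definition cov_norm :: real where
  "cov_norm = (\<integral>x. \<integral>y. (cov_kernel x y)\<^sup>2 \<partial>M \<partial>M)"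

lemma s_le: "s \<le> C\<^sup>2"
proof -
  obtain x where x: "x \<in> space M" using not_empty by blast
  have "(\<integral>y. (h x y)\<^sup>2 \<partial>M) \<le> C\<^sup>2"
    using x h_bound C_pos
    by (intro integral_le_const bdd_meas_intros bdd_meas_section[OF h_bdd]) (auto simp: abs_le_square_iff[symmetric])
  then show ?thesis using h_var[OF x] by simp
qed

lemma s_nonneg: "0 \<le> s"
proof -
  obtain x where x: "x \<in> space M" using not_empty by blast
  have "0 \<le> (\<integral>y. (h x y)\<^sup>2 \<partial>M)" by simp
  then show ?thesis using h_var[OF x] by simp
qed

lemma mean_zero_cov_kernel: "mean_zero_kernel M cov_kernel"
proof
  interpret MM: pair_prob_space M M ..
  have b3: "bdd_meas ((M \<Otimes>\<^sub>M M) \<Otimes>\<^sub>M M) (\<lambda>(p, z). h (fst p) z * h (snd p) z)"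
    unfolding case_prod_beta
    by (intro bdd_meas_intros bdd_meas_compose[OF h_bdd[unfolded case_prod_beta],
        of "\<lambda>q. (fst (fst q), snd q)", simplified]
      bdd_meas_compose[OF h_bdd[unfolded case_prod_beta],
        of "\<lambda>q. (snd (fst q), snd q)", simplified]) auto
  show "bdd_meas (M \<Otimes>\<^sub>M M) (\<lambda>(x, y). cov_kernel x y)"
    using bdd_meas_integral[OF b3] unfolding cov_kernel_def case_prod_beta .
  show "cov_kernel x y = cov_kernel y x" for x y
    unfolding cov_kernel_def by (simp add: mult.commute)
  fix x assume x: "x \<in> space M"
  have i2: "bdd_meas (M \<Otimes>\<^sub>M M) (\<lambda>(z, y). h x z * h y z)"
    unfolding case_prod_beta
    by (intro bdd_meas_intros bdd_meas_compose[OF bdd_meas_section[OF h_bdd x], of fst]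
      bdd_meas_compose[OF h_bdd[unfolded case_prod_beta], of "\<lambda>q. (snd q, fst q)", simplified]) auto
  have "(\<integral>y. cov_kernel x y \<partial>M) = (\<integral>z. \<integral>y. h x z * h y z \<partial>M \<partial>M)"
    unfolding cov_kernel_def
    by (rule MM.Fubini_integral[of "\<lambda>z y. h x z * h y z"])
       (rule MM.integrable_bdd_meas[OF i2])
  also have "\<dots> = (\<integral>z. 0 \<partial>M)"
    by (rule Bochner_Integration.integral_cong) (auto simp: h_mean')
  finally show "(\<integral>y. cov_kernel x y \<partial>M) = 0" by simp
qed

text \<open>With \<open>x j\<close> frozen the summands are i.i.d. and centred, so the i.i.d.
  moments apply for each value of \<open>x j\<close>; Fubini moves the integral over
  \<open>x j\<close> outside.\<close>

lemma row_sum_moments: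
  fixes J :: "'i set" and f :: real
  assumes J: "finite J" "j \<notin> J"
  defines "P \<equiv> PiM (insert j J) (\<lambda>_. M)"
  shows "(\<integral>x. (\<Sum>i\<in>J. h (x i) (x j))\<^sup>2 \<partial>P) = card J * s"
    and "(\<And>y. y \<in> space M \<Longrightarrow> (\<integral>x. h x y ^ 4 \<partial>M) \<le> f) \<Longrightarrow>
      (\<integral>x. (\<Sum>i\<in>J. h (x i) (x j)) ^ 4 \<partial>P) \<le> card J * f + 3 * (real (card J))\<^sup>2 * s\<^sup>2"
proof -
  define PJ where "PJ = PiM J (\<lambda>_. M)"
  interpret J: prob_space PJ unfolding PJ_def by (rule prob_space_PiM) unfold_locales
  interpret I: prob_space P unfolding P_def by (rule prob_space_PiM) unfold_locales
  define D where "D x y = (\<Sum>i\<in>J. h (x i) y)" for x :: "'i \<Rightarrow> 'a" and y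
  have Dj: "bdd_meas P (\<lambda>x. D x (x j))"
    unfolding D_def P_def by (intro bdd_meas_intros bdd_meas_component2[OF h_bdd]) auto
  have D_upd: "D (x(j := y)) z = D x z" for x y z
    unfolding D_def using J by (intro sum.cong) auto
  have swap: "(\<integral>x. D x (x j) ^ k \<partial>P) = (\<integral>y. \<integral>x. D x y ^ k \<partial>PJ \<partial>M)" for k
  proof -
    interpret JM: pair_prob_space PJ M ..
    have "bdd_meas (PJ \<Otimes>\<^sub>M M) (\<lambda>(x, y). D x y ^ k)"
      unfolding D_def case_prod_beta PJ_def
      by (intro bdd_meas_intros bdd_meas_compose[OF h_bdd[unfolded case_prod_beta],
        of "\<lambda>x. (fst x i, snd x)" for i, simplified]) auto
    from JM.Fubini_integral[OF JM.integrable_bdd_meas[OF this]]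
    have "(\<integral>y. \<integral>x. D x y ^ k \<partial>PJ \<partial>M) = (\<integral>x. \<integral>y. D (x(j := y)) ((x(j := y)) j) ^ k \<partial>M \<partial>PJ)"
      by (simp add: D_upd)
    also have "\<dots> = (\<integral>x. D x (x j) ^ k \<partial>P)"
      unfolding P_def PJ_def
      by (rule integral_PiM_insert[symmetric, OF J]) (intro bdd_meas_intros Dj[unfolded P_def])
    finally show ?thesis ..
  qed
  have iid: "bdd_meas M (\<lambda>x. h x y)" "(\<integral>x. h x y \<partial>M) = 0" if "y \<in> space M" for y
    using that by (auto intro!: bdd_meas_section'[OF h_bdd] h_mean')
  have var': "(\<integral>x. (h x y)\<^sup>2 \<partial>M) = s" if "y \<in> space M" for y
    using h_var[OF that] by (simp add: h_sym)
  have "(\<integral>y. \<integral>x. (D x y)\<^sup>2 \<partial>PJ \<partial>M) = (\<integral>y. card J * s \<partial>M)"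
    unfolding D_def PJ_def
    by (rule Bochner_Integration.integral_cong[OF refl])
      (use iid_sum_moments(2)[OF iid J(1)] var' in simp)
  then show "(\<integral>x. (\<Sum>i\<in>J. h (x i) (x j))\<^sup>2 \<partial>P) = card J * s"
    using swap[of 2] by (simp add: D_def prob_space)
  assume f: "\<And>y. y \<in> space M \<Longrightarrow> (\<integral>x. h x y ^ 4 \<partial>M) \<le> f"
  have "(\<integral>y. \<integral>x. D x y ^ 4 \<partial>PJ \<partial>M) \<le> card J * f + 3 * (real (card J))\<^sup>2 * s\<^sup>2"
  proof (rule integral_le_const)
    show "bdd_meas M (\<lambda>y. \<integral>x. D x y ^ 4 \<partial>PJ)"
      unfolding D_def
      by (rule J.bdd_meas_integral, unfold case_prod_beta PJ_def)
        (intro bdd_meas_intros bdd_meas_compose[OF h_bdd[unfolded case_prod_beta],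
        of "\<lambda>x. (snd x i, fst x)" for i, simplified], auto)
    fix y assume y: "y \<in> space M"
    have "(\<integral>x. D x y ^ 4 \<partial>PJ) \<le> card J * (\<integral>x. h x y ^ 4 \<partial>M) + 3 * (real (card J))\<^sup>2 * s\<^sup>2"
      using iid_sum_moments(3)[OF iid[OF y] J(1)] var'[OF y] unfolding D_def PJ_def by simp
    also have "\<dots> \<le> card J * f + 3 * (real (card J))\<^sup>2 * s\<^sup>2"
      using f[OF y] by (intro add_right_mono mult_left_mono) auto
    finally show "(\<integral>x. D x y ^ 4 \<partial>PJ) \<le> card J * f + 3 * (real (card J))\<^sup>2 * s\<^sup>2" .
  qed
  then show "(\<integral>x. (\<Sum>i\<in>J. h (x i) (x j)) ^ 4 \<partial>P) \<le> card J * f + 3 * (real (card J))\<^sup>2 * s\<^sup>2"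
    using swap[of 4] by (simp add: D_def)
qed

text \<open>With \<open>S\<close> the part free of \<open>x j\<close> and \<open>Dj\<close> the row
  sum, U = S + 2 Dj. Expanding the exponential around S, the constant term integrates to 0, the
  linear term leaves Dj^2, whose conditional mean is \<open>N * s\<close> plus the U-statistic of
  \<open>cov_kernel\<close>, and the remainder is cubic in Dj.\<close>

lemma char_ustat_step:
  fixes J :: "'i set"
  assumes J: "finite J" "j \<notin> J" "J \<noteq> {}"
  defines "P \<equiv> PiM (insert j J) (\<lambda>_. M)" and "U \<equiv> ustat h (insert j J)" and "N \<equiv> real (card J)"
  shows "cmod ((\<integral>x. (\<Sum>i\<in>J. h (x i) (x j)) * iexp (\<xi> * U x) \<partial>P)
      - 2 * \<i> * \<xi> * N * s * (\<integral>x. iexp (\<xi> * U x) \<partial>P))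
    \<le> 2 * \<bar>\<xi>\<bar> * N * sqrt (2 * cov_norm) + 9 * \<xi>\<^sup>2 * C ^ 3 * N * sqrt N"
proof -
  define PJ where "PJ = PiM J (\<lambda>_. M)"
  interpret J: prob_space PJ unfolding PJ_def by (rule prob_space_PiM) unfold_locales
  interpret I: prob_space P unfolding P_def by (rule prob_space_PiM) unfold_locales
  interpret G: mean_zero_kernel M cov_kernel by (rule mean_zero_cov_kernel)
  have N: "N > 0" using J unfolding N_def by (simp add: card_gt_0_iff)
  define S where "S = ustat h J"
  define D where "D x y = (\<Sum>i\<in>J. h (x i) y)" for x :: "'i \<Rightarrow> 'a" and y
  define Dj where "Dj x = D x (x j)" for x :: "'i \<Rightarrow> 'a"
  have Dj: "bdd_meas P Dj"
    unfolding D_def Dj_def P_def by (intro bdd_meas_intros bdd_meas_component2[OF h_bdd]) auto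
  have DJ: "bdd_meas M (D x)" if "x \<in> space PJ" for x
    unfolding D_def using that
    by (intro bdd_meas_intros bdd_meas_section[OF h_bdd]) (auto simp: PJ_def space_PiM PiE_iff)
  have SP: "bdd_meas P S"
    unfolding S_def P_def by (rule bdd_meas_ustat[OF h_bdd]) auto
  have SJ: "bdd_meas PJ S"
    unfolding S_def PJ_def by (rule bdd_meas_ustat[OF h_bdd]) auto
  have UP: "bdd_meas P U"
    unfolding U_def P_def by (rule bdd_meas_ustat[OF h_bdd]) auto
  have S_upd: "S (x(j := y)) = S x" for x y
    unfolding S_def using J by (simp add: ustat_upd)
  have D_upd: "Dj (x(j := y)) = D x y" for x y
    unfolding D_def Dj_def using J by (intro sum.cong) auto
  have U: "U x = S x + 2 * Dj x" for x
    unfolding U_def S_def Dj_def D_def using J by (simp add: ustat_insert h_sym)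
  have split: "(\<integral>x. f x \<partial>P) = (\<integral>x. \<integral>y. f (x(j := y)) \<partial>M \<partial>PJ)" if "bdd_meas P f"
    for f :: "('i \<Rightarrow> 'a) \<Rightarrow> 'b::{banach, second_countable_topology}"
    using J that unfolding P_def PJ_def by (intro integral_PiM_insert)

  have m2: "(\<integral>x. (Dj x)\<^sup>2 \<partial>P) = N * s"
    using row_sum_moments(1)[OF J(1,2)] unfolding Dj_def D_def P_def N_def .
  have h4: "\<bar>h x y ^ 4\<bar> \<le> C ^ 4" for x y
    using power_mono[OF h_bound[of x y], of 4] by (simp add: power_abs)
  have m4: "(\<integral>x. Dj x ^ 4 \<partial>P) \<le> 4 * C ^ 4 * N\<^sup>2"
  proof -
    have "(\<integral>x. h x y ^ 4 \<partial>M) \<le> C ^ 4" if "y \<in> space M" for y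
      using h4 that by (intro integral_le_const bdd_meas_intros bdd_meas_section'[OF h_bdd]) (simp_all add: abs_le_iff)
    then have "(\<integral>x. Dj x ^ 4 \<partial>P) \<le> N * C ^ 4 + 3 * N\<^sup>2 * s\<^sup>2"
      unfolding Dj_def D_def P_def N_def by (intro row_sum_moments(2)[OF J(1,2)])
    also have "s\<^sup>2 \<le> C ^ 4"
      using power_mono[OF s_le s_nonneg, of 2] by simp
    also have "N * C ^ 4 \<le> N\<^sup>2 * C ^ 4"
      using J C_pos unfolding N_def power2_eq_square
      by (intro mult_right_mono) (auto simp: card_gt_0_iff Suc_le_eq)
    finally show ?thesis using N by (simp add: algebra_simps)
  qed
  have m1: "(\<integral>x. \<bar>Dj x\<bar> \<partial>P) \<le> C * sqrt N"
  proof -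
    have "(\<integral>x. \<bar>Dj x\<bar> \<partial>P) \<le> sqrt (N * s)"
      using I.integral_abs_le_sqrt[OF Dj] m2 by simp
    also have "\<dots> \<le> sqrt (N * C\<^sup>2)"
      using s_le N by (intro real_sqrt_le_mono mult_left_mono) auto
    finally show ?thesis using C_pos by (simp add: real_sqrt_mult mult.commute)
  qed
  have m3: "(\<integral>x. \<bar>Dj x\<bar> ^ 3 \<partial>P) \<le> 5 / 2 * C ^ 3 * N * sqrt N"
  proof -
    \<comment> \<open>The order of magnitude of \<open>Dj\<close>; with it both terms of
      \<open>abs_power3_le\<close> are of order C^3 N sqrt N.\<close>
    let ?a = "C * sqrt N"
    have a: "?a > 0" using C_pos N by simp
    have "(\<integral>x. \<bar>Dj x\<bar> ^ 3 \<partial>P) \<le> (\<integral>x. (?a * (Dj x)\<^sup>2 + Dj x ^ 4 / ?a) / 2 \<partial>P)"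
      unfolding divide_inverse
      by (intro integral_mono I.integrable_bdd_meas bdd_meas_intros Dj
        abs_power3_le[unfolded divide_inverse] a)
    also have "\<dots> = (?a * (\<integral>x. (Dj x)\<^sup>2 \<partial>P) + (\<integral>x. Dj x ^ 4 \<partial>P) / ?a) / 2"
      using I.integrable_bdd_meas[OF bdd_meas_power[OF Dj]] by simp
    also have "\<dots> \<le> (?a * (N * C\<^sup>2) + (4 * C ^ 4 * N\<^sup>2) / ?a) / 2"
      using m2 m4 a s_le N by (intro divide_right_mono add_mono mult_left_mono) auto
    also have "(4 * C ^ 4 * N\<^sup>2) / ?a = 4 * C ^ 3 * N * sqrt N"
    proof -
      have "N * N = N * sqrt N * sqrt N" using N by simp
      then show ?thesis using a C_pos N
        by (simp add: power2_eq_square eval_nat_numeral divide_eq_eq)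
    qed
    finally show ?thesis by (simp add: eval_nat_numeral algebra_simps)
  qed

  define e where "e x = iexp (\<xi> * S x)" for x
  have eP: "bdd_meas P e" and eJ: "bdd_meas PJ e"
    unfolding e_def by (intro bdd_meas_intros SP SJ)+
  have e_upd: "e (x(j := y)) = e x" for x y unfolding e_def S_upd ..
  define T1 where "T1 x = complex_of_real (Dj x) * e x" for x
  define T2 where "T2 x = complex_of_real ((Dj x)\<^sup>2) * e x" for x
  define R where "R x = Dj x * iexp (\<xi> * U x) - T1 x - 2 * \<i> * \<xi> * T2 x" for x
  have bT: "bdd_meas P T1" "bdd_meas P T2" "bdd_meas P R"
    unfolding T1_def T2_def R_def by (intro bdd_meas_intros Dj eP UP)+
  have "(\<integral>x. Dj x * iexp (\<xi> * U x) \<partial>P) = (\<integral>x. T1 x + 2 * \<i> * \<xi> * T2 x + R x \<partial>P)"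
    unfolding R_def by simp
  also have "\<dots> = (\<integral>x. T1 x \<partial>P) + 2 * \<i> * \<xi> * (\<integral>x. T2 x \<partial>P) + (\<integral>x. R x \<partial>P)"
    using bT[THEN I.integrable_bdd_meas] by simp
  finally have expand: "(\<integral>x. Dj x * iexp (\<xi> * U x) \<partial>P)
    = (\<integral>x. T1 x \<partial>P) + 2 * \<i> * \<xi> * (\<integral>x. T2 x \<partial>P) + (\<integral>x. R x \<partial>P)" .
  have sp: "x i \<in> space M" if "x \<in> space PJ" "i \<in> J" for x i
    using that by (auto simp: PJ_def space_PiM PiE_iff)
  have T1: "(\<integral>x. T1 x \<partial>P) = 0"
  proof -
    have "(\<integral>y. complex_of_real (D x y) * e x \<partial>M) = 0" if x: "x \<in> space PJ" for x
    proof -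
      have "(\<integral>y. D x y \<partial>M) = 0"
        unfolding D_def using sp[OF x]
        by (subst Bochner_Integration.integral_sum)
          (auto intro!: integrable_bdd_meas bdd_meas_section[OF h_bdd] sum.neutral h_mean)
      then show ?thesis by (simp add: integral_complex_of_real)
    qed
    then have "(\<integral>x. \<integral>y. complex_of_real (D x y) * e x \<partial>M \<partial>PJ) = (\<integral>x. 0 \<partial>PJ)"
      by (intro Bochner_Integration.integral_cong) auto
    moreover have "(\<integral>x. T1 x \<partial>P) = (\<integral>x. \<integral>y. T1 (x(j := y)) \<partial>M \<partial>PJ)"
      by (rule split[OF bT(1)])
    ultimately show ?thesis
      unfolding T1_def D_upd e_upd by simp
  qed
  have T2: "(\<integral>x. T2 x \<partial>P) = N * s * (\<integral>x. e x \<partial>P) + (\<integral>x. ustat cov_kernel J x * e x \<partial>PJ)"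
  proof -
    have "(\<integral>y. complex_of_real ((D x y)\<^sup>2) * e x \<partial>M) = N * s * e x + ustat cov_kernel J x * e x"
      if x: "x \<in> space PJ" for x
    proof -
      have "(\<integral>y. (D x y)\<^sup>2 \<partial>M) = (\<integral>y. (\<Sum>i\<in>J. \<Sum>k\<in>J. h (x i) y * h (x k) y) \<partial>M)"
        unfolding D_def power2_eq_square sum_product ..
      also have "\<dots> = (\<Sum>i\<in>J. \<Sum>k\<in>J. cov_kernel (x i) (x k))"
        unfolding cov_kernel_def using sp[OF x]
        by (simp add: Bochner_Integration.integral_sum integrable_bdd_meas bdd_meas_intros
          bdd_meas_section[OF h_bdd])
      \<comment> \<open>The diagonal gives \<open>N * s\<close>, the rest is the U-statistic of
        \<open>cov_kernel\<close>.\<close>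
      also have "\<dots> = (\<Sum>i\<in>J. cov_kernel (x i) (x i) + (\<Sum>k\<in>J - {i}. cov_kernel (x i) (x k)))"
        using J(1) by (intro sum.cong refl sum.remove)
      also have "\<dots> = N * s + ustat cov_kernel J x"
        using h_var[OF sp[OF x]] unfolding ustat_def N_def sum.distrib
        by (simp add: cov_kernel_def power2_eq_square)
      finally have "(\<integral>y. (D x y)\<^sup>2 \<partial>M) = N * s + ustat cov_kernel J x" .
      then have "(\<integral>y. complex_of_real ((D x y)\<^sup>2) \<partial>M) = of_real (N * s + ustat cov_kernel J x)"
        by (simp only: integral_complex_of_real)
      then show ?thesis by (simp add: algebra_simps)
    qed
    then have "(\<integral>x. \<integral>y. T2 (x(j := y)) \<partial>M \<partial>PJ) = (\<integral>x. N * s * e x + ustat cov_kernel J x * e x \<partial>PJ)"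
      unfolding T2_def D_upd e_upd by (intro Bochner_Integration.integral_cong) auto
    then have "(\<integral>x. T2 x \<partial>P) = (\<integral>x. N * s * e x + ustat cov_kernel J x * e x \<partial>PJ)"
      unfolding split[OF bT(2)] .
    also have "\<dots> = N * s * (\<integral>x. e x \<partial>PJ) + (\<integral>x. ustat cov_kernel J x * e x \<partial>PJ)"
    proof -
      have "bdd_meas PJ (\<lambda>x. complex_of_real (ustat cov_kernel J x) * e x)"
        unfolding PJ_def by (intro bdd_meas_intros bdd_meas_ustat[OF G.h_bdd] eJ[unfolded PJ_def]) auto
      from J.integrable_bdd_meas[OF this] show ?thesis
        using J.integrable_bdd_meas[OF eJ] by simp
    qed
    also have "(\<integral>x. e x \<partial>PJ) = (\<integral>x. e x \<partial>P)"
      by (subst split[OF eP]) (simp add: e_upd prob_space)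
    finally show ?thesis .
  qed
  have off: "cmod (\<integral>x. ustat cov_kernel J x * e x \<partial>PJ) \<le> N * sqrt (2 * cov_norm)"
  proof -
    have b: "bdd_meas PJ (ustat cov_kernel J)"
      unfolding PJ_def by (rule bdd_meas_ustat[OF G.h_bdd]) auto
    have "cmod (\<integral>x. ustat cov_kernel J x * e x \<partial>PJ) \<le> (\<integral>x. cmod (ustat cov_kernel J x * e x) \<partial>PJ)"
      by (rule integral_norm_bound)
    also have "\<dots> = (\<integral>x. \<bar>ustat cov_kernel J x\<bar> \<partial>PJ)"
      by (simp add: norm_mult e_def)
    also have "\<dots> \<le> sqrt (\<integral>x. (ustat cov_kernel J x)\<^sup>2 \<partial>PJ)"
      by (rule J.integral_abs_le_sqrt[OF b])
    also have "\<dots> \<le> sqrt (N\<^sup>2 * (2 * cov_norm))"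
      using G.ustat_second_moment[OF J(1)] unfolding PJ_def cov_norm_def N_def
      by (intro real_sqrt_le_mono) (simp add: algebra_simps)
    finally show ?thesis using N by (simp add: real_sqrt_mult)
  qed
  \<comment> \<open>The leading term has to be expressed by the characteristic function of U instead
    of S. This exchange accounts for 4 of the final constant 9, the remainder \<open>R\<close> for
    the other 5.\<close>
  have e_diff: "cmod ((\<integral>x. e x \<partial>P) - (\<integral>x. iexp (\<xi> * U x) \<partial>P)) \<le> 2 * \<bar>\<xi>\<bar> * (C * sqrt N)"
  proof -
    have "(\<integral>x. e x \<partial>P) - (\<integral>x. iexp (\<xi> * U x) \<partial>P) = (\<integral>x. e x - iexp (\<xi> * U x) \<partial>P)"
      by (rule Bochner_Integration.integral_diff[symmetric])
        (intro I.integrable_bdd_meas bdd_meas_intros UP eP)+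
    also have "cmod \<dots> \<le> (\<integral>x. 2 * \<bar>\<xi>\<bar> * \<bar>Dj x\<bar> \<partial>P)"
    proof (intro I.norm_integral_le bdd_meas_intros UP eP Dj)
      fix x
      show "cmod (e x - iexp (\<xi> * U x)) \<le> 2 * \<bar>\<xi>\<bar> * \<bar>Dj x\<bar>"
        unfolding e_def U using cmod_iexp_diff_le[of "\<xi> * S x" "\<xi> * (S x + 2 * Dj x)"]
        by (simp add: algebra_simps abs_mult)
    qed
    also have "\<dots> \<le> 2 * \<bar>\<xi>\<bar> * (C * sqrt N)"
      using m1 by (simp add: mult_left_mono)
    finally show ?thesis .
  qed
  have R: "cmod (\<integral>x. R x \<partial>P) \<le> 5 * \<xi>\<^sup>2 * C ^ 3 * N * sqrt N"
  proof -
    have "cmod (\<integral>x. R x \<partial>P) \<le> (\<integral>x. 2 * \<xi>\<^sup>2 * \<bar>Dj x\<bar> ^ 3 \<partial>P)"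
    proof (intro I.norm_integral_le bdd_meas_intros bT Dj)
      fix x
      let ?d = "2 * \<xi> * Dj x"
      have "iexp (\<xi> * U x) = e x * iexp ?d"
        unfolding e_def U by (simp add: exp_add[symmetric] algebra_simps)
      then have "R x = Dj x * e x * (iexp ?d - (1 + \<i> * ?d))"
        unfolding R_def T1_def T2_def by (simp add: algebra_simps power2_eq_square)
      then have "cmod (R x) = \<bar>Dj x\<bar> * cmod (iexp ?d - (1 + \<i> * ?d))"
        by (simp add: norm_mult e_def)
      also have "\<dots> \<le> \<bar>Dj x\<bar> * (?d\<^sup>2 / 2)"
        using iexp_approx1[of ?d 1] by (intro mult_left_mono) (simp_all add: numeral_2_eq_2)
      also have "\<dots> = 2 * \<xi>\<^sup>2 * \<bar>Dj x\<bar> ^ 3"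
        by (cases "Dj x \<ge> 0") (auto simp: eval_nat_numeral algebra_simps)
      finally show "cmod (R x) \<le> 2 * \<xi>\<^sup>2 * \<bar>Dj x\<bar> ^ 3" .
    qed
    also have "\<dots> \<le> 2 * \<xi>\<^sup>2 * (5 / 2 * C ^ 3 * N * sqrt N)"
      by (subst integral_mult_right_zero) (intro mult_left_mono m3, simp)
    finally show ?thesis by (simp add: algebra_simps)
  qed
  let ?E = "\<integral>x. iexp (\<xi> * U x) \<partial>P"
  have "(\<integral>x. Dj x * iexp (\<xi> * U x) \<partial>P) - 2 * \<i> * \<xi> * N * s * ?E
    = 2 * \<i> * \<xi> * N * s * ((\<integral>x. e x \<partial>P) - ?E) + 2 * \<i> * \<xi> * (\<integral>x. ustat cov_kernel J x * e x \<partial>PJ) + (\<integral>x. R x \<partial>P)"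
    unfolding expand T1 T2 by (simp add: algebra_simps)
  also have "cmod \<dots> \<le> cmod (2 * \<i> * \<xi> * N * s * ((\<integral>x. e x \<partial>P) - ?E))
      + cmod (2 * \<i> * \<xi> * (\<integral>x. ustat cov_kernel J x * e x \<partial>PJ)) + cmod (\<integral>x. R x \<partial>P)"
    by (intro order_trans[OF norm_triangle_ineq] add_mono order_refl)
  also have "cmod (2 * \<i> * \<xi> * N * s * ((\<integral>x. e x \<partial>P) - ?E)) \<le> 2 * \<bar>\<xi>\<bar> * N * C\<^sup>2 * (2 * \<bar>\<xi>\<bar> * (C * sqrt N))"
    unfolding norm_mult using e_diff s_le s_nonneg N by (intro mult_mono) auto
  also have "\<dots> = 4 * \<xi>\<^sup>2 * C ^ 3 * N * sqrt N"
    by (cases "\<xi> \<ge> 0") (auto simp: eval_nat_numeral algebra_simps)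
  also have "cmod (2 * \<i> * \<xi> * (\<integral>x. ustat cov_kernel J x * e x \<partial>PJ)) \<le> 2 * \<bar>\<xi>\<bar> * (N * sqrt (2 * cov_norm))"
    unfolding norm_mult using off by (intro mult_mono) auto
  finally show ?thesis
    using R unfolding Dj_def D_def by (simp add: algebra_simps)
qed


text \<open>Summing the row identities over all points gives \<psi>' = - t s \<psi> for t in [0, 1],
  up to an error \<epsilon>. After multiplication by exp (s t^2 / 2) the derivative is at most
  \<epsilon> exp (s / 2), and this last factor cancels at t = 1.\<close>

lemma char_ustat:
  fixes I :: "'i set"
  assumes I: "finite I" "card I \<ge> 2"
  defines "n \<equiv> real (card I)"
  shows "cmod ((\<integral>x. iexp (sqrt (1 / (2 * n * (n - 1))) * ustat h I x) \<partial>PiM I (\<lambda>_. M)) - exp (- s / 2))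
    \<le> sqrt (2 * cov_norm) + 9 * C ^ 3 / sqrt n"
proof -
  define P where "P = PiM I (\<lambda>_. M)"
  interpret P: prob_space P unfolding P_def by (rule prob_space_PiM) unfold_locales
  define U where "U = ustat h I"
  have U: "bdd_meas P U"
    unfolding U_def P_def by (rule bdd_meas_ustat[OF h_bdd]) auto
  define N where "N = n - 1"
  have n: "n \<ge> 2" "N \<ge> 1" using I unfolding n_def N_def by auto
  \<comment> \<open>The normalisation that gives \<kappa> U variance \<open>s\<close>: the
    U-statistic over ordered pairs has variance 2 n (n - 1) s.\<close>
  define \<kappa> where "\<kappa> = sqrt (1 / (2 * n * N))"
  have \<kappa>: "\<kappa> > 0" "2 * \<kappa>\<^sup>2 * n * N = 1"
    using n unfolding \<kappa>_def by auto
  define \<psi> where "\<psi> t = (\<integral>x. iexp (t * (\<kappa> * U x)) \<partial>P)" for t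
  define \<psi>' where "\<psi>' t = (\<integral>x. \<i> * (\<kappa> * U x) * iexp (t * (\<kappa> * U x)) \<partial>P)" for t
  define \<epsilon> where "\<epsilon> = sqrt (2 * cov_norm) + 9 * C ^ 3 / sqrt n"
  have cov0: "cov_norm \<ge> 0" unfolding cov_norm_def by simp
  have \<psi>': "(\<psi> has_vector_derivative \<psi>' t) (at t)" for t
    unfolding \<psi>_def[abs_def] \<psi>'_def
    using P.char_approx_derivative[of "\<lambda>x. \<kappa> * U x" t] by (simp add: bdd_meas_intros U)
  have ode: "cmod (\<psi>' t + t * s * \<psi> t) \<le> \<epsilon>" if t: "0 \<le> t" "t \<le> 1" for t
  proof -
    define \<xi> where "\<xi> = t * \<kappa>"
    have \<xi>: "0 \<le> \<xi>" "\<xi> \<le> \<kappa>"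
      using t \<kappa> unfolding \<xi>_def by (auto simp: mult_left_le_one_le)
    define D where "D j x = (\<Sum>i\<in>I - {j}. h (x i) (x j))" for j and x :: "'i \<Rightarrow> 'a"
    define err where "err = 2 * \<bar>\<xi>\<bar> * N * sqrt (2 * cov_norm) + 9 * \<xi>\<^sup>2 * C ^ 3 * N * sqrt N"
    have step: "cmod ((\<integral>x. D j x * iexp (\<xi> * U x) \<partial>P) - 2 * \<i> * \<xi> * N * s * \<psi> t) \<le> err"
      if j: "j \<in> I" for j
    proof -
      have ins: "insert j (I - {j}) = I" using j by auto
      have c: "real (card (I - {j})) = N" using j I unfolding N_def n_def by simp
      have "I - {j} \<noteq> {}"
        using c n by (metis card.empty not_one_le_zero of_nat_0)
      then show ?thesis
        using char_ustat_step[of "I - {j}" j \<xi>] I(1)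
        unfolding ins c D_def P_def U_def \<psi>_def err_def \<xi>_def by (simp add: mult.assoc)
    qed
    have U_sum: "U x = (\<Sum>j\<in>I. D j x)" for x
    proof -
      have "U x = (\<Sum>j\<in>I. \<Sum>i\<in>I - {j}. h (x j) (x i))"
        unfolding U_def ustat_def ..
      then show ?thesis unfolding D_def by (simp add: h_sym)
    qed
    have bD: "bdd_meas P (D j)" if "j \<in> I" for j
      unfolding D_def P_def using that by (intro bdd_meas_intros bdd_meas_component2[OF h_bdd]) auto
    have "\<psi>' t = (\<integral>x. (\<Sum>j\<in>I. \<i> * \<kappa> * (D j x * iexp (\<xi> * U x))) \<partial>P)"
      unfolding \<psi>'_def \<xi>_def
    proof (rule Bochner_Integration.integral_cong[OF refl])
      fix x
      have "(\<Sum>j\<in>I. \<i> * \<kappa> * (D j x * iexp (t * \<kappa> * U x))) = \<i> * \<kappa> * (\<Sum>j\<in>I. complex_of_real (D j x)) * iexp (t * \<kappa> * U x)"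
        by (simp only: sum_distrib_left sum_distrib_right mult.assoc)
      also have "(\<Sum>j\<in>I. complex_of_real (D j x)) = U x" unfolding U_sum by simp
      finally show "\<i> * (\<kappa> * U x) * iexp (t * (\<kappa> * U x)) = (\<Sum>j\<in>I. \<i> * \<kappa> * (D j x * iexp (t * \<kappa> * U x)))"
        by (simp add: mult.assoc)
    qed
    also have "\<dots> = (\<Sum>j\<in>I. \<integral>x. \<i> * \<kappa> * (D j x * iexp (\<xi> * U x)) \<partial>P)"
      by (intro Bochner_Integration.integral_sum P.integrable_bdd_meas bdd_meas_intros bD U)
    also have "\<dots> = (\<Sum>j\<in>I. \<i> * \<kappa> * (\<integral>x. D j x * iexp (\<xi> * U x) \<partial>P))"
      by simp
    finally have \<psi>'_eq: "\<psi>' t = (\<Sum>j\<in>I. \<i> * \<kappa> * (\<integral>x. D j x * iexp (\<xi> * U x) \<partial>P))" .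
    have "t * s * \<psi> t = - (\<Sum>j\<in>I. \<i> * \<kappa> * (2 * \<i> * \<xi> * N * s * \<psi> t))"
    proof -
      have "(\<Sum>j\<in>I. \<i> * \<kappa> * (2 * \<i> * \<xi> * N * s * \<psi> t)) = - complex_of_real (2 * \<kappa>\<^sup>2 * n * N) * t * s * \<psi> t"
        unfolding \<xi>_def by (simp add: n_def power2_eq_square)
      then show ?thesis unfolding \<kappa>(2) by simp
    qed
    then have "\<psi>' t + t * s * \<psi> t
        = (\<Sum>j\<in>I. \<i> * \<kappa> * ((\<integral>x. D j x * iexp (\<xi> * U x) \<partial>P) - 2 * \<i> * \<xi> * N * s * \<psi> t))"
      unfolding \<psi>'_eq by (simp only: right_diff_distrib sum_subtractf add_uminus_conv_diff)
    also have "cmod \<dots> \<le> (\<Sum>j\<in>I. \<kappa> * err)"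
      using step \<kappa> by (intro sum_norm_le) (auto simp: norm_mult)
    also have "\<dots> = n * \<kappa> * err" by (simp add: n_def)
    also have "\<dots> \<le> n * \<kappa> * (2 * \<kappa> * N * sqrt (2 * cov_norm) + 9 * \<kappa>\<^sup>2 * C ^ 3 * N * sqrt N)"
      unfolding err_def using \<xi> n \<kappa> C_pos cov0
      by (intro mult_left_mono add_mono mult_right_mono power_mono) auto
    also have "\<dots> = (2 * \<kappa>\<^sup>2 * n * N) * sqrt (2 * cov_norm) + 9 * C ^ 3 * ((2 * \<kappa>\<^sup>2 * n * N) * (\<kappa> * sqrt N / 2))"
      by (simp add: power2_eq_square algebra_simps)
    also have "\<dots> = sqrt (2 * cov_norm) + 9 * C ^ 3 * (\<kappa> * sqrt N / 2)"
      unfolding \<kappa>(2) by simp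
    also have "\<kappa> * sqrt N / 2 \<le> 1 / sqrt n"
    proof -
      have "\<kappa> * sqrt N = sqrt (1 / (2 * n))"
        using n unfolding \<kappa>_def real_sqrt_mult[symmetric] by simp
      also have "\<dots> \<le> sqrt (1 / n)" using n by (intro real_sqrt_le_mono) (simp add: field_simps)
      finally have "\<kappa> * sqrt N \<le> 1 / sqrt n" by (simp add: real_sqrt_divide)
      moreover have "0 \<le> \<kappa> * sqrt N" using \<kappa> n by simp
      ultimately show ?thesis by linarith
    qed
    finally show ?thesis
      unfolding \<epsilon>_def using C_pos by (simp add: mult_left_mono)
  qed
  define \<theta> where "\<theta> t = \<psi> t * exp (complex_of_real (s * t\<^sup>2 / 2))" for t
  define \<theta>' where "\<theta>' t = (\<psi>' t + t * s * \<psi> t) * exp (complex_of_real (s * t\<^sup>2 / 2))" for t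
  have \<theta>': "(\<theta> has_vector_derivative \<theta>' t) (at t)" for t
  proof -
    have "((\<lambda>t. s * t\<^sup>2 / 2) has_real_derivative s * t) (at t)"
      by (auto intro!: derivative_eq_intros)
    then have "((\<lambda>t. exp (s * t\<^sup>2 / 2)) has_real_derivative exp (s * t\<^sup>2 / 2) * (s * t)) (at t)"
      by (rule DERIV_chain2[OF DERIV_exp])
    then have "((\<lambda>t. complex_of_real (exp (s * t\<^sup>2 / 2))) has_vector_derivative complex_of_real (exp (s * t\<^sup>2 / 2) * (s * t))) (at t)"
      by (intro has_vector_derivative_of_real) (simp add: has_real_derivative_iff_has_vector_derivative)
    from has_vector_derivative_mult[OF \<psi>' this]
    show ?thesis unfolding \<theta>_def[abs_def] \<theta>'_def
      by (simp add: exp_of_real[symmetric] algebra_simps)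
  qed
  have "\<exists>t\<in>{0<..<1}. cmod (\<theta> 1 - \<theta> 0) \<le> cmod ((1 - 0) *\<^sub>R \<theta>' t)"
    using \<theta>' by (intro mvt_general)
      (auto intro!: continuous_at_imp_continuous_on simp: has_vector_derivative_def intro: has_derivative_continuous)
  then obtain t where t: "0 < t" "t < 1" "cmod (\<theta> 1 - \<theta> 0) \<le> cmod (\<theta>' t)" by auto
  have "cmod (\<theta>' t) \<le> \<epsilon> * exp (s / 2)"
  proof -
    have "s * t\<^sup>2 \<le> s" using t s_nonneg by (simp add: mult_left_le power_le_one)
    then have "cmod (exp (complex_of_real (s * t\<^sup>2 / 2))) \<le> exp (s / 2)"
      by (simp add: norm_exp_eq_Re)
    then show ?thesis
      unfolding \<theta>'_def norm_mult using ode[of t] t by (intro mult_mono) (auto intro: order_trans[OF norm_ge_zero])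
  qed
  moreover have "\<theta> 1 - \<theta> 0 = (\<psi> 1 - exp (- s / 2)) * exp (s / 2)"
    unfolding \<theta>_def using P.prob_space
    by (simp add: \<psi>_def left_diff_distrib exp_of_real[symmetric] exp_minus_inverse flip: exp_add)
  then have "cmod (\<psi> 1 - exp (- s / 2)) * exp (s / 2) = cmod (\<theta> 1 - \<theta> 0)"
    by (simp add: norm_mult)
  ultimately have "cmod (\<psi> 1 - exp (- s / 2)) * exp (s / 2) \<le> \<epsilon> * exp (s / 2)"
    using t(3) by linarith
  then have "cmod (\<psi> 1 - exp (- s / 2)) \<le> \<epsilon>"
    by (rule mult_right_le_imp_le) simp
  then show ?thesis
    unfolding \<psi>_def \<epsilon>_def \<kappa>_def U_def P_def N_def by simp
qed

end

text \<open>The term a^3 b is kept exact because it will integrate to 0. The mixed squares, six from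
  the expansion and two from estimating a b^3, are split by 2 x y <= l x^2 + y^2 / l with a free
  weight \<open>l\<close>.\<close>

lemma power4_add_le:
  fixes a b l :: real
  assumes "l > 0"
  shows "(a + b) ^ 4 \<le> a ^ 4 + 4 * a ^ 3 * b + 4 * l * a ^ 4 + 4 / l * b ^ 4 + 3 * b ^ 4"
proof -
  have "(a + b) ^ 4 = a ^ 4 + 4 * a ^ 3 * b + 6 * (a\<^sup>2 * b\<^sup>2) + 4 * (a * b) * b\<^sup>2 + b ^ 4"
    by (simp add: eval_nat_numeral algebra_simps)
  moreover have "4 * (a * b) * b\<^sup>2 \<le> 2 * (a\<^sup>2 * b\<^sup>2) + 2 * b ^ 4"
  proof -
    have "0 \<le> 2 * (a * b - b\<^sup>2)\<^sup>2" by simp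
    then show ?thesis by (simp add: power2_eq_square eval_nat_numeral algebra_simps)
  qed
  moreover have "8 * (a\<^sup>2 * b\<^sup>2) \<le> 4 * l * a ^ 4 + 4 / l * b ^ 4"
  proof -
    have "0 \<le> 4 / l * (l * a\<^sup>2 - b\<^sup>2)\<^sup>2" using assms by simp
    also have "\<dots> = 4 * l * a ^ 4 + 4 / l * b ^ 4 - 8 * (a\<^sup>2 * b\<^sup>2)"
      using assms by (simp add: power2_diff power_mult_distrib field_simps power2_eq_square eval_nat_numeral)
    finally show ?thesis by simp
  qed
  ultimately show ?thesis by linarith
qed

section \<open>Fourth moment of a degenerate U-statistic\<close>

context degenerate_kernel
begin

text \<open>The bound \<open>n\<close> on the number of points stays fixed in the induction, so that
  the bound for one row is the same at every step. With \<open>C <= 1\<close> the fourth moment of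
  \<open>h\<close> is at most \<open>s\<close>; without this factor \<open>s\<close> the term linear
  in \<open>n\<close> would not shrink with the increment.\<close>

lemma ustat_fourth_moment_aux:
  fixes I :: "'i set"
  assumes "finite I" "card I \<le> n" "C \<le> 1"
  shows "(\<integral>x. ustat h I x ^ 4 \<partial>PiM I (\<lambda>_. M))
    \<le> 16 * (real (card I))\<^sup>2 * (16 * (n * s + 3 * (real n)\<^sup>2 * s\<^sup>2))"
  using assms(1,2)
proof induction
  case empty
  then show ?case by (simp add: ustat_def)
next
  case (insert j J)
  \<comment> \<open>The factor 16 is the fourth power of the 2 in \<open>D\<close> below.\<close>
  define \<beta> where "\<beta> = 16 * (n * s + 3 * (real n)\<^sup>2 * s\<^sup>2)"
  have \<beta>: "\<beta> \<ge> 0" unfolding \<beta>_def using s_nonneg by simp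
  define P where "P = PiM (insert j J) (\<lambda>_. M)"
  define PJ where "PJ = PiM J (\<lambda>_. M)"
  interpret J: prob_space PJ unfolding PJ_def by (rule prob_space_PiM) unfold_locales
  interpret I: prob_space P unfolding P_def by (rule prob_space_PiM) unfold_locales
  define S where "S = ustat h J"
  define D where "D x y = 2 * (\<Sum>i\<in>J. h (x i) y)" for x :: "'i \<Rightarrow> 'a" and y
  have Dj: "bdd_meas P (\<lambda>x. D x (x j))"
    unfolding D_def P_def by (intro bdd_meas_intros bdd_meas_component2[OF h_bdd]) auto
  have SP: "bdd_meas P S"
    unfolding S_def P_def by (rule bdd_meas_ustat[OF h_bdd]) auto
  have S_upd: "S (x(j := y)) = S x" for x y
    unfolding S_def using insert by (simp add: ustat_upd)
  have D_upd: "D (x(j := y)) z = D x z" for x y z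
    unfolding D_def using insert by (intro arg_cong2[of _ _ _ _ "(*)"] sum.cong) auto
  have U: "ustat h (insert j J) x = S x + D x (x j)" for x
    unfolding S_def D_def using insert by (simp add: ustat_insert h_sym)
  have split: "(\<integral>x. f x \<partial>P) = (\<integral>x. \<integral>y. f (x(j := y)) \<partial>M \<partial>PJ)" if "bdd_meas P f"
    for f :: "('i \<Rightarrow> 'a) \<Rightarrow> real"
    using insert that unfolding P_def PJ_def by (intro integral_PiM_insert)
  have c: "card (insert j J) = Suc (card J)" using insert by simp
  have h4: "(\<integral>x. h x y ^ 4 \<partial>M) \<le> s" if y: "y \<in> space M" for y
  proof -
    have "h x y ^ 4 \<le> (h x y)\<^sup>2" for x
    proof -
      have "\<bar>h x y\<bar> \<le> 1" using h_bound[of x y] assms(3) by linarith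
      then have "(h x y)\<^sup>2 \<le> 1" using abs_le_square_iff[of "h x y" 1] by simp
      then have "(h x y)\<^sup>2 * (h x y)\<^sup>2 \<le> 1 * (h x y)\<^sup>2" by (intro mult_right_mono) auto
      then show ?thesis by (simp add: power2_eq_square eval_nat_numeral)
    qed
    then have "(\<integral>x. h x y ^ 4 \<partial>M) \<le> (\<integral>x. (h x y)\<^sup>2 \<partial>M)"
      using y by (intro integral_mono integrable_bdd_meas bdd_meas_intros bdd_meas_section'[OF h_bdd])
    then show ?thesis using h_var[OF y] by (simp add: h_sym)
  qed
  have D4: "(\<integral>x. D x (x j) ^ 4 \<partial>P) \<le> \<beta>"
  proof -
    have "(\<integral>x. D x (x j) ^ 4 \<partial>P) = 16 * (\<integral>x. (\<Sum>i\<in>J. h (x i) (x j)) ^ 4 \<partial>P)"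
      unfolding D_def by (simp add: power_mult_distrib)
    also have "\<dots> \<le> 16 * (card J * s + 3 * (real (card J))\<^sup>2 * s\<^sup>2)"
      using row_sum_moments(2)[OF insert(1,2) h4] unfolding P_def by simp
    also have "\<dots> \<le> \<beta>"
      unfolding \<beta>_def using insert s_nonneg
      by (intro mult_left_mono add_mono mult_right_mono power_mono) auto
    finally show ?thesis .
  qed
  have S3D: "(\<integral>x. S x ^ 3 * D x (x j) \<partial>P) = 0"
  proof -
    have "(\<integral>y. S x ^ 3 * D x y \<partial>M) = 0" if x: "x \<in> space PJ" for x
    proof -
      have "(\<integral>y. D x y \<partial>M) = 0"
        unfolding D_def using x
        by (simp add: Bochner_Integration.integral_sum integrable_bdd_meas bdd_meas_section[OF h_bdd]
          h_mean PJ_def space_PiM PiE_iff)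
      then show ?thesis by simp
    qed
    then have "(\<integral>x. \<integral>y. S x ^ 3 * D x y \<partial>M \<partial>PJ) = (\<integral>x. 0 \<partial>PJ)"
      by (intro Bochner_Integration.integral_cong) auto
    moreover have "(\<integral>x. S x ^ 3 * D x (x j) \<partial>P)
        = (\<integral>x. \<integral>y. S (x(j := y)) ^ 3 * D (x(j := y)) ((x(j := y)) j) \<partial>M \<partial>PJ)"
      by (rule split) (intro bdd_meas_intros SP Dj)
    ultimately show ?thesis by (simp add: S_upd D_upd)
  qed
  have S4: "(\<integral>x. S x ^ 4 \<partial>P) \<le> 16 * (real (card J))\<^sup>2 * \<beta>"
  proof -
    have "(\<integral>x. S x ^ 4 \<partial>P) = (\<integral>x. \<integral>y. S (x(j := y)) ^ 4 \<partial>M \<partial>PJ)"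
      by (rule split) (intro bdd_meas_intros SP)
    also have "\<dots> = (\<integral>x. S x ^ 4 \<partial>PJ)" by (simp add: S_upd prob_space)
    finally show ?thesis using insert unfolding S_def PJ_def \<beta>_def by simp
  qed
  show ?case
  proof (cases "J = {}")
    case True
    then show ?thesis using \<beta> by (simp add: ustat_def \<beta>_def)
  next
    case False
    define m where "m = real (card J)"
    have m: "m \<ge> 1" using False insert unfolding m_def by (simp add: Suc_le_eq card_gt_0_iff)
    \<comment> \<open>The growth factor becomes 1 + 4 l = 1 + 1 / m, which adds 16 m; the price 4 /
      l + 3 = 16 m + 3 still fits, since 16 m^2 + 32 m + 3 <= 16 (m + 1)^2.\<close>
    define l where "l = 1 / (4 * m)"
    have l: "l > 0" using m unfolding l_def by simp
    note i = I.integrable_bdd_meas[OF bdd_meas_power[OF SP]] I.integrable_bdd_meas[OF bdd_meas_power[OF Dj]]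
      I.integrable_bdd_meas[OF bdd_meas_mult[OF bdd_meas_power[OF SP] Dj]]
    have "(\<integral>x. ustat h (insert j J) x ^ 4 \<partial>P)
        \<le> (\<integral>x. S x ^ 4 + 4 * (S x ^ 3 * D x (x j)) + 4 * l * S x ^ 4 + 4 / l * D x (x j) ^ 4 + 3 * D x (x j) ^ 4 \<partial>P)"
      unfolding U using l power4_add_le[OF l]
      by (intro integral_mono I.integrable_bdd_meas bdd_meas_intros SP Dj) (auto simp: mult.assoc)
    also have "\<dots> = (\<integral>x. S x ^ 4 \<partial>P) + 4 * (\<integral>x. S x ^ 3 * D x (x j) \<partial>P)
        + 4 * l * (\<integral>x. S x ^ 4 \<partial>P) + 4 / l * (\<integral>x. D x (x j) ^ 4 \<partial>P) + 3 * (\<integral>x. D x (x j) ^ 4 \<partial>P)"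
      using i by simp
    also have "\<dots> = (1 + 4 * l) * (\<integral>x. S x ^ 4 \<partial>P) + (4 / l + 3) * (\<integral>x. D x (x j) ^ 4 \<partial>P)"
      using S3D by (simp add: algebra_simps)
    also have "\<dots> \<le> (1 + 4 * l) * (16 * m\<^sup>2 * \<beta>) + (4 / l + 3) * \<beta>"
      using S4 D4 l unfolding m_def by (intro add_mono mult_left_mono) auto
    also have "\<dots> = (16 * m\<^sup>2 + 32 * m + 3) * \<beta>"
      using m unfolding l_def by (simp add: field_simps power2_eq_square)
    also have "\<dots> \<le> (16 * (m + 1)\<^sup>2) * \<beta>"
      using \<beta> by (intro mult_right_mono) (auto simp: power2_eq_square algebra_simps)
    finally show ?thesis
      using c unfolding P_def m_def \<beta>_def by (simp add: add.commute)
  qed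
qed

lemma ustat_fourth_moment:
  fixes I :: "'i set"
  assumes I: "finite I" "card I \<ge> 2" and C: "C \<le> 1"
  defines "n \<equiv> real (card I)"
  shows "(\<integral>x. (sqrt (1 / (2 * n * (n - 1))) * ustat h I x) ^ 4 \<partial>PiM I (\<lambda>_. M)) \<le> 4096 * (s / n + s\<^sup>2)"
proof -
  have n: "n \<ge> 2" using I unfolding n_def by auto
  define a where "a = 1 / (2 * n * (n - 1))"
  have a: "0 \<le> a" "a \<le> 1 / n\<^sup>2"
    using n unfolding a_def by (auto intro!: frac_le simp: power2_eq_square algebra_simps)
  have s4: "sqrt a ^ 4 = a\<^sup>2"
    using a power_mult[of "sqrt a" 2 2] by simp
  have "(\<integral>x. (sqrt a * ustat h I x) ^ 4 \<partial>PiM I (\<lambda>_. M)) = a\<^sup>2 * (\<integral>x. ustat h I x ^ 4 \<partial>PiM I (\<lambda>_. M))"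
    by (simp add: power_mult_distrib s4)
  also have "\<dots> \<le> (1 / n\<^sup>2)\<^sup>2 * (16 * n\<^sup>2 * (16 * (n * s + 3 * n\<^sup>2 * s\<^sup>2)))"
    using ustat_fourth_moment_aux[OF I(1) order_refl C] a s_nonneg unfolding n_def
    by (intro mult_mono power_mono) auto
  also have "\<dots> = 256 * (s / n + 3 * s\<^sup>2)"
    using n by (simp add: field_simps power2_eq_square)
  also have "\<dots> \<le> 4096 * (s / n + s\<^sup>2)"
  proof -
    have "0 \<le> s / n" "0 \<le> s\<^sup>2" using n s_nonneg by auto
    then show ?thesis by argo
  qed
  finally show ?thesis unfolding a_def .
qed

end

section \<open>Convergence in law of random vectors\<close>

text \<open>The span of cosines of affine forms: means of such functions are read off from
  characteristic functions, and the product-to-sum formula makes the span an algebra, as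
  Stone-Weierstrass demands. The phase \<open>b\<close> covers the sines.\<close>

inductive_set trig_fns :: "nat \<Rightarrow> ((nat \<Rightarrow> real) \<Rightarrow> real) set" for d where
  cos: "(\<lambda>x. cos ((\<Sum>k<d. \<xi> k * x k) + b)) \<in> trig_fns d"
| add: "f \<in> trig_fns d \<Longrightarrow> g \<in> trig_fns d \<Longrightarrow> (\<lambda>x. f x + g x) \<in> trig_fns d"
| scale: "f \<in> trig_fns d \<Longrightarrow> (\<lambda>x. c * f x) \<in> trig_fns d"

lemma trig_fns_mult:
  assumes "f \<in> trig_fns d" "g \<in> trig_fns d"
  shows "(\<lambda>x. f x * g x) \<in> trig_fns d"
  using assms(1)
proof induction
  case (cos \<xi> b)
  from assms(2) show ?case
  proof induction
    case (cos \<zeta> c)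
    have "(\<lambda>x. 1 / 2 * cos ((\<Sum>k<d. (\<xi> k - \<zeta> k) * x k) + (b - c))
        + 1 / 2 * cos ((\<Sum>k<d. (\<xi> k + \<zeta> k) * x k) + (b + c))) \<in> trig_fns d"
      by (intro trig_fns.intros)
    moreover have "1 / 2 * cos ((\<Sum>k<d. (\<xi> k - \<zeta> k) * x k) + (b - c))
        + 1 / 2 * cos ((\<Sum>k<d. (\<xi> k + \<zeta> k) * x k) + (b + c))
      = cos ((\<Sum>k<d. \<xi> k * x k) + b) * cos ((\<Sum>k<d. \<zeta> k * x k) + c)" for x :: "nat \<Rightarrow> real"
      unfolding cos_times_cos by (simp add: left_diff_distrib distrib_right sum.distrib sum_subtractf
        algebra_simps add_divide_distrib)
    ultimately show ?case by simp
  next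
    case (add f g)
    from trig_fns.add[OF add.IH] show ?case by (simp add: distrib_left)
  next
    case (scale f c)
    from trig_fns.scale[OF scale.IH, of c] show ?case by (simp add: algebra_simps)
  qed
next
  case (add f g)
  from trig_fns.add[OF add.IH] show ?case by (simp add: distrib_right)
next
  case (scale f c)
  from trig_fns.scale[OF scale.IH, of c] show ?case by (simp add: algebra_simps)
qed

text \<open>Padding with 0 places vectors of any dimension \<open>d\<close> in one space
  \<open>nat \<Rightarrow> real\<close> with its product topology; 0 is fixed by the folding map
  used below.\<close>

definition trunc_vec :: "nat \<Rightarrow> (nat \<Rightarrow> real) \<Rightarrow> nat \<Rightarrow> real" where
  "trunc_vec d w = (\<lambda>k. if k < d then w k else 0)"

lemma measurable_trunc_vec:
  assumes "\<And>k. k < d \<Longrightarrow> W k \<in> borel_measurable M"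
  shows "(\<lambda>\<omega>. trunc_vec d (\<lambda>k. W k \<omega>)) \<in> borel_measurable M"
  unfolding trunc_vec_def using assms
  by (intro measurable_coordinatewise_then_product) (case_tac "i < d", auto)

lemma bdd_meas_trig:
  assumes "g \<in> trig_fns d" "\<And>k. k < d \<Longrightarrow> W k \<in> borel_measurable M"
  shows "bdd_meas M (\<lambda>\<omega>. g (trunc_vec d (\<lambda>k. W k \<omega>)))"
  using assms(1)
proof induction
  case (cos \<xi> b)
  show ?case
    using assms(2)
    by (intro bdd_measI[of _ _ 1] borel_measurable_continuous_on[OF continuous_on_cos[OF continuous_on_id]]
      borel_measurable_add borel_measurable_sum borel_measurable_times borel_measurable_const)
      (auto simp: trunc_vec_def)
qed (auto intro: bdd_meas_add bdd_meas_mult bdd_meas_const)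

text \<open>A cosine with phase \<open>b\<close> is the real part of \<open>iexp b\<close> times a
  character, so its mean follows the characteristic function; sums and multiples are handled by
  induction.\<close>

lemma trig_fns_tendsto:
  fixes M :: "nat \<Rightarrow> 'a measure" and N :: "'b measure"
  assumes "g \<in> trig_fns d"
    and M: "\<And>n. prob_space (M n)" and N: "prob_space N"
    and W: "\<And>n k. k < d \<Longrightarrow> W n k \<in> borel_measurable (M n)"
    and Z: "\<And>k. k < d \<Longrightarrow> Z k \<in> borel_measurable N"
    and char: "\<And>\<xi>. (\<lambda>n. \<integral>\<omega>. iexp (\<Sum>k<d. \<xi> k * W n k \<omega>) \<partial>M n) \<longlonglongrightarrow> (\<integral>\<omega>. iexp (\<Sum>k<d. \<xi> k * Z k \<omega>) \<partial>N)"
  shows "(\<lambda>n. \<integral>\<omega>. g (trunc_vec d (\<lambda>k. W n k \<omega>)) \<partial>M n) \<longlonglongrightarrow> (\<integral>\<omega>. g (trunc_vec d (\<lambda>k. Z k \<omega>)) \<partial>N)"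
  using assms(1)
proof induction
  case (cos \<xi> b)
  have eq: "(\<integral>\<omega>. cos ((\<Sum>k<d. \<xi> k * trunc_vec d (\<lambda>k. V k \<omega>) k) + b) \<partial>P)
      = Re (iexp b * (\<integral>\<omega>. iexp (\<Sum>k<d. \<xi> k * V k \<omega>) \<partial>P))"
    if "prob_space P" and V: "\<And>k. k < d \<Longrightarrow> V k \<in> borel_measurable P" for V and P :: "'c measure"
  proof -
    interpret prob_space P by fact
    have b: "bdd_meas P (\<lambda>\<omega>. iexp b * iexp (\<Sum>k<d. \<xi> k * V k \<omega>))"
      by (intro bdd_meas_intros(3) bdd_meas_const bdd_meas_iexp) 
        (intro borel_measurable_sum borel_measurable_times borel_measurable_const V, simp)
    have "cos ((\<Sum>k<d. \<xi> k * trunc_vec d (\<lambda>k. V k \<omega>) k) + b) = Re (iexp b * iexp (\<Sum>k<d. \<xi> k * V k \<omega>))" for \<omega>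
      by (simp add: trunc_vec_def exp_add[symmetric] Re_exp add.commute flip: of_real_sum of_real_mult)
    then have "(\<integral>\<omega>. cos ((\<Sum>k<d. \<xi> k * trunc_vec d (\<lambda>k. V k \<omega>) k) + b) \<partial>P)
      = (\<integral>\<omega>. Re (iexp b * iexp (\<Sum>k<d. \<xi> k * V k \<omega>)) \<partial>P)" by simp
    also have "\<dots> = Re (\<integral>\<omega>. iexp b * iexp (\<Sum>k<d. \<xi> k * V k \<omega>) \<partial>P)"
      by (rule integral_Re[OF integrable_bdd_meas[OF b]])
    finally show ?thesis by simp
  qed
  have "(\<integral>\<omega>. cos ((\<Sum>k<d. \<xi> k * trunc_vec d (\<lambda>k. W n k \<omega>) k) + b) \<partial>M n)
      = Re (iexp b * (\<integral>\<omega>. iexp (\<Sum>k<d. \<xi> k * W n k \<omega>) \<partial>M n))" for n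
    by (rule eq[OF M]) (rule W)
  moreover have "(\<integral>\<omega>. cos ((\<Sum>k<d. \<xi> k * trunc_vec d (\<lambda>k. Z k \<omega>) k) + b) \<partial>N)
      = Re (iexp b * (\<integral>\<omega>. iexp (\<Sum>k<d. \<xi> k * Z k \<omega>) \<partial>N))"
    by (rule eq[OF N]) (rule Z)
  ultimately show ?case
    by (simp only:) (intro tendsto_intros char)
next
  case (add f g)
  have eq: "(\<integral>\<omega>. f (trunc_vec d (\<lambda>k. V k \<omega>)) + g (trunc_vec d (\<lambda>k. V k \<omega>)) \<partial>P)
      = (\<integral>\<omega>. f (trunc_vec d (\<lambda>k. V k \<omega>)) \<partial>P) + (\<integral>\<omega>. g (trunc_vec d (\<lambda>k. V k \<omega>)) \<partial>P)"
    if "prob_space P" and V: "\<And>k. k < d \<Longrightarrow> V k \<in> borel_measurable P" for V and P :: "'c measure"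
  proof -
    interpret prob_space P by fact
    show ?thesis
      by (intro Bochner_Integration.integral_add integrable_bdd_meas bdd_meas_trig add.hyps V)
  qed
  have "(\<integral>\<omega>. f (trunc_vec d (\<lambda>k. W n k \<omega>)) + g (trunc_vec d (\<lambda>k. W n k \<omega>)) \<partial>M n)
      = (\<integral>\<omega>. f (trunc_vec d (\<lambda>k. W n k \<omega>)) \<partial>M n) + (\<integral>\<omega>. g (trunc_vec d (\<lambda>k. W n k \<omega>)) \<partial>M n)" for n
    by (rule eq[OF M]) (rule W)
  moreover have "(\<integral>\<omega>. f (trunc_vec d (\<lambda>k. Z k \<omega>)) + g (trunc_vec d (\<lambda>k. Z k \<omega>)) \<partial>N)
      = (\<integral>\<omega>. f (trunc_vec d (\<lambda>k. Z k \<omega>)) \<partial>N) + (\<integral>\<omega>. g (trunc_vec d (\<lambda>k. Z k \<omega>)) \<partial>N)"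
    by (rule eq[OF N]) (rule Z)
  ultimately show ?case
    by (simp only:) (intro tendsto_intros add.IH)
next
  case (scale f c)
  then show ?case by (simp add: tendsto_mult_left)
qed

text \<open>Tychonoff's theorem.\<close>

lemma compact_cube: "compact {s :: nat \<Rightarrow> real. \<forall>k. \<bar>s k\<bar> \<le> 1}"
proof -
  have "compactin (product_topology (\<lambda>_. euclidean) UNIV) (PiE UNIV (\<lambda>_::nat. {-1..1::real}))"
    by (simp add: compactin_PiE)
  moreover have "PiE UNIV (\<lambda>_::nat. {-1..1::real}) = {s. \<forall>k. \<bar>s k\<bar> \<le> 1}"
    by (auto simp: PiE_iff abs_le_iff minus_le_iff)
  ultimately show ?thesis by (simp add: euclidean_product_topology)
qed

text \<open>Folding \<open>x \<mapsto> R arcsin (sin (x / R))\<close> is the identity on \<open>[-R, R]\<close>, so a function of the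
  folded coordinates agrees with \<open>f\<close> on a large cube, and it is a continuous function of the
  sines, hence uniformly close to a polynomial in the sines.\<close>

lemma trig_approx:
  fixes f :: "(nat \<Rightarrow> real) \<Rightarrow> real"
  assumes f: "continuous_on UNIV f" and "R > 0" "\<epsilon> > 0"
  obtains g where "g \<in> trig_fns d"
    "\<And>w. \<bar>f (\<lambda>k. R * arcsin (sin (trunc_vec d w k / R))) - g (trunc_vec d w)\<bar> < \<epsilon>"
proof -
  define S where "S = {s :: nat \<Rightarrow> real. (\<forall>k. \<bar>s k\<bar> \<le> 1) \<and> (\<forall>k\<ge>d. s k = 0)}"
  define A where "A = {p. continuous_on S p \<and> (\<lambda>x. p (\<lambda>k. if k < d then sin (x k / R) else 0)) \<in> trig_fns d}"
  have "closed {s :: nat \<Rightarrow> real. \<forall>k\<ge>d. s k = 0}"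
    by (intro closed_Collect_all closed_Collect_imp closed_Collect_eq continuous_on_product_coordinates)
      (auto intro: continuous_intros)
  then have "compact S"
    using compact_Int_closed[OF compact_cube] unfolding S_def by (simp add: Collect_conj_eq)
  interpret function_ring_on A S
  proof
    show "compact S" by fact
    show "(\<lambda>_. c) \<in> A" for c
      unfolding A_def using trig_fns.scale[OF trig_fns.cos[where \<xi> = "\<lambda>_. 0" and b = 0], where c = c and d = d]
      by simp
    show "f \<in> A \<Longrightarrow> g \<in> A \<Longrightarrow> (\<lambda>x. f x + g x) \<in> A" for f g
      unfolding A_def by (auto intro: continuous_on_add trig_fns.add)
    show "f \<in> A \<Longrightarrow> g \<in> A \<Longrightarrow> (\<lambda>x. f x * g x) \<in> A" for f g
      unfolding A_def by (auto intro: continuous_on_mult trig_fns_mult)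
    fix x y assume xy: "x \<in> S" "y \<in> S" "x \<noteq> y"
    then obtain k where k: "x k \<noteq> y k" by auto
    with xy have "k < d" unfolding S_def by (metis (mono_tags, lifting) mem_Collect_eq not_le)
    \<comment> \<open>The sine of one coordinate, written as a cosine with phase - pi / 2; these
      sines separate points.\<close>
    have "(\<lambda>x. cos ((\<Sum>j<d. (if j = k then 1 / R else 0) * x j) + (- pi / 2))) \<in> trig_fns d"
      by (rule trig_fns.cos)
    moreover have "cos ((\<Sum>j<d. (if j = k then 1 / R else 0) * x j) + (- pi / 2)) = sin (x k / R)" for x
      using \<open>k < d\<close> by (simp add: if_distrib[of "\<lambda>c. c * _"] cos_diff flip: cos_sin_eq cong: if_cong)
    ultimately have "(\<lambda>s. s k) \<in> A"
      unfolding A_def using \<open>k < d\<close>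
      by (auto intro: continuous_on_subset[OF continuous_on_product_coordinates])
    with k show "\<exists>f\<in>A. f x \<noteq> f y" by (intro bexI[of _ "\<lambda>s. s k"])
  qed (auto simp: A_def)
  have "continuous_on S (\<lambda>s. (\<lambda>k. R * arcsin (s k)))"
    by (intro continuous_on_coordinatewise_then_product continuous_intros
      continuous_on_subset[OF continuous_on_product_coordinates])
      (auto simp: S_def abs_le_iff minus_le_iff)
  then have "continuous_on S (\<lambda>s. f (\<lambda>k. R * arcsin (s k)))"
    by (rule continuous_on_compose2[OF f]) auto
  from Stone_Weierstrass_basic[OF this \<open>\<epsilon> > 0\<close>] obtain p
    where p: "p \<in> A" "\<And>s. s \<in> S \<Longrightarrow> \<bar>f (\<lambda>k. R * arcsin (s k)) - p s\<bar> < \<epsilon>" by blast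
  define g where "g x = p (\<lambda>k. if k < d then sin (x k / R) else 0)" for x
  have "\<bar>f (\<lambda>k. R * arcsin (sin (trunc_vec d w k / R))) - g (trunc_vec d w)\<bar> < \<epsilon>" for w
  proof -
    have "(\<lambda>k. if k < d then sin (trunc_vec d w k / R) else 0) = (\<lambda>k. sin (trunc_vec d w k / R))"
      by (auto simp: trunc_vec_def)
    moreover have "(\<lambda>k. sin (trunc_vec d w k / R)) \<in> S"
      unfolding S_def by (auto simp: trunc_vec_def)
    ultimately show ?thesis using p(2) unfolding g_def by simp
  qed
  moreover have "g \<in> trig_fns d" using p(1) unfolding A_def g_def by simp
  ultimately show ?thesis using that by blast
qed

text \<open>If all coordinates are at most \<open>R\<close> in modulus, folding changes nothing.
  Otherwise two values of \<open>f\<close> differ by at most 2 B, and R^2 is at most the sum of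
  squares, which gives a Chebyshev bound.\<close>

lemma (in prob_space) trig_approx_integral:
  fixes f g :: "(nat \<Rightarrow> real) \<Rightarrow> real"
  assumes f: "continuous_on UNIV f" "\<And>x. \<bar>f x\<bar> \<le> B"
    and g: "g \<in> trig_fns d"
      "\<And>w. \<bar>f (\<lambda>k. R * arcsin (sin (trunc_vec d w k / R))) - g (trunc_vec d w)\<bar> < \<epsilon>"
    and R: "R > 0"
    and W: "\<And>k. k < d \<Longrightarrow> W k \<in> borel_measurable M"
      "\<And>k. k < d \<Longrightarrow> integrable M (\<lambda>\<omega>. (W k \<omega>)\<^sup>2)" "\<And>k. k < d \<Longrightarrow> (\<integral>\<omega>. (W k \<omega>)\<^sup>2 \<partial>M) \<le> C"
  shows "\<bar>(\<integral>\<omega>. f (trunc_vec d (\<lambda>k. W k \<omega>)) \<partial>M) - (\<integral>\<omega>. g (trunc_vec d (\<lambda>k. W k \<omega>)) \<partial>M)\<bar>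
    \<le> \<epsilon> + 2 * B * (d * C) / R\<^sup>2"
proof -
  define V where "V \<omega> = trunc_vec d (\<lambda>k. W k \<omega>)" for \<omega>
  have "V \<in> borel_measurable M"
    unfolding V_def[abs_def] by (rule measurable_trunc_vec[OF W(1)])
  then have bf: "bdd_meas M (\<lambda>\<omega>. f (V \<omega>))"
    using measurable_compose[OF _ borel_measurable_continuous_onI[OF f(1)]] f(2)
    by (intro bdd_measI[of _ _ B]) simp_all
  have bg: "bdd_meas M (\<lambda>\<omega>. g (V \<omega>))"
    unfolding V_def by (rule bdd_meas_trig[OF g(1) W(1)])
  have B: "B \<ge> 0" using f(2)[of undefined] by linarith
  have pw: "\<bar>f (V \<omega>) - g (V \<omega>)\<bar> \<le> \<epsilon> + 2 * B / R\<^sup>2 * (\<Sum>k<d. (W k \<omega>)\<^sup>2)" for \<omega>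
  proof -
    define x where "x = (\<lambda>k. R * arcsin (sin (V \<omega> k / R)))"
    have "\<bar>f (V \<omega>) - f x\<bar> \<le> 2 * B / R\<^sup>2 * (\<Sum>k<d. (W k \<omega>)\<^sup>2)"
    proof (cases "\<forall>k<d. \<bar>W k \<omega>\<bar> \<le> R")
      case True
      have "x k = V \<omega> k" for k
      proof -
        have "\<bar>V \<omega> k / R\<bar> \<le> 1"
          using True R unfolding V_def trunc_vec_def by (auto simp: divide_le_eq)
        moreover have "1 \<le> pi / 2" using pi_gt3 by simp
        ultimately have "arcsin (sin (V \<omega> k / R)) = V \<omega> k / R"
          by (intro arcsin_sin) linarith+
        then show ?thesis unfolding x_def using R by simp
      qed
      then have "x = V \<omega>" by auto
      then show ?thesis using B by (simp add: sum_nonneg)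
    next
      case False
      then obtain k where k: "k < d" "R < \<bar>W k \<omega>\<bar>" by auto
      have "R\<^sup>2 \<le> (W k \<omega>)\<^sup>2" using k R by (intro abs_le_square_iff[THEN iffD1]) auto
      also have "\<dots> \<le> (\<Sum>k<d. (W k \<omega>)\<^sup>2)"
        using k by (intro member_le_sum) auto
      finally have "2 * B / R\<^sup>2 * R\<^sup>2 \<le> 2 * B / R\<^sup>2 * (\<Sum>k<d. (W k \<omega>)\<^sup>2)"
        using B by (intro mult_left_mono) auto
      then show ?thesis using R f(2)[of "V \<omega>"] f(2)[of x] by simp
    qed
    moreover have "\<bar>f x - g (V \<omega>)\<bar> < \<epsilon>"
      using g(2) unfolding x_def V_def .
    ultimately show ?thesis by linarith
  qed
  have iW: "integrable M (\<lambda>\<omega>. \<Sum>k<d. (W k \<omega>)\<^sup>2)"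
    using W(2) by (intro Bochner_Integration.integrable_sum) simp
  have "(\<integral>\<omega>. f (V \<omega>) \<partial>M) - (\<integral>\<omega>. g (V \<omega>) \<partial>M) = (\<integral>\<omega>. f (V \<omega>) - g (V \<omega>) \<partial>M)"
    using integrable_bdd_meas[OF bf] integrable_bdd_meas[OF bg] by simp
  then have "\<bar>(\<integral>\<omega>. f (V \<omega>) \<partial>M) - (\<integral>\<omega>. g (V \<omega>) \<partial>M)\<bar> \<le> (\<integral>\<omega>. \<bar>f (V \<omega>) - g (V \<omega>)\<bar> \<partial>M)"
    using integral_abs_bound[of M "\<lambda>\<omega>. f (V \<omega>) - g (V \<omega>)"] by (simp only:)
  also have "\<dots> \<le> (\<integral>\<omega>. \<epsilon> + 2 * B / R\<^sup>2 * (\<Sum>k<d. (W k \<omega>)\<^sup>2) \<partial>M)"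
    using pw iW integrable_bdd_meas[OF bdd_meas_abs[OF bdd_meas_diff[OF bf bg]]]
    by (intro integral_mono) simp_all
  also have "\<dots> = \<epsilon> + 2 * B / R\<^sup>2 * (\<Sum>k<d. \<integral>\<omega>. (W k \<omega>)\<^sup>2 \<partial>M)"
  proof -
    have "(\<integral>\<omega>. (\<Sum>k<d. (W k \<omega>)\<^sup>2) \<partial>M) = (\<Sum>k<d. \<integral>\<omega>. (W k \<omega>)\<^sup>2 \<partial>M)"
      using W(2) by (intro Bochner_Integration.integral_sum) simp
    with iW show ?thesis by (simp add: prob_space)
  qed
  also have "\<dots> \<le> \<epsilon> + 2 * B / R\<^sup>2 * (\<Sum>k<d. C)"
    using W(3) B by (intro add_left_mono mult_left_mono sum_mono) auto
  finally show ?thesis unfolding V_def by simp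
qed

text \<open>Levy's continuity theorem in dimension \<open>d\<close>. The common second-moment bound
  \<open>C\<close> replaces tightness: it allows the cut-off \<open>R\<close> to be chosen before
  \<open>n\<close>.\<close>

theorem multivariate_continuity:
  fixes M :: "nat \<Rightarrow> 'a measure" and N :: "'b measure" and f :: "(nat \<Rightarrow> real) \<Rightarrow> real"
  assumes M: "\<And>n. prob_space (M n)" and N: "prob_space N"
    and W: "\<And>n k. k < d \<Longrightarrow> W n k \<in> borel_measurable (M n)"
      "\<And>n k. k < d \<Longrightarrow> integrable (M n) (\<lambda>\<omega>. (W n k \<omega>)\<^sup>2)"
      "\<And>n k. k < d \<Longrightarrow> (\<integral>\<omega>. (W n k \<omega>)\<^sup>2 \<partial>M n) \<le> C"
    and Z: "\<And>k. k < d \<Longrightarrow> Z k \<in> borel_measurable N"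
      "\<And>k. k < d \<Longrightarrow> integrable N (\<lambda>\<omega>. (Z k \<omega>)\<^sup>2)"
      "\<And>k. k < d \<Longrightarrow> (\<integral>\<omega>. (Z k \<omega>)\<^sup>2 \<partial>N) \<le> C"
    and char: "\<And>\<xi>. (\<lambda>n. \<integral>\<omega>. iexp (\<Sum>k<d. \<xi> k * W n k \<omega>) \<partial>M n) \<longlonglongrightarrow> (\<integral>\<omega>. iexp (\<Sum>k<d. \<xi> k * Z k \<omega>) \<partial>N)"
    and f: "continuous_on UNIV f" "\<And>x. \<bar>f x\<bar> \<le> B"
  shows "(\<lambda>n. \<integral>\<omega>. f (trunc_vec d (\<lambda>k. W n k \<omega>)) \<partial>M n) \<longlonglongrightarrow> (\<integral>\<omega>. f (trunc_vec d (\<lambda>k. Z k \<omega>)) \<partial>N)"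
    (is "?I \<longlonglongrightarrow> ?J")
proof (rule LIMSEQ_I)
  fix e :: real assume "e > 0"
  have "((\<lambda>R::real. 2 * B * (d * C) / R\<^sup>2) \<longlongrightarrow> 0) at_top"
    by (intro tendsto_divide_0[OF tendsto_const] filterlim_at_top_imp_at_infinity
      filterlim_pow_at_top filterlim_ident) simp
  from tendsto_add[OF tendsto_const this]
  have "((\<lambda>R. e / 6 + 2 * B * (d * C) / R\<^sup>2) \<longlongrightarrow> e / 6) at_top" by simp
  then have "\<forall>\<^sub>F R in at_top. e / 6 + 2 * B * (d * C) / R\<^sup>2 < e / 3"
    by (rule order_tendstoD) (use \<open>e > 0\<close> in simp)
  then have "\<forall>\<^sub>F R in at_top. e / 6 + 2 * B * (d * C) / R\<^sup>2 < e / 3 \<and> R > 0"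
    using eventually_gt_at_top by (rule eventually_conj)
  then obtain R where R: "e / 6 + 2 * B * (d * C) / R\<^sup>2 < e / 3" "R > 0"
    by (auto dest: eventually_happens)
  obtain g where g: "g \<in> trig_fns d"
    "\<And>w. \<bar>f (\<lambda>k. R * arcsin (sin (trunc_vec d w k / R))) - g (trunc_vec d w)\<bar> < e / 6"
    using trig_approx[OF f(1) R(2), of "e / 6" d] \<open>e > 0\<close> by auto
  let ?I' = "\<lambda>n. \<integral>\<omega>. g (trunc_vec d (\<lambda>k. W n k \<omega>)) \<partial>M n"
  let ?J' = "\<integral>\<omega>. g (trunc_vec d (\<lambda>k. Z k \<omega>)) \<partial>N"
  have 1: "\<bar>?I n - ?I' n\<bar> < e / 3" for n
    using prob_space.trig_approx_integral[OF M f g R(2) W] R(1) by (rule le_less_trans)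
  have 2: "\<bar>?J - ?J'\<bar> < e / 3"
    using prob_space.trig_approx_integral[OF N f g R(2) Z] R(1) by (rule le_less_trans)
  have "?I' \<longlonglongrightarrow> ?J'"
    by (rule trig_fns_tendsto[OF g(1) M N W(1) Z(1) char])
  then obtain n0 where 3: "\<And>n. n \<ge> n0 \<Longrightarrow> \<bar>?I' n - ?J'\<bar> < e / 3"
    using LIMSEQ_D[of ?I' ?J' "e / 3"] \<open>e > 0\<close> by auto
  have "\<bar>?I n - ?J\<bar> < e" if "n \<ge> n0" for n
    using 1[of n] 2 3[OF that] by linarith
  then show "\<exists>n0. \<forall>n\<ge>n0. norm (?I n - ?J) < e" by auto
qed

section \<open>The uniform distribution on the sphere\<close>

text \<open>Matrix of the reflection in the hyperplane orthogonal to \<open>w\<close>, with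
  \<open>w\<close> of any nonzero length.\<close>

definition householder :: "nat \<Rightarrow> (nat \<Rightarrow> real) \<Rightarrow> nat \<Rightarrow> nat \<Rightarrow> real" where
  "householder p w i j = (if i = j then 1 else 0) - 2 * w i * w j / dot p w w"

lemma dot_diff_left: "dot p (\<lambda>i. u i - v i) x = dot p u x - dot p v x"
  unfolding dot_def by (simp add: left_diff_distrib sum_subtractf)

lemma dot_diff_right: "dot p x (\<lambda>i. u i - v i) = dot p x u - dot p x v"
  unfolding dot_def by (simp add: right_diff_distrib sum_subtractf)

lemma dot_commute: "dot p x y = dot p y x"
  unfolding dot_def by (simp add: mult.commute)

lemma dot_eq_L2: "dot p x x = (L2_set x {..<p})\<^sup>2"
  unfolding dot_def L2_set_def by (simp add: power2_eq_square sum_nonneg)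

lemma abs_dot_le: "\<bar>dot p x y\<bar> \<le> sqrt (dot p x x) * sqrt (dot p y y)"
proof -
  have "\<bar>dot p x y\<bar> \<le> (\<Sum>i<p. \<bar>x i\<bar> * \<bar>y i\<bar>)"
    unfolding dot_def by (intro order_trans[OF sum_abs]) (simp add: abs_mult)
  also have "\<dots> \<le> L2_set x {..<p} * L2_set y {..<p}" by (rule L2_set_mult_ineq)
  finally show ?thesis by (simp add: dot_eq_L2)
qed

lemma orthogonal_householder:
  assumes "dot p w w \<noteq> 0"
  shows "orthogonal_mat p (householder p w)"
  unfolding orthogonal_mat_def
proof (intro allI impI)
  fix i j assume ij: "i < p" "j < p"
  define s where "s = dot p w w"
  have s: "s \<noteq> 0" "(\<Sum>k<p. w k * w k) = s" using assms unfolding s_def dot_def by auto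
  have "(\<Sum>k<p. householder p w k i * householder p w k j)
      = (\<Sum>k<p. (if k = i then (if k = j then 1 else 0) else 0) - (if k = i then 2 * w k * w j / s else 0)
          - (if k = j then 2 * w k * w i / s else 0) + 4 * w i * w j / s\<^sup>2 * (w k * w k))"
    unfolding householder_def s_def[symmetric]
    by (intro sum.cong refl) (auto simp: algebra_simps power2_eq_square)
  also have "\<dots> = (if i = j then 1 else 0) - 2 * w i * w j / s - 2 * w j * w i / s + 4 * w i * w j / s\<^sup>2 * s"
  proof -
    have c: "(\<Sum>k<p. 4 * w i * w j / s\<^sup>2 * (w k * w k)) = 4 * w i * w j / s\<^sup>2 * s"
      unfolding sum_distrib_left[symmetric] s(2) ..
    show ?thesis using ij unfolding sum.distrib sum_subtractf c by simp
  qed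
  also have "\<dots> = (if i = j then 1 else 0)"
    using s(1) by (simp add: power2_eq_square)
  finally show "(\<Sum>k<p. householder p w k i * householder p w k j) = (if i = j then 1 else 0)" .
qed

text \<open>For |u| = |v| the reflection along u - v is symmetric and swaps u and v, so it can be
  moved from the argument to v. The equality of norms enters as w . w = - 2 v . w.\<close>

lemma dot_householder:
  assumes "dot p u u = dot p v v" "dot p w w \<noteq> 0" "w = (\<lambda>i. u i - v i)"
  shows "dot p v (mat_app p (householder p w) x) = dot p u x"
proof -
  define s where "s = dot p w w"
  have s: "s = - 2 * dot p v w" "s \<noteq> 0"
    using assms unfolding s_def by (auto simp: dot_diff_left dot_diff_right dot_commute)
  have "dot p v (mat_app p (householder p w) x) = (\<Sum>i<p. \<Sum>j<p. v i * (householder p w i j * x j))"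
    unfolding dot_def mat_app_def by (simp add: sum_distrib_left)
  also have "\<dots> = (\<Sum>j<p. \<Sum>i<p. v i * (householder p w i j * x j))"
    by (rule sum.swap)
  also have "\<dots> = (\<Sum>j<p. u j * x j)"
  proof (rule sum.cong[OF refl])
    fix j assume "j \<in> {..<p}"
    then have j: "j < p" by simp
    have "(\<Sum>i<p. v i * (householder p w i j * x j))
        = (\<Sum>i<p. (if i = j then v i * x j else 0) - 2 * w j * x j / s * (v i * w i))"
      unfolding householder_def s_def[symmetric]
      by (intro sum.cong refl) (auto simp: algebra_simps)
    also have "\<dots> = v j * x j - 2 * w j * x j / s * dot p v w"
      using j unfolding dot_def by (simp add: sum_subtractf sum_distrib_left)
    also have "\<dots> = u j * x j"
    proof -
      have d: "dot p v w = - s / 2" using s(1) by simp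
      show ?thesis unfolding d using s(2) assms(3) by (simp add: field_simps)
    qed
    finally show "(\<Sum>i<p. v i * (householder p w i j * x j)) = u j * x j" .
  qed
  finally show ?thesis unfolding dot_def .
qed

lemma measurable_dot: "dot p u \<in> borel_measurable (rspace p)"
  unfolding dot_def[abs_def] rspace_def by measurable

lemma measurable_mat_app: "mat_app p Q \<in> measurable (rspace p) (rspace p)"
  unfolding mat_app_def[abs_def] rspace_def by measurable

lemma sets_unit_sphere: "unit_sphere p \<in> sets (rspace p)"
  unfolding unit_sphere_def L2_set_def rspace_def by measurable

locale uniform_sphere =
  fixes p :: nat and \<mu> :: "(nat \<Rightarrow> real) measure"
  assumes unif: "uniform_on_sphere p \<mu>" and p2: "2 \<le> p"

sublocale uniform_sphere \<subseteq> prob_space \<mu>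
  using unif unfolding uniform_on_sphere_def by simp

context uniform_sphere
begin

text \<open>The uniform distribution is only almost surely carried by the sphere; \<open>onto\<close> moves the
  exceptional points there, so that all inner products below are bounded everywhere.\<close>

definition onto :: "(nat \<Rightarrow> real) \<Rightarrow> nat \<Rightarrow> real" where
  "onto x = (if x \<in> unit_sphere p then x else (\<lambda>i\<in>{..<p}. if i = 0 then 1 else 0))"

definition kern :: "(nat \<Rightarrow> real) \<Rightarrow> (nat \<Rightarrow> real) \<Rightarrow> real" where
  "kern x y = dot p (onto x) (onto y)"

lemma sets_mu: "sets \<mu> = sets (rspace p)" and AE_sphere: "AE x in \<mu>. x \<in> unit_sphere p"
  and distr_mat_app: "orthogonal_mat p Q \<Longrightarrow> distr \<mu> (rspace p) (mat_app p Q) = \<mu>"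
  using unif unfolding uniform_on_sphere_def by auto

lemma space_mu: "space \<mu> = space (rspace p)"
  by (rule sets_eq_imp_space_eq[OF sets_mu])

lemma measurable_mu: "measurable \<mu> N = measurable (rspace p) N"
  by (rule measurable_cong_sets[OF sets_mu refl])

lemma AE_onto: "AE x in \<mu>. onto x = x"
  using AE_sphere by eventually_elim (simp add: onto_def)

lemma onto_in_sphere: "onto x \<in> unit_sphere p"
  unfolding onto_def unit_sphere_def using p2
  by (auto simp: L2_set_def rspace_def space_PiM if_distrib[of "\<lambda>c. c\<^sup>2"] cong: if_cong)

lemma dot_onto: "dot p (onto x) (onto x) = 1"
  using onto_in_sphere[of x] unfolding unit_sphere_def by (simp add: dot_eq_L2)

lemma abs_dot_onto_le: "\<bar>dot p u (onto x)\<bar> \<le> sqrt (dot p u u)"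
  using abs_dot_le[of p u "onto x"] by (simp add: dot_onto)

lemma abs_kern_le: "\<bar>kern x y\<bar> \<le> 1"
  unfolding kern_def using abs_dot_onto_le[of "onto x" y] by (simp add: dot_onto)

lemma abs_onto_le: "i < p \<Longrightarrow> \<bar>onto x i\<bar> \<le> 1"
proof -
  assume i: "i < p"
  have "(onto x i)\<^sup>2 \<le> (\<Sum>j<p. (onto x j)\<^sup>2)"
    using i by (intro member_le_sum) auto
  also have "\<dots> = 1" using dot_onto[of x] by (simp add: dot_def power2_eq_square)
  finally show ?thesis by (simp add: abs_square_le_1)
qed

lemma measurable_onto: "onto \<in> measurable \<mu> (rspace p)"
proof -
  have "(\<lambda>i\<in>{..<p}. if i = 0 then 1 else 0) \<in> space (rspace p)"
    by (simp add: rspace_def space_PiM)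
  then show ?thesis
    unfolding onto_def[abs_def] measurable_mu using sets_unit_sphere
    by (intro measurable_If_set measurable_ident_sets measurable_const) (auto simp: space_mu Int_absorb2 sets.sets_into_space)
qed

lemma bdd_meas_onto: "i < p \<Longrightarrow> bdd_meas \<mu> (\<lambda>x. onto x i)"
  using measurable_compose[OF measurable_onto[unfolded rspace_def] measurable_component_singleton, of i]
  by (intro bdd_measI[of _ _ 1]) (auto intro: abs_onto_le)

lemma bdd_meas_dot_onto: "bdd_meas \<mu> (\<lambda>x. dot p u (onto x))"
  unfolding dot_def by (intro bdd_meas_intros bdd_meas_onto) simp

lemma kern_commute: "kern x y = kern y x"
  unfolding kern_def by (rule dot_commute)

lemma bdd_meas_kern: "bdd_meas (\<mu> \<Otimes>\<^sub>M \<mu>) (\<lambda>(x, y). kern x y)"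
  unfolding kern_def dot_def case_prod_beta
  by (intro bdd_meas_intros bdd_meas_compose[OF bdd_meas_onto, where f = fst]
    bdd_meas_compose[OF bdd_meas_onto, where f = snd]) auto

text \<open>The reflection that swaps u and v preserves \<mu>. It does not exist if u and v agree
  below \<open>p\<close>, but then the two functionals coincide. Only here is the invariance of
  \<mu> used directly.\<close>

lemma distr_dot:
  assumes "dot p u u = dot p v v"
  shows "distr \<mu> borel (dot p u) = distr \<mu> borel (dot p v)"
proof (cases "\<forall>i<p. u i = v i")
  case True
  then have "dot p u = dot p v" unfolding dot_def by auto
  then show ?thesis by simp
next
  case False
  define w where "w = (\<lambda>i. u i - v i)"
  from False obtain i where i: "i < p" "w i \<noteq> 0" unfolding w_def by auto
  have w: "dot p w w \<noteq> 0"
    unfolding dot_def using i by (subst sum_nonneg_eq_0_iff) auto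
  have "distr \<mu> borel (dot p v) = distr (distr \<mu> (rspace p) (mat_app p (householder p w))) borel (dot p v)"
    unfolding distr_mat_app[OF orthogonal_householder[OF w]] ..
  also have "\<dots> = distr \<mu> borel (dot p v \<circ> mat_app p (householder p w))"
    by (rule distr_distr[OF measurable_dot]) (simp add: measurable_mu measurable_mat_app)
  also have "dot p v \<circ> mat_app p (householder p w) = dot p u"
    using dot_householder[OF assms w w_def] by auto
  finally show ?thesis by simp
qed

lemma distr_dot_onto: "distr \<mu> borel (\<lambda>x. dot p u (onto x)) = distr \<mu> borel (dot p u)"
  using AE_onto
  by (intro distr_cong_AE refl bdd_meas_measurable[OF bdd_meas_dot_onto])
    (auto simp: measurable_mu measurable_dot)

lemma integral_dot_onto:
  fixes g :: "real \<Rightarrow> 'b::{banach, second_countable_topology}"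
  assumes "dot p u u = dot p v v" "g \<in> borel_measurable borel"
  shows "(\<integral>x. g (dot p u (onto x)) \<partial>\<mu>) = (\<integral>x. g (dot p v (onto x)) \<partial>\<mu>)"
proof -
  have "(\<integral>x. g (dot p u (onto x)) \<partial>\<mu>) = (\<integral>t. g t \<partial>distr \<mu> borel (\<lambda>x. dot p u (onto x)))" for u
    by (rule integral_distr[symmetric]) (auto intro: bdd_meas_measurable[OF bdd_meas_dot_onto] assms)
  then show ?thesis
    using distr_dot[OF assms(1)] by (simp add: distr_dot_onto)
qed

definition unit_vec :: "nat \<Rightarrow> nat \<Rightarrow> real" where
  "unit_vec i = (\<lambda>j. if j = i then 1 else 0)"

lemma dot_unit_vec: "i < p \<Longrightarrow> dot p (unit_vec i) x = x i"
  unfolding dot_def unit_vec_def by (simp add: if_distrib[of "\<lambda>c. c * _"] cong: if_cong)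

lemma dot_unit_vecs: "i < p \<Longrightarrow> dot p (unit_vec i) (unit_vec j) = (if i = j then 1 else 0)"
  by (simp add: dot_unit_vec) (simp add: unit_vec_def)

lemma sum_onto_sq: "(\<Sum>i<p. (onto x i)\<^sup>2) = 1"
  using dot_onto[of x] by (simp add: dot_def power2_eq_square)

lemma dot_scale: "dot p (\<lambda>i. c * u i) x = c * dot p u x" "dot p x (\<lambda>i. c * u i) = c * dot p x u"
  unfolding dot_def by (simp_all add: sum_distrib_left mult_ac)

lemma dot_add: "dot p (\<lambda>i. u i + v i) x = dot p u x + dot p v x" "dot p x (\<lambda>i. u i + v i) = dot p x u + dot p x v"
  unfolding dot_def by (simp_all add: sum.distrib algebra_simps)

text \<open>By invariance the value is |u|^2 times that of any single coordinate, and the squared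
  coordinates add up to 1.\<close>

lemma second_moment: "(\<integral>x. (dot p u (onto x))\<^sup>2 \<partial>\<mu>) = dot p u u / p"
proof -
  have eq: "(\<integral>x. (dot p u (onto x))\<^sup>2 \<partial>\<mu>) = dot p u u * (\<integral>x. (onto x i)\<^sup>2 \<partial>\<mu>)" if i: "i < p" for u i
  proof -
    have "dot p u u \<ge> 0" by (simp add: dot_eq_L2)
    then have "(\<integral>x. (dot p u (onto x))\<^sup>2 \<partial>\<mu>) = (\<integral>x. (dot p (\<lambda>j. sqrt (dot p u u) * unit_vec i j) (onto x))\<^sup>2 \<partial>\<mu>)"
      using i by (intro integral_dot_onto[of u _ "\<lambda>t. t\<^sup>2"]) (auto simp: dot_scale dot_unit_vecs)
    then show ?thesis
      using \<open>dot p u u \<ge> 0\<close> i by (simp add: dot_scale dot_unit_vec power_mult_distrib)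
  qed
  have "1 = (\<integral>x. (\<Sum>i<p. (onto x i)\<^sup>2) \<partial>\<mu>)" by (simp add: sum_onto_sq prob_space)
  also have "\<dots> = (\<Sum>i<p. \<integral>x. (onto x i)\<^sup>2 \<partial>\<mu>)"
    by (intro Bochner_Integration.integral_sum integrable_bdd_meas bdd_meas_intros bdd_meas_onto) simp
  finally have "dot p u u * 1 = (\<Sum>i<p. dot p u u * (\<integral>x. (onto x i)\<^sup>2 \<partial>\<mu>))"
    unfolding sum_distrib_left[symmetric] by (rule arg_cong)
  also have "\<dots> = (\<Sum>i<p. \<integral>x. (dot p u (onto x))\<^sup>2 \<partial>\<mu>)"
    by (intro sum.cong) (auto simp: eq)
  finally show ?thesis using p2 by (simp add: field_simps)
qed

text \<open>The sum and the difference of coordinates i and j have the law of sqrt 2 times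
  coordinate i. Adding their fourth moments gives 8 f = 4 f + 12 g, so f is three times the mixed
  moment g. For fixed i the mixed moments sum to at most the second moment 1 / p.\<close>

lemma fourth_moment: "(\<Sum>i<p. \<integral>x. onto x i ^ 4 \<partial>\<mu>) \<le> 3 / (real p - 1)"
proof -
  have mom: "(\<integral>x. onto x i ^ 4 \<partial>\<mu>) = 3 * (\<integral>x. (onto x i)\<^sup>2 * (onto x j)\<^sup>2 \<partial>\<mu>)"
    if ij: "i < p" "j < p" "i \<noteq> j" for i j
  proof -
    define f where "f = (\<integral>x. onto x i ^ 4 \<partial>\<mu>)"
    note b = bdd_meas_onto[OF ij(1)] bdd_meas_onto[OF ij(2)]
    have u: "(\<integral>x. (onto x i + c * onto x j) ^ 4 \<partial>\<mu>) = 4 * f" if c: "c\<^sup>2 = 1" for c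
    proof -
      have "(\<integral>x. dot p (\<lambda>k. unit_vec i k + c * unit_vec j k) (onto x) ^ 4 \<partial>\<mu>)
          = (\<integral>x. dot p (\<lambda>k. sqrt 2 * unit_vec i k) (onto x) ^ 4 \<partial>\<mu>)"
        using ij c by (intro integral_dot_onto[of _ _ "\<lambda>t. t ^ 4"])
          (auto simp: dot_scale dot_add dot_unit_vecs power2_eq_square)
      moreover have "sqrt 2 ^ 4 = (4::real)" using power_mult[of "sqrt 2" 2 2] by simp
      ultimately show ?thesis
        using ij by (simp add: dot_scale dot_add dot_unit_vec f_def power_mult_distrib)
    qed
    have j: "(\<integral>x. onto x j ^ 4 \<partial>\<mu>) = f"
      using integral_dot_onto[of "unit_vec j" "unit_vec i" "\<lambda>t. t ^ 4"] ij
      by (simp add: dot_unit_vecs) (simp add: dot_unit_vec f_def)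
    have "8 * f = (\<integral>x. (onto x i + 1 * onto x j) ^ 4 \<partial>\<mu>) + (\<integral>x. (onto x i + (- 1) * onto x j) ^ 4 \<partial>\<mu>)"
      by (subst (1 2) u) auto
    also have "\<dots> = (\<integral>x. (onto x i + 1 * onto x j) ^ 4 + (onto x i + (- 1) * onto x j) ^ 4 \<partial>\<mu>)"
      by (intro Bochner_Integration.integral_add[symmetric] integrable_bdd_meas bdd_meas_intros b)
    also have "\<dots> = (\<integral>x. 2 * onto x i ^ 4 + 12 * ((onto x i)\<^sup>2 * (onto x j)\<^sup>2) + 2 * onto x j ^ 4 \<partial>\<mu>)"
      by (intro Bochner_Integration.integral_cong refl) (simp add: eval_nat_numeral algebra_simps)
    also have "\<dots> = 2 * f + 12 * (\<integral>x. (onto x i)\<^sup>2 * (onto x j)\<^sup>2 \<partial>\<mu>) + 2 * f"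
    proof -
      have "integrable \<mu> (\<lambda>x. (onto x i)\<^sup>2 * (onto x j)\<^sup>2)" "integrable \<mu> (\<lambda>x. onto x i ^ 4)" "integrable \<mu> (\<lambda>x. onto x j ^ 4)"
        by (intro integrable_bdd_meas bdd_meas_intros b)+
      then show ?thesis by (simp add: j f_def)
    qed
    finally show ?thesis by (simp add: f_def)
  qed
  have "(real p - 1) * (\<integral>x. onto x i ^ 4 \<partial>\<mu>) \<le> 3 * (\<integral>x. (onto x i)\<^sup>2 \<partial>\<mu>)" if i: "i < p" for i
  proof -
    have "(real p - 1) * (\<integral>x. onto x i ^ 4 \<partial>\<mu>) = (\<Sum>j\<in>{..<p} - {i}. \<integral>x. onto x i ^ 4 \<partial>\<mu>)"
      using i p2 by (simp add: of_nat_diff)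
    also have "\<dots> = 3 * (\<Sum>j\<in>{..<p} - {i}. \<integral>x. (onto x i)\<^sup>2 * (onto x j)\<^sup>2 \<partial>\<mu>)"
      unfolding sum_distrib_left by (rule sum.cong) (use i mom in auto)
    also have "(\<Sum>j\<in>{..<p} - {i}. \<integral>x. (onto x i)\<^sup>2 * (onto x j)\<^sup>2 \<partial>\<mu>)
        = (\<integral>x. (\<Sum>j\<in>{..<p} - {i}. (onto x i)\<^sup>2 * (onto x j)\<^sup>2) \<partial>\<mu>)"
      using i by (intro Bochner_Integration.integral_sum[symmetric] integrable_bdd_meas bdd_meas_intros bdd_meas_onto) auto
    also have "\<dots> \<le> (\<integral>x. (onto x i)\<^sup>2 \<partial>\<mu>)"
    proof (intro integral_mono integrable_bdd_meas bdd_meas_intros bdd_meas_onto)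
      fix x
      have "(\<Sum>j\<in>{..<p} - {i}. (onto x j)\<^sup>2) \<le> (\<Sum>j<p. (onto x j)\<^sup>2)" by (intro sum_mono2) auto
      then have "(onto x i)\<^sup>2 * (\<Sum>j\<in>{..<p} - {i}. (onto x j)\<^sup>2) \<le> (onto x i)\<^sup>2 * 1"
        by (intro mult_left_mono) (auto simp: sum_onto_sq)
      then show "(\<Sum>j\<in>{..<p} - {i}. (onto x i)\<^sup>2 * (onto x j)\<^sup>2) \<le> (onto x i)\<^sup>2"
        by (simp add: sum_distrib_left)
    qed (use i in auto)
    finally show ?thesis by simp
  qed
  then have "(\<Sum>i<p. (real p - 1) * (\<integral>x. onto x i ^ 4 \<partial>\<mu>)) \<le> (\<Sum>i<p. 3 * (\<integral>x. (onto x i)\<^sup>2 \<partial>\<mu>))"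
    by (intro sum_mono) auto
  also have "\<dots> = (\<Sum>i<p. 3 * (1 / p))"
  proof (intro sum.cong refl)
    fix i assume "i \<in> {..<p}"
    then have i: "i < p" by simp
    show "3 * (\<integral>x. (onto x i)\<^sup>2 \<partial>\<mu>) = 3 * (1 / p)"
      using second_moment[of "unit_vec i"] dot_unit_vecs[OF i, of i] dot_unit_vec[OF i] by simp
  qed
  also have "\<dots> = 3" using p2 by simp
  finally have "(real p - 1) * (\<Sum>i<p. \<integral>x. onto x i ^ 4 \<partial>\<mu>) \<le> 3"
    unfolding sum_distrib_left .
  then show ?thesis using p2 by (simp add: pos_le_divide_eq mult.commute)
qed


section \<open>Characteristic function of a linear functional of a uniform point\<close>

text \<open>Averaging the characteristic function of \<open>u \<bullet> X\<close> over the \<open>2\<^sup>p\<close> vectors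
  \<open>(\<plusminus>\<rho>, \<dots>, \<plusminus>\<rho>)\<close>, which all have the same norm as \<open>u\<close>, replaces it by a product of cosines.\<close>

lemma char_dot_prod_cos:
  fixes \<rho> :: real
  assumes \<rho>: "dot p u u = real p * \<rho>\<^sup>2"
  shows "(\<integral>x. iexp (dot p u (onto x)) \<partial>\<mu>) = (\<integral>x. (\<Prod>k<p. complex_of_real (cos (\<rho> * onto x k))) \<partial>\<mu>)"
proof -
  define E where "E = PiE {..<p} (\<lambda>_. {-1, 1::real})"
  have E: "finite E" "card E = 2 ^ p"
    unfolding E_def by (auto intro: finite_PiE simp: card_PiE numeral_2_eq_2)
  have "(\<integral>x. iexp (dot p u (onto x)) \<partial>\<mu>) = (\<integral>x. (\<Prod>k<p. iexp (\<rho> * e k * onto x k)) \<partial>\<mu>)"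
    if e: "e \<in> E" for e
  proof -
    have e2: "e k * e k = 1" if "k < p" for k
      using PiE_mem[OF e[unfolded E_def], of k] that by auto
    have "dot p u u = dot p (\<lambda>k. \<rho> * e k) (\<lambda>k. \<rho> * e k)"
      unfolding dot_scale \<rho> by (simp add: dot_def e2 power2_eq_square)
    then have "(\<integral>x. iexp (dot p u (onto x)) \<partial>\<mu>) = (\<integral>x. iexp (dot p (\<lambda>k. \<rho> * e k) (onto x)) \<partial>\<mu>)"
      by (rule integral_dot_onto) simp
    then show ?thesis
      by (simp add: dot_def exp_sum sum_distrib_left mult.assoc)
  qed
  then have "(\<Sum>e\<in>E. \<integral>x. iexp (dot p u (onto x)) \<partial>\<mu>) = (\<Sum>e\<in>E. \<integral>x. (\<Prod>k<p. iexp (\<rho> * e k * onto x k)) \<partial>\<mu>)"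
    by (rule sum.cong[OF refl])
  then have "2 ^ p * (\<integral>x. iexp (dot p u (onto x)) \<partial>\<mu>) = (\<Sum>e\<in>E. \<integral>x. (\<Prod>k<p. iexp (\<rho> * e k * onto x k)) \<partial>\<mu>)"
    by (simp only: sum_constant E(2)) simp
  also have "\<dots> = (\<integral>x. (\<Sum>e\<in>E. \<Prod>k<p. iexp (\<rho> * e k * onto x k)) \<partial>\<mu>)"
    by (intro Bochner_Integration.integral_sum[symmetric] integrable_bdd_meas bdd_meas_intros bdd_meas_onto) simp
  also have "\<dots> = (\<integral>x. 2 ^ p * (\<Prod>k<p. complex_of_real (cos (\<rho> * onto x k))) \<partial>\<mu>)"
  proof (rule Bochner_Integration.integral_cong[OF refl])
    fix x
    have "(\<Sum>e\<in>E. \<Prod>k<p. iexp (\<rho> * e k * onto x k)) = (\<Prod>k<p. \<Sum>e\<in>{-1, 1}. iexp (\<rho> * e * onto x k))"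
      unfolding E_def by (rule prod_sum_PiE[symmetric]) auto
    also have "\<dots> = (\<Prod>k<p. 2 * complex_of_real (cos (\<rho> * onto x k)))"
      by (intro prod.cong refl) (simp add: complex_eq_iff Re_exp Im_exp)
    finally show "(\<Sum>e\<in>E. \<Prod>k<p. iexp (\<rho> * e k * onto x k)) = 2 ^ p * (\<Prod>k<p. complex_of_real (cos (\<rho> * onto x k)))"
      by (simp add: prod.distrib)
  qed
  finally show ?thesis
    unfolding integral_mult_right_zero by (rule mult_left_cancel[THEN iffD1, rotated]) simp
qed

text \<open>Both functions are compared with 1 - a^2 / 2; the errors a^4 / 24 and a^4 / 8 add up to
  a^4 / 6.\<close>

lemma abs_cos_minus_exp_le:
  fixes a :: real
  shows "\<bar>cos a - exp (- (a\<^sup>2) / 2)\<bar> \<le> a ^ 4 / 6"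
proof -
  have A: "cmod (iexp a - (\<Sum>k\<le>3. (\<i> * a) ^ k / fact k)) \<le> \<bar>a\<bar> ^ 4 / fact 4"
    using iexp_approx1[of a 3] by simp
  have B: "cos a - (1 - a\<^sup>2 / 2) = Re (iexp a - (\<Sum>k\<le>3. (\<i> * a) ^ k / fact k))"
    by (simp add: numeral_3_eq_3 Re_exp power2_eq_square fact_numeral)
  have "\<bar>cos a - (1 - a\<^sup>2 / 2)\<bar> \<le> \<bar>a\<bar> ^ 4 / fact 4"
    unfolding B by (rule order_trans[OF abs_Re_le_cmod A])
  then have 1: "\<bar>cos a - (1 - a\<^sup>2 / 2)\<bar> \<le> a ^ 4 / 24"
    by (simp add: fact_numeral)
  have "\<bar>exp (- b) - (1 - b)\<bar> \<le> b\<^sup>2 / 2" if "b \<ge> 0" for b :: real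
  proof -
    have "(1 - b + b\<^sup>2 / 2) * (1 + b + b\<^sup>2 / 2) = 1 + (b\<^sup>2)\<^sup>2 / 4"
      by (simp add: field_simps power2_eq_square)
    then have "1 \<le> (1 - b + b\<^sup>2 / 2) * (1 + b + b\<^sup>2 / 2)"
      by simp
    also have "\<dots> \<le> (1 - b + b\<^sup>2 / 2) * exp b"
    proof (rule mult_left_mono[OF exp_lower_Taylor_quadratic[OF that]])
      have "0 \<le> ((1 - b)\<^sup>2 + 1) / 2" by simp
      then show "0 \<le> 1 - b + b\<^sup>2 / 2" by (simp add: power2_eq_square algebra_simps)
    qed
    finally have "exp (- b) \<le> 1 - b + b\<^sup>2 / 2"
      by (simp add: exp_minus inverse_eq_divide divide_le_eq)
    moreover have "1 - b \<le> exp (- b)" using exp_ge_add_one_self[of "- b"] by simp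
    ultimately show ?thesis by simp
  qed
  from this[of "a\<^sup>2 / 2"] have "\<bar>exp (- (a\<^sup>2) / 2) - (1 - a\<^sup>2 / 2)\<bar> \<le> a ^ 4 / 8"
    by (simp add: power_divide)
  with 1 show ?thesis by linarith
qed

text \<open>Each cosine is replaced by a Gaussian factor exp (- (\<rho> x_k)^2 / 2). The product of
  these factors is constant on the sphere, since the squared coordinates sum to 1, and the total
  error is a multiple of the summed fourth moments, which are of order 1 / p.\<close>

lemma char_dot_approx:
  "cmod ((\<integral>x. iexp (dot p u (onto x)) \<partial>\<mu>) - exp (- dot p u u / (2 * p)))
    \<le> (dot p u u / p)\<^sup>2 / (2 * (real p - 1))"
proof -
  define \<rho> where "\<rho> = sqrt (dot p u u / p)"
  have "dot p u u \<ge> 0" by (simp add: dot_eq_L2)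
  then have \<rho>: "\<rho>\<^sup>2 = dot p u u / p" unfolding \<rho>_def by simp
  then have \<rho>': "dot p u u = p * \<rho>\<^sup>2" using p2 by simp
  let ?C = "\<lambda>x k. complex_of_real (cos (\<rho> * onto x k))"
  let ?G = "\<lambda>x k. complex_of_real (exp (- (\<rho> * onto x k)\<^sup>2 / 2))"
  have G: "(\<Prod>k<p. ?G x k) = exp (- dot p u u / (2 * p))" for x
  proof -
    have "(\<Prod>k<p. exp (- (\<rho> * onto x k)\<^sup>2 / 2)) = exp (\<Sum>k<p. - (\<rho> * onto x k)\<^sup>2 / 2)"
      by (simp add: exp_sum)
    also have "(\<Sum>k<p. - (\<rho> * onto x k)\<^sup>2 / 2) = - \<rho>\<^sup>2 / 2 * (\<Sum>k<p. (onto x k)\<^sup>2)"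
      by (simp add: sum_distrib_left power_mult_distrib)
    finally show ?thesis unfolding sum_onto_sq \<rho> by (simp flip: of_real_prod)
  qed
  have bC: "bdd_meas \<mu> (\<lambda>x. \<Prod>k<p. ?C x k)"
  proof (intro bdd_meas_prod bdd_meas_of_real)
    fix k assume "k \<in> {..<p}"
    then have [measurable]: "(\<lambda>x. onto x k) \<in> borel_measurable \<mu>"
      by (intro bdd_meas_measurable[OF bdd_meas_onto]) simp
    show "bdd_meas \<mu> (\<lambda>x. cos (\<rho> * onto x k))"
      by (rule bdd_measI[of _ _ 1]) auto
  qed
  define c where "c = complex_of_real (exp (- dot p u u / (2 * p)))"
  have Gc: "(\<Prod>k<p. ?G x k) = c" for x unfolding G c_def ..
  have "(\<integral>x. iexp (dot p u (onto x)) \<partial>\<mu>) - c = (\<integral>x. (\<Prod>k<p. ?C x k) \<partial>\<mu>) - (\<integral>x. c \<partial>\<mu>)"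
    unfolding char_dot_prod_cos[OF \<rho>'] by (simp add: prob_space)
  also have "\<dots> = (\<integral>x. (\<Prod>k<p. ?C x k) - c \<partial>\<mu>)"
    by (rule Bochner_Integration.integral_diff[OF integrable_bdd_meas[OF bC]
      integrable_bdd_meas[OF bdd_meas_const], symmetric])
  also have "cmod \<dots> \<le> (\<integral>x. (\<Sum>k<p. \<rho> ^ 4 / 6 * onto x k ^ 4) \<partial>\<mu>)"
  proof (rule norm_integral_le)
    show "bdd_meas \<mu> (\<lambda>x. (\<Prod>k<p. ?C x k) - c)"
      by (intro bdd_meas_diff bC bdd_meas_const)
    show "bdd_meas \<mu> (\<lambda>x. \<Sum>k<p. \<rho> ^ 4 / 6 * onto x k ^ 4)"
      by (intro bdd_meas_intros bdd_meas_onto) simp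
    fix x
    have "cmod ((\<Prod>k<p. ?C x k) - (\<Prod>k<p. ?G x k)) \<le> (\<Sum>k<p. cmod (?C x k - ?G x k))"
      by (rule norm_prod_diff) auto
    also have "\<dots> \<le> (\<Sum>k<p. \<rho> ^ 4 / 6 * onto x k ^ 4)"
    proof (rule sum_mono)
      fix k
      have "cmod (?C x k - ?G x k) = \<bar>cos (\<rho> * onto x k) - exp (- (\<rho> * onto x k)\<^sup>2 / 2)\<bar>"
        by (simp flip: of_real_diff)
      also have "\<dots> \<le> \<rho> ^ 4 / 6 * onto x k ^ 4"
        using abs_cos_minus_exp_le[of "\<rho> * onto x k"] by (simp add: power_mult_distrib)
      finally show "cmod (?C x k - ?G x k) \<le> \<rho> ^ 4 / 6 * onto x k ^ 4" .
    qed
    finally show "cmod ((\<Prod>k<p. ?C x k) - c) \<le> (\<Sum>k<p. \<rho> ^ 4 / 6 * onto x k ^ 4)"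
      unfolding Gc .
  qed
  also have "\<dots> = (\<Sum>k<p. \<integral>x. \<rho> ^ 4 / 6 * onto x k ^ 4 \<partial>\<mu>)"
    by (intro Bochner_Integration.integral_sum integrable_bdd_meas bdd_meas_intros bdd_meas_onto) simp
  also have "\<dots> = \<rho> ^ 4 / 6 * (\<Sum>k<p. \<integral>x. onto x k ^ 4 \<partial>\<mu>)"
    by (simp add: sum_distrib_left)
  also have "\<dots> \<le> \<rho> ^ 4 / 6 * (3 / (real p - 1))"
    by (intro mult_left_mono fourth_moment) simp
  also have "\<rho> ^ 4 = (dot p u u / p)\<^sup>2"
    unfolding \<rho>[symmetric] by simp
  also have "(dot p u u / p)\<^sup>2 / 6 * (3 / (real p - 1)) = (dot p u u / p)\<^sup>2 / (2 * (real p - 1))"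
    by simp
  finally show ?thesis unfolding c_def .
qed

section \<open>Linear functionals of a uniform point have no atoms\<close>

text \<open>The unit vectors \<open>v s\<close> in the proof parametrise the circle in the plane of the coordinates \<open>0\<close> and \<open>j\<close>
  rationally. The equation \<open>v s \<bullet> x = t\<close> is quadratic in \<open>s\<close>, so at most two of these equally likely events
  occur at once, unless the equation is trivial.\<close>

lemma atom_le:
  assumes u: "dot p u u = 1" and j: "0 < j" "j < p"
  shows "prob {x \<in> space \<mu>. dot p u (onto x) = t} \<le> prob {x \<in> space \<mu>. t = 0 \<and> onto x 0 = 0 \<and> onto x j = 0}"
proof -
  define b where "b = prob {x \<in> space \<mu>. t = 0 \<and> onto x 0 = 0 \<and> onto x j = 0}"
  define a where "a = prob {x \<in> space \<mu>. dot p u (onto x) = t}"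
  define v where "v s = (\<lambda>k. (1 - real s ^ 2) / (1 + real s ^ 2) * unit_vec 0 k + 2 * real s / (1 + real s ^ 2) * unit_vec j k)" for s :: nat
  have p0: "0 < p" using p2 by simp
  have nz: "1 + real s ^ 2 \<noteq> 0" for s by (metis add_pos_nonneg less_numeral_extra(1,3) zero_le_power2)
  have lin: "dot p (\<lambda>k. c * unit_vec 0 k + d * unit_vec j k) x = c * x 0 + d * x j" for c d x
    using j p0 by (simp add: dot_add dot_scale dot_unit_vec)
  have v1: "dot p (v s) (v s) = 1" for s
  proof -
    have "dot p (v s) (v s) = ((1 - real s ^ 2) / (1 + real s ^ 2))\<^sup>2 + (2 * real s / (1 + real s ^ 2))\<^sup>2"
      unfolding v_def lin using j by (simp add: unit_vec_def power2_eq_square)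
    also have "\<dots> = ((1 - real s ^ 2)\<^sup>2 + (2 * real s)\<^sup>2) / (1 + real s ^ 2)\<^sup>2"
      by (simp add: power_divide add_divide_distrib)
    also have "(1 - real s ^ 2)\<^sup>2 + (2 * real s)\<^sup>2 = (1 + real s ^ 2)\<^sup>2"
      by (simp add: power2_eq_square algebra_simps)
    finally show ?thesis using nz by simp
  qed
  have mm: "{x \<in> space \<mu>. dot p u (onto x) = t} \<in> events" for u
    using bdd_meas_measurable[OF bdd_meas_dot_onto[of u]] by measurable
  have mb: "{x \<in> space \<mu>. t = 0 \<and> onto x 0 = 0 \<and> onto x j = 0} \<in> events"
    using bdd_meas_measurable[OF bdd_meas_onto[OF p0]] bdd_meas_measurable[OF bdd_meas_onto[OF j(2)]] by measurable
  have av: "prob {x \<in> space \<mu>. dot p (v s) (onto x) = t} = a" for s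
  proof -
    have "prob {x \<in> space \<mu>. dot p w (onto x) = t} = measure (distr \<mu> borel (\<lambda>x. dot p w (onto x))) {t}" for w
      by (subst measure_distr[OF bdd_meas_measurable[OF bdd_meas_dot_onto]]) (auto intro!: arg_cong[of _ _ prob])
    then show ?thesis
      unfolding a_def distr_dot_onto using distr_dot[of "v s" u] u v1[of s] by (simp only:)
  qed
  \<comment> \<open>The expected number of the first n events that occur: at most 2 of them off the
    exceptional event, at most n on it. Since n is arbitrary, a <= b follows.\<close>
  have "real n * a \<le> 2 + real n * b" for n
  proof -
    have "real n * a = (\<Sum>s<n. prob {x \<in> space \<mu>. dot p (v s) (onto x) = t})"
      by (simp add: av)
    also have "\<dots> = (\<Sum>s<n. \<integral>x. indicator {x \<in> space \<mu>. dot p (v s) (onto x) = t} x \<partial>\<mu>)"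
      using mm by simp
    also have "\<dots> = (\<integral>x. (\<Sum>s<n. indicator {x \<in> space \<mu>. dot p (v s) (onto x) = t} x) \<partial>\<mu>)"
      by (intro Bochner_Integration.integral_sum[symmetric] integrable_bdd_meas bdd_meas_indicator mm)
    also have "\<dots> \<le> (\<integral>x. 2 + real n * indicator {x \<in> space \<mu>. t = 0 \<and> onto x 0 = 0 \<and> onto x j = 0} x \<partial>\<mu>)"
    proof (intro integral_mono integrable_bdd_meas bdd_meas_sum bdd_meas_add bdd_meas_mult bdd_meas_const
        bdd_meas_indicator mm mb)
      fix x assume x: "x \<in> space \<mu>"
      define q where "q = [:onto x 0 - t, 2 * onto x j, - onto x 0 - t:]"
      have root: "poly q (real s) = 0 \<longleftrightarrow> dot p (v s) (onto x) = t" for s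
      proof -
        have "dot p (v s) (onto x) = ((1 - real s ^ 2) * onto x 0 + 2 * real s * onto x j) / (1 + real s ^ 2)"
          unfolding v_def lin by (simp add: add_divide_distrib)
        also have "\<dots> = t \<longleftrightarrow> (1 - real s ^ 2) * onto x 0 + 2 * real s * onto x j = t * (1 + real s ^ 2)"
          using nz[of s] by (simp add: divide_eq_eq)
        also have "\<dots> \<longleftrightarrow> poly q (real s) = 0"
          unfolding q_def by (auto simp: power2_eq_square algebra_simps)
        finally show ?thesis ..
      qed
      have sum: "(\<Sum>s<n. indicator {x \<in> space \<mu>. dot p (v s) (onto x) = t} x :: real) = card {s. s < n \<and> poly q (real s) = 0}"
        using x by (simp add: indicator_def root sum.If_cases Int_def)
      show "(\<Sum>s<n. indicator {x \<in> space \<mu>. dot p (v s) (onto x) = t} x) \<le> 2 + real n * indicator {x \<in> space \<mu>. t = 0 \<and> onto x 0 = 0 \<and> onto x j = 0} x"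
      proof (cases "q = 0")
        case True
        then have "t = 0 \<and> onto x 0 = 0 \<and> onto x j = 0" unfolding q_def by auto
        moreover have "card {s. s < n \<and> poly q (real s) = 0} \<le> n"
          using card_mono[of "{..<n}" "{s. s < n \<and> poly q (real s) = 0}"] by auto
        ultimately show ?thesis unfolding sum using x by simp
      next
        case False
        have "card {s. s < n \<and> poly q (real s) = 0} = card (real ` {s. s < n \<and> poly q (real s) = 0})"
          by (intro card_image[symmetric] inj_on_of_nat)
        also have "\<dots> \<le> card {r. poly q r = 0}"
          by (intro card_mono poly_roots_finite False) auto
        also have "\<dots> \<le> degree q" by (rule card_poly_roots_bound[OF False])
        also have "\<dots> \<le> 2" unfolding q_def by (simp add: degree_pCons_eq_if)
        finally show ?thesis unfolding sum by (simp add: indicator_def)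
      qed
    qed
    also have "\<dots> = (\<integral>x. 2 \<partial>\<mu>) + (\<integral>x. real n * indicator {x \<in> space \<mu>. t = 0 \<and> onto x 0 = 0 \<and> onto x j = 0} x \<partial>\<mu>)"
      by (rule Bochner_Integration.integral_add)
        (intro integrable_bdd_meas bdd_meas_mult bdd_meas_const bdd_meas_indicator mb)+
    also have "\<dots> = 2 + real n * b"
      unfolding integral_mult_right_zero b_def Bochner_Integration.integral_indicator
        sets.Int_space_eq2[OF mb] by (simp only: lebesgue_integral_const prob_space) simp
    finally show ?thesis .
  qed
  then have *: "real n * (a - b) \<le> 2" for n by (simp add: algebra_simps)
  have "a - b \<le> 0"
  proof (rule ccontr)
    assume "\<not> a - b \<le> 0"
    then obtain n where "2 < real n * (a - b)" using reals_Archimedean3[of "a - b"] by auto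
    with *[of n] show False by simp
  qed
  then show ?thesis unfolding a_def b_def by simp
qed

text \<open>For t other than 0 the exceptional event of \<open>atom_le\<close> is empty. For t = 0,
  first take u to be a unit vector: on the event that coordinate 0 vanishes, every other coordinate
  vanishes almost surely as well, which contradicts norm 1. So that event is null, and it contains
  the exceptional event for general u.\<close>

lemma no_atoms:
  assumes u: "dot p u u = 1"
  shows "prob {x \<in> space \<mu>. dot p u (onto x) = t} = 0"
proof (cases "t = 0")
  case False
  then show ?thesis using atom_le[OF u, of 1 t] p2 by (simp add: measure_le_0_iff)
next
  case True
  have p0: "0 < p" using p2 by simp
  define A where "A = {x \<in> space \<mu>. onto x 0 = 0}"
  have m: "{x \<in> space \<mu>. onto x i = 0} \<in> events" if "i < p" for i
    using bdd_meas_measurable[OF bdd_meas_onto[OF that]] by measurable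
  have A: "A \<in> events" unfolding A_def using m[OF p0] .
  have d0: "dot p (unit_vec 0) (unit_vec 0) = 1" using p0 by (simp add: dot_unit_vecs)
  have "prob {x \<in> A. onto x j \<noteq> 0} = 0" if j: "0 < j" "j < p" for j
  proof -
    have eq: "{x \<in> A. onto x j \<noteq> 0} = A - {x \<in> space \<mu>. onto x 0 = 0 \<and> onto x j = 0}"
      unfolding A_def by auto
    have "{x \<in> space \<mu>. onto x 0 = 0 \<and> onto x j = 0} = {x \<in> space \<mu>. onto x 0 = 0} \<inter> {x \<in> space \<mu>. onto x j = 0}" by auto
    then have mj: "{x \<in> space \<mu>. onto x 0 = 0 \<and> onto x j = 0} \<in> events" using m[OF p0] m[OF j(2)] by auto
    have "prob A \<le> prob {x \<in> space \<mu>. onto x 0 = 0 \<and> onto x j = 0}"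
      using atom_le[OF d0 j, of 0] p0 by (simp add: dot_unit_vec A_def)
    moreover have "prob {x \<in> A. onto x j \<noteq> 0} = prob A - prob {x \<in> space \<mu>. onto x 0 = 0 \<and> onto x j = 0}"
      unfolding eq using A mj by (intro finite_measure_Diff) (auto simp: A_def)
    ultimately show ?thesis using measure_nonneg[of \<mu> "{x \<in> A. onto x j \<noteq> 0}"] by linarith
  qed
  moreover have "{x \<in> A. onto x j \<noteq> 0} \<in> events" if "j < p" for j
  proof -
    have "{x \<in> A. onto x j \<noteq> 0} = A - {x \<in> space \<mu>. onto x j = 0}" unfolding A_def by auto
    then show ?thesis using A m[OF that] by auto
  qed
  ultimately have "(\<Union>j\<in>{0<..<p}. {x \<in> A. onto x j \<noteq> 0}) \<in> null_sets \<mu>"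
    by (intro null_sets_UN') (auto simp: emeasure_eq_measure null_sets_def)
  moreover have "(\<Union>j\<in>{0<..<p}. {x \<in> A. onto x j \<noteq> 0}) = A"
  proof -
    have "\<exists>j\<in>{0<..<p}. onto x j \<noteq> 0" if "onto x 0 = 0" for x
    proof (rule ccontr)
      assume "\<not> (\<exists>j\<in>{0<..<p}. onto x j \<noteq> 0)"
      with that have "\<forall>i<p. onto x i = 0" by (metis greaterThanLessThan_iff neq0_conv)
      then have "(\<Sum>i<p. (onto x i)\<^sup>2) = 0" by simp
      then show False using sum_onto_sq[of x] by simp
    qed
    then show ?thesis unfolding A_def by auto
  qed
  ultimately have "prob A = 0" by (simp add: emeasure_eq_measure null_sets_def)
  moreover have "prob {x \<in> space \<mu>. dot p u (onto x) = 0} \<le> prob A"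
  proof -
    have "prob {x \<in> space \<mu>. dot p u (onto x) = 0} \<le> prob {x \<in> space \<mu>. (0::real) = 0 \<and> onto x 0 = 0 \<and> onto x 1 = 0}"
      using atom_le[OF u, of 1 0] p2 by simp
    also have "\<dots> \<le> prob A" using A unfolding A_def by (intro finite_measure_mono) auto
    finally show ?thesis .
  qed
  ultimately show ?thesis unfolding True by (simp add: measure_le_0_iff)
qed


end

section \<open>Distribution function and quantiles of the inner product\<close>

context uniform_sphere
begin

definition cdf_kern :: "real \<Rightarrow> real" where
  "cdf_kern = cdf (distr \<mu> borel (\<lambda>y. dot p (unit_vec 0) (onto y)))"

text \<open>That the value does not depend on \<open>x\<close> is the source of degeneracy. It holds
  for every \<open>x\<close>, not just almost every one, because \<open>onto x\<close> always has
  norm 1.\<close>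

lemma prob_kern_le: "prob {y \<in> space \<mu>. kern x y \<le> t} = cdf_kern t"
proof -
  have d0: "dot p (unit_vec 0) (unit_vec 0) = 1" using p2 by (simp add: dot_unit_vecs)
  have "prob {y \<in> space \<mu>. kern x y \<le> t} = measure (distr \<mu> borel (\<lambda>y. dot p (onto x) (onto y))) {..t}"
    unfolding kern_def
    by (subst measure_distr[OF bdd_meas_measurable[OF bdd_meas_dot_onto]]) (auto intro!: arg_cong[of _ _ prob])
  also have "distr \<mu> borel (\<lambda>y. dot p (onto x) (onto y)) = distr \<mu> borel (\<lambda>y. dot p (unit_vec 0) (onto y))"
    unfolding distr_dot_onto by (rule distr_dot) (simp add: d0 dot_onto)
  finally show ?thesis unfolding cdf_kern_def cdf_def .
qed

lemma real_distribution_dot: "real_distribution (distr \<mu> borel (\<lambda>y. dot p u (onto y)))"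
  by (rule real_distribution_distr) (rule bdd_meas_measurable[OF bdd_meas_dot_onto])

lemma cdf_kern_mono: "s \<le> t \<Longrightarrow> cdf_kern s \<le> cdf_kern t"
proof -
  interpret D: real_distribution "distr \<mu> borel (\<lambda>y. dot p (unit_vec 0) (onto y))" by (rule real_distribution_dot)
  show "s \<le> t \<Longrightarrow> cdf_kern s \<le> cdf_kern t"
    unfolding cdf_kern_def by (rule D.cdf_nondecreasing)
qed

lemma isCont_cdf_kern: "isCont cdf_kern t"
proof -
  interpret D: real_distribution "distr \<mu> borel (\<lambda>y. dot p (unit_vec 0) (onto y))" by (rule real_distribution_dot)
  have d0: "dot p (unit_vec 0) (unit_vec 0) = 1" using p2 by (simp add: dot_unit_vecs)
  have "measure (distr \<mu> borel (\<lambda>y. dot p (unit_vec 0) (onto y))) {t} = prob {y \<in> space \<mu>. dot p (unit_vec 0) (onto y) = t}"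
    by (subst measure_distr[OF bdd_meas_measurable[OF bdd_meas_dot_onto]]) (auto intro!: arg_cong[of _ _ prob])
  then show ?thesis
    unfolding cdf_kern_def D.isCont_cdf by (simp add: no_atoms[OF d0])
qed

lemma cdf_kern_1: "cdf_kern 1 = 1"
proof -
  obtain x where x: "x \<in> space \<mu>" using not_empty by blast
  have "{y \<in> space \<mu>. kern x y \<le> 1} = space \<mu>" using abs_kern_le[of x] by (auto simp: abs_le_iff)
  then show ?thesis using prob_kern_le[of x 1] prob_space by simp
qed

lemma cdf_kern_minus_1: "cdf_kern (- 1) = 0"
proof -
  obtain x where x: "x \<in> space \<mu>" using not_empty by blast
  \<comment> \<open>The kernel is at least - 1, so this event is an atom.\<close>
  have "kern x y \<le> - 1 \<longleftrightarrow> dot p (onto x) (onto y) = - 1" for y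
    using abs_kern_le[of x y] unfolding kern_def by linarith
  then have "prob {y \<in> space \<mu>. kern x y \<le> - 1} = 0"
    by (simp only: no_atoms[OF dot_onto])
  then show ?thesis by (simp only: prob_kern_le)
qed

lemma inner_cdf_eq: "inner_cdf p \<mu> t = cdf_kern t"
proof -
  interpret MM: pair_prob_space \<mu> \<mu> ..
  have dm: "(\<lambda>z. dot p (fst z) (snd z)) \<in> borel_measurable (\<mu> \<Otimes>\<^sub>M \<mu>)"
  proof -
    have "(\<lambda>z. fst z i) \<in> borel_measurable (\<mu> \<Otimes>\<^sub>M \<mu>)" "(\<lambda>z. snd z i) \<in> borel_measurable (\<mu> \<Otimes>\<^sub>M \<mu>)" if "i < p" for i
      using that by (auto intro!: measurable_compose[OF measurable_fst] measurable_compose[OF measurable_snd]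
        simp: measurable_mu rspace_def)
    then show ?thesis unfolding dot_def by (intro borel_measurable_sum borel_measurable_times) auto
  qed
  have km: "(\<lambda>z. kern (fst z) (snd z)) \<in> borel_measurable (\<mu> \<Otimes>\<^sub>M \<mu>)"
    using bdd_meas_measurable[OF bdd_meas_kern] by (simp add: case_prod_beta)
  define A where "A = {z \<in> space (\<mu> \<Otimes>\<^sub>M \<mu>). kern (fst z) (snd z) \<le> t}"
  have A: "A \<in> sets (\<mu> \<Otimes>\<^sub>M \<mu>)" unfolding A_def using km by measurable
  have "AE z in \<mu> \<Otimes>\<^sub>M \<mu>. dot p (fst z) (snd z) = kern (fst z) (snd z)"
  proof (rule MM.AE_pair_measure)
    show "{z \<in> space (\<mu> \<Otimes>\<^sub>M \<mu>). dot p (fst z) (snd z) = kern (fst z) (snd z)} \<in> sets (\<mu> \<Otimes>\<^sub>M \<mu>)"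
      using dm km by measurable
    show "AE x in \<mu>. AE y in \<mu>. dot p (fst (x, y)) (snd (x, y)) = kern (fst (x, y)) (snd (x, y))"
      using AE_onto
    proof eventually_elim
      fix x assume x: "onto x = x"
      show "AE y in \<mu>. dot p (fst (x, y)) (snd (x, y)) = kern (fst (x, y)) (snd (x, y))"
        using AE_onto by eventually_elim (simp add: kern_def x)
    qed
  qed
  then have "inner_cdf p \<mu> t = measure (\<mu> \<Otimes>\<^sub>M \<mu>) A"
    unfolding inner_cdf_def A_def using dm km
    by (intro measure_eq_AE) auto
  also have "\<dots> = cdf_kern t"
  proof -
    have "emeasure (\<mu> \<Otimes>\<^sub>M \<mu>) A = (\<integral>\<^sup>+x. emeasure \<mu> (Pair x -` A) \<partial>\<mu>)"
      by (rule emeasure_pair_measure_alt[OF A])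
    also have "\<dots> = (\<integral>\<^sup>+x. ennreal (cdf_kern t) \<partial>\<mu>)"
    proof (rule nn_integral_cong)
      fix x assume "x \<in> space \<mu>"
      then have "Pair x -` A = {y \<in> space \<mu>. kern x y \<le> t}"
        unfolding A_def by (auto simp: space_pair_measure)
      then show "emeasure \<mu> (Pair x -` A) = ennreal (cdf_kern t)"
        by (simp add: emeasure_eq_measure prob_kern_le)
    qed
    also have "\<dots> = ennreal (cdf_kern t)" by (simp add: emeasure_space_1)
    \<comment> \<open>Written as a probability, \<open>cdf_kern t\<close> is nonnegative, which is
      what removing \<open>ennreal\<close> requires.\<close>
    finally show ?thesis
      using prob_kern_le[of undefined t, symmetric] by (simp add: measure_def)
  qed
  finally show ?thesis .
qed

text \<open>Intermediate values exist because there are no atoms. The two end values are set by hand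
  so that a grid of quantiles spans all of [-1, 1].\<close>

lemma ex_quantile:
  "\<exists>q. q 0 = - 1 \<and> q 1 = 1 \<and> (\<forall>u\<in>{0..1}. q u \<in> {-1..1} \<and> cdf_kern (q u) = u)"
proof -
  have "\<exists>t\<in>{-1..1}. cdf_kern t = u" if "u \<in> {0..1}" for u
    using IVT[of cdf_kern "- 1" u 1] that isCont_cdf_kern by (auto simp: cdf_kern_1 cdf_kern_minus_1)
  then obtain q where "\<And>u. u \<in> {0..1} \<Longrightarrow> q u \<in> {-1..1} \<and> cdf_kern (q u) = u" by metis
  then show ?thesis
    by (intro exI[of _ "q(0 := - 1, 1 := 1)"]) (auto simp: cdf_kern_1 cdf_kern_minus_1)
qed

text \<open>Given the opposite vertices z and w, the inner integral over x is the characteristic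
  function at sqrt p (a z + c w), a vector of squared norm p (a^2 + c^2 + 2 a c \<tau>) with \<tau>
  = \<open>kern z w\<close>; likewise for y. The terms with \<tau> are the only coupling of the
  edges, and \<tau> has mean modulus at most 1 / sqrt p.\<close>

lemma char_cycle_approx:
  fixes a b c d :: real
  shows "cmod ((\<integral>z. \<integral>w. (\<integral>x. iexp (sqrt p * (a * kern z x + c * kern w x)) \<partial>\<mu>)
        * (\<integral>y. iexp (sqrt p * (b * kern z y + d * kern w y)) \<partial>\<mu>) \<partial>\<mu> \<partial>\<mu>)
      - exp (- (a\<^sup>2 + b\<^sup>2 + c\<^sup>2 + d\<^sup>2) / 2))
    \<le> ((\<bar>a\<bar> + \<bar>c\<bar>) ^ 4 + (\<bar>b\<bar> + \<bar>d\<bar>) ^ 4) / (2 * (real p - 1)) + \<bar>a * c + b * d\<bar> / sqrt p"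
proof -
  interpret MM: pair_prob_space \<mu> \<mu> ..
  define \<phi> where "\<phi> a c z w = (\<integral>x. iexp (sqrt p * (a * kern z x + c * kern w x)) \<partial>\<mu>)" for a c :: real and z w
  define e where "e a c \<tau> = exp (- (a\<^sup>2 + c\<^sup>2 + 2 * a * c * \<tau>) / 2)" for a c \<tau> :: real
  have quad: "0 \<le> a\<^sup>2 + c\<^sup>2 + 2 * a * c * \<tau>" "a\<^sup>2 + c\<^sup>2 + 2 * a * c * \<tau> \<le> (\<bar>a\<bar> + \<bar>c\<bar>)\<^sup>2" if "\<bar>\<tau>\<bar> \<le> 1" for a c \<tau> :: real
  proof -
    have "\<bar>2 * a * c * \<tau>\<bar> \<le> 2 * \<bar>a\<bar> * \<bar>c\<bar> * 1"
      unfolding abs_mult abs_numeral using that by (intro mult_left_mono) auto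
    moreover have "0 \<le> (\<bar>a\<bar> - \<bar>c\<bar>)\<^sup>2" by simp
    ultimately show "0 \<le> a\<^sup>2 + c\<^sup>2 + 2 * a * c * \<tau>" "a\<^sup>2 + c\<^sup>2 + 2 * a * c * \<tau> \<le> (\<bar>a\<bar> + \<bar>c\<bar>)\<^sup>2"
      by (simp_all add: power2_sum power2_diff)
  qed
  have phi: "cmod (\<phi> a c z w - e a c (kern z w)) \<le> (\<bar>a\<bar> + \<bar>c\<bar>) ^ 4 / (2 * (real p - 1))" for a c z w
  proof -
    define u where "u = (\<lambda>i. sqrt p * (a * onto z i + c * onto w i))"
    have du: "dot p u x = sqrt p * (a * dot p (onto z) x + c * dot p (onto w) x)" for x
      unfolding u_def by (simp add: dot_scale dot_add)
    have "dot p u u = sqrt p * (sqrt p * (a\<^sup>2 + c\<^sup>2 + 2 * a * c * kern z w))"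
      unfolding du by (subst (1 2) dot_commute, unfold du)
        (simp add: dot_onto kern_def dot_commute[of p "onto w" "onto z"] power2_eq_square algebra_simps)
    then have "dot p u u = p * (a\<^sup>2 + c\<^sup>2 + 2 * a * c * kern z w)"
      by (simp flip: mult.assoc)
    then have uu: "dot p u u / p = a\<^sup>2 + c\<^sup>2 + 2 * a * c * kern z w"
      using p2 by simp
    have "cmod (\<phi> a c z w - e a c (kern z w)) \<le> (a\<^sup>2 + c\<^sup>2 + 2 * a * c * kern z w)\<^sup>2 / (2 * (real p - 1))"
    proof -
      have "\<phi> a c z w = (\<integral>x. iexp (dot p u (onto x)) \<partial>\<mu>)"
        unfolding \<phi>_def du kern_def ..
      moreover have "exp (- dot p u u / (2 * p)) = e a c (kern z w)"
        unfolding e_def uu[symmetric] by simp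
      ultimately show ?thesis using char_dot_approx[of u] unfolding uu by simp
    qed
    also have "\<dots> \<le> ((\<bar>a\<bar> + \<bar>c\<bar>)\<^sup>2)\<^sup>2 / (2 * (real p - 1))"
      using quad[OF abs_kern_le] p2 by (intro divide_right_mono power_mono) auto
    finally show ?thesis by simp
  qed
  have phi_le: "cmod (\<phi> a c z w) \<le> 1" for a c z w
  proof -
    have "cmod (\<phi> a c z w) \<le> (\<integral>x. cmod (iexp (sqrt p * (a * kern z x + c * kern w x))) \<partial>\<mu>)"
      unfolding \<phi>_def by (rule integral_norm_bound)
    then show ?thesis by (simp add: prob_space)
  qed
  have e_bd: "0 \<le> e a c \<tau>" "e a c \<tau> \<le> 1" if "\<bar>\<tau>\<bar> \<le> 1" for a c \<tau>
    using quad[OF that, of a c] unfolding e_def by auto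
  define \<epsilon> where "\<epsilon> = ((\<bar>a\<bar> + \<bar>c\<bar>) ^ 4 + (\<bar>b\<bar> + \<bar>d\<bar>) ^ 4) / (2 * (real p - 1))"
  let ?E = "exp (- (a\<^sup>2 + b\<^sup>2 + c\<^sup>2 + d\<^sup>2) / 2)"
  have pw: "cmod (\<phi> a c z w * \<phi> b d z w - ?E) \<le> \<epsilon> + \<bar>a * c + b * d\<bar> * \<bar>kern z w\<bar>" for z w
  proof -
    define \<tau> where "\<tau> = kern z w"
    have \<tau>: "\<bar>\<tau>\<bar> \<le> 1" unfolding \<tau>_def by (rule abs_kern_le)
    have "cmod (\<phi> a c z w * \<phi> b d z w - e a c \<tau> * e b d \<tau>)
        = cmod ((\<phi> a c z w - e a c \<tau>) * \<phi> b d z w + e a c \<tau> * (\<phi> b d z w - e b d \<tau>))"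
      by (simp add: algebra_simps)
    also have "\<dots> \<le> cmod (\<phi> a c z w - e a c \<tau>) * cmod (\<phi> b d z w) + cmod (e a c \<tau>) * cmod (\<phi> b d z w - e b d \<tau>)"
      by (metis norm_mult norm_triangle_ineq)
    also have "\<dots> \<le> cmod (\<phi> a c z w - e a c \<tau>) * 1 + 1 * cmod (\<phi> b d z w - e b d \<tau>)"
      using phi_le e_bd[OF \<tau>] by (intro add_mono mult_mono) auto
    also have "\<dots> \<le> \<epsilon>"
      using phi[of a c z w] phi[of b d z w] unfolding \<epsilon>_def \<tau>_def by (simp add: add_divide_distrib)
    finally have 1: "cmod (\<phi> a c z w * \<phi> b d z w - e a c \<tau> * e b d \<tau>) \<le> \<epsilon>" .
    have lip: "\<bar>exp (- s) - exp (- t)\<bar> \<le> \<bar>s - t\<bar>" if "0 \<le> s" "0 \<le> t" for s t :: real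
    proof -
      have "exp (- s) - exp (- t) \<le> t - s" if "0 \<le> s" "s \<le> t" for s t :: real
      proof -
        have "exp (- s) - exp (- t) = exp (- s) * (1 - exp (- (t - s)))"
          by (simp add: right_diff_distrib flip: exp_add)
        also have "\<dots> \<le> 1 * (1 - exp (- (t - s)))"
          using that by (intro mult_right_mono) auto
        also have "\<dots> \<le> t - s" using exp_ge_add_one_self[of "s - t"] unfolding minus_diff_eq mult_1 by argo
        finally show ?thesis .
      qed
      from this[of s t] this[of t s] that show ?thesis
        by (cases s t rule: linorder_cases) auto
    qed
    have "e a c \<tau> * e b d \<tau> = exp (- ((a\<^sup>2 + c\<^sup>2 + 2 * a * c * \<tau>) / 2 + (b\<^sup>2 + d\<^sup>2 + 2 * b * d * \<tau>) / 2))"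
      unfolding e_def exp_add[symmetric] by (rule arg_cong[of _ _ exp]) (simp add: field_simps)
    moreover have "?E = exp (- ((a\<^sup>2 + b\<^sup>2 + c\<^sup>2 + d\<^sup>2) / 2))"
      by (rule arg_cong[of _ _ exp]) argo
    ultimately have "\<bar>e a c \<tau> * e b d \<tau> - ?E\<bar>
        \<le> \<bar>((a\<^sup>2 + c\<^sup>2 + 2 * a * c * \<tau>) / 2 + (b\<^sup>2 + d\<^sup>2 + 2 * b * d * \<tau>) / 2) - (a\<^sup>2 + b\<^sup>2 + c\<^sup>2 + d\<^sup>2) / 2\<bar>"
      using quad(1)[OF \<tau>, of a c] quad(1)[OF \<tau>, of b d] by (simp only:) (rule lip, auto)
    also have "\<dots> = \<bar>a * c + b * d\<bar> * \<bar>\<tau>\<bar>"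
      unfolding abs_mult[symmetric] by (rule arg_cong[of _ _ abs]) (simp add: field_simps)
    finally have 2: "cmod (e a c \<tau> * e b d \<tau> - ?E) \<le> \<bar>a * c + b * d\<bar> * \<bar>\<tau>\<bar>"
      by (simp flip: of_real_mult of_real_diff)
    have "cmod (\<phi> a c z w * \<phi> b d z w - ?E) \<le> cmod (\<phi> a c z w * \<phi> b d z w - e a c \<tau> * e b d \<tau>) + cmod (e a c \<tau> * e b d \<tau> - ?E)"
      using norm_triangle_ineq[of "\<phi> a c z w * \<phi> b d z w - e a c \<tau> * e b d \<tau>" "e a c \<tau> * e b d \<tau> - ?E"]
      by (simp only: of_real_diff diff_add_cancel add_diff_eq)
    with 1 2 show ?thesis unfolding \<tau>_def by linarith
  qed
  have b\<phi>: "bdd_meas (\<mu> \<Otimes>\<^sub>M \<mu>) (\<lambda>(z, w). \<phi> a c z w)" for a c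
  proof -
    have "bdd_meas ((\<mu> \<Otimes>\<^sub>M \<mu>) \<Otimes>\<^sub>M \<mu>) (\<lambda>(q, x). iexp (sqrt p * (a * kern (fst q) x + c * kern (snd q) x)))"
      unfolding case_prod_beta
      by (intro bdd_meas_intros
        bdd_meas_compose[OF bdd_meas_kern[unfolded case_prod_beta], of "\<lambda>r. (fst (fst r), snd r)", simplified]
        bdd_meas_compose[OF bdd_meas_kern[unfolded case_prod_beta], of "\<lambda>r. (snd (fst r), snd r)", simplified]) auto
    from bdd_meas_integral[OF this] show ?thesis
      unfolding \<phi>_def case_prod_beta .
  qed
  have b2: "bdd_meas (\<mu> \<Otimes>\<^sub>M \<mu>) (\<lambda>q. \<phi> a c (fst q) (snd q) * \<phi> b d (fst q) (snd q))"
    using b\<phi>[of a c] b\<phi>[of b d] unfolding case_prod_beta by (rule bdd_meas_mult)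
  have bk: "bdd_meas (\<mu> \<Otimes>\<^sub>M \<mu>) (\<lambda>q. kern (fst q) (snd q))"
    using bdd_meas_kern unfolding case_prod_beta .
  have eq: "(\<integral>z. \<integral>w. \<phi> a c z w * \<phi> b d z w \<partial>\<mu> \<partial>\<mu>) - ?E
      = (\<integral>q. \<phi> a c (fst q) (snd q) * \<phi> b d (fst q) (snd q) - ?E \<partial>(\<mu> \<Otimes>\<^sub>M \<mu>))"
    using MM.integral_fst'[OF MM.integrable_bdd_meas[OF b2]] MM.integrable_bdd_meas[OF b2]
    by (simp add: MM.prob_space)
  have "cmod ((\<integral>z. \<integral>w. \<phi> a c z w * \<phi> b d z w \<partial>\<mu> \<partial>\<mu>) - ?E) \<le> (\<integral>q. \<epsilon> + \<bar>a * c + b * d\<bar> * \<bar>kern (fst q) (snd q)\<bar> \<partial>(\<mu> \<Otimes>\<^sub>M \<mu>))"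
    unfolding eq using pw by (intro MM.norm_integral_le bdd_meas_intros b2 bk)
  also have "\<dots> = \<epsilon> + \<bar>a * c + b * d\<bar> * (\<integral>q. \<bar>kern (fst q) (snd q)\<bar> \<partial>(\<mu> \<Otimes>\<^sub>M \<mu>))"
    by (rule MM.integral_affine[OF bdd_meas_abs[OF bk]])
  also have "(\<integral>q. \<bar>kern (fst q) (snd q)\<bar> \<partial>(\<mu> \<Otimes>\<^sub>M \<mu>)) \<le> 1 / sqrt p"
  proof -
    have "(\<integral>q. \<bar>kern (fst q) (snd q)\<bar> \<partial>(\<mu> \<Otimes>\<^sub>M \<mu>)) = (\<integral>z. \<integral>w. \<bar>kern z w\<bar> \<partial>\<mu> \<partial>\<mu>)"
      using MM.integral_fst'[OF MM.integrable_bdd_meas[OF bdd_meas_abs[OF bk]]] by simp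
    also have "\<dots> \<le> (\<integral>z. 1 / sqrt p \<partial>\<mu>)"
    proof (rule integral_mono)
      show "integrable \<mu> (\<lambda>z. \<integral>w. \<bar>kern z w\<bar> \<partial>\<mu>)"
        by (rule integrable_bdd_meas[OF bdd_meas_integral], unfold case_prod_beta)
          (rule bdd_meas_abs[OF bk])
      fix z assume "z \<in> space \<mu>"
      have "(\<integral>w. \<bar>kern z w\<bar> \<partial>\<mu>) \<le> sqrt (\<integral>w. (kern z w)\<^sup>2 \<partial>\<mu>)"
        unfolding kern_def by (rule integral_abs_le_sqrt[OF bdd_meas_dot_onto])
      also have "\<dots> = 1 / sqrt p"
        unfolding kern_def second_moment by (simp add: dot_onto real_sqrt_divide)
      finally show "(\<integral>w. \<bar>kern z w\<bar> \<partial>\<mu>) \<le> 1 / sqrt p" .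
    qed simp
    finally show ?thesis by (simp add: prob_space)
  qed
  finally show ?thesis
    unfolding \<phi>_def \<epsilon>_def by (simp add: mult_left_mono)
qed

end

section \<open>Threshold kernels and their 4-cycles\<close>

locale quantile_sphere = uniform_sphere +
  fixes q :: "real \<Rightarrow> real"
  assumes q0: "q 0 = - 1" and q1: "q 1 = 1"
    and q_range: "u \<in> {0..1} \<Longrightarrow> q u \<in> {-1..1}"
    and cdf_q: "u \<in> {0..1} \<Longrightarrow> cdf_kern (q u) = u"
begin

text \<open>The kernel \<open>h\<^sub>u\<close> of the overview, evaluated after moving both points
  onto the sphere.\<close>

definition ind :: "real \<Rightarrow> (nat \<Rightarrow> real) \<Rightarrow> (nat \<Rightarrow> real) \<Rightarrow> real" where
  "ind u x y = of_bool (kern x y \<le> q u) - u"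

lemma q_mono: "u \<in> {0..1} \<Longrightarrow> v \<in> {0..1} \<Longrightarrow> u \<le> v \<Longrightarrow> q u \<le> q v"
  using cdf_kern_mono[of "q v" "q u"] cdf_q[of u] cdf_q[of v] by (cases "u = v") force+

lemma kern_section: "(\<lambda>y. kern x y) \<in> borel_measurable \<mu>"
  unfolding kern_def by (rule bdd_meas_measurable[OF bdd_meas_dot_onto])

lemma integral_kern_le: "(\<integral>y. of_bool (kern x y \<le> t) \<partial>\<mu>) = cdf_kern t"
  by (simp add: integral_of_bool_le prob_kern_le)

lemma bdd_meas_ind: "bdd_meas (\<mu> \<Otimes>\<^sub>M \<mu>) (\<lambda>(x, y). ind u x y)"
  unfolding ind_def case_prod_beta
  by (intro bdd_meas_diff bdd_meas_const bdd_meas_of_bool_le)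
    (use bdd_meas_measurable[OF bdd_meas_kern] in \<open>simp add: case_prod_beta\<close>)

lemma ind_commute: "ind u x y = ind u y x"
  unfolding ind_def by (simp add: kern_commute)

lemma bdd_meas_ind_section: "bdd_meas \<mu> (ind u x)"
  unfolding ind_def[abs_def] by (intro bdd_meas_diff bdd_meas_const bdd_meas_of_bool_le kern_section)

lemma integral_ind: "u \<in> {0..1} \<Longrightarrow> (\<integral>y. ind u x y \<partial>\<mu>) = 0"
  unfolding ind_def
  using integrable_bdd_meas[OF bdd_meas_of_bool_le[OF kern_section]]
  by (simp add: prob_space integral_kern_le cdf_q)

lemma abs_ind_le: "u \<in> {0..1} \<Longrightarrow> \<bar>ind u x y\<bar> \<le> 1"
  unfolding ind_def by (auto simp: of_bool_def)

text \<open>The product of two threshold indicators is the one at the lower level. Hence the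
  covariance given one point is already that of the bridge, in every dimension.\<close>

lemma integral_ind_ind:
  assumes "u \<in> {0..1}" "v \<in> {0..1}"
  shows "(\<integral>y. ind u x y * ind v x y \<partial>\<mu>) = min u v - u * v"
proof -
  have "ind u x y * ind v x y = of_bool (kern x y \<le> q (min u v)) - v * ind u x y - u * ind v x y - u * v" for y
  proof -
    have "q (min u v) = min (q u) (q v)"
      using q_mono[OF assms] q_mono[OF assms(2,1)] by (auto simp: min_def)
    then show ?thesis unfolding ind_def by (auto simp: of_bool_def algebra_simps)
  qed
  then have "(\<integral>y. ind u x y * ind v x y \<partial>\<mu>)
    = (\<integral>y. of_bool (kern x y \<le> q (min u v)) - v * ind u x y - u * ind v x y - u * v \<partial>\<mu>)"
    by (simp only:)
  also have "\<dots> = cdf_kern (q (min u v)) - v * 0 - u * 0 - u * v"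
    using integrable_bdd_meas[OF bdd_meas_of_bool_le[OF kern_section]]
      integrable_bdd_meas[OF bdd_meas_ind_section] assms
    by (simp add: prob_space integral_kern_le integral_ind)
  also have "cdf_kern (q (min u v)) = min u v"
    using assms by (intro cdf_q) (auto simp: min_def)
  finally show ?thesis by simp
qed

text \<open>The row variance is that of the same combination of bridge values. The summand 1 keeps
  the bound positive, and at least 1, when all coefficients vanish.\<close>

lemma degenerate_combination:
  assumes u: "\<And>k. k < d \<Longrightarrow> u k \<in> {0..1}"
  shows "degenerate_kernel \<mu> (\<lambda>x y. \<Sum>k<d. c k * ind (u k) x y) (1 + (\<Sum>k<d. \<bar>c k\<bar>))
    (\<Sum>k<d. \<Sum>l<d. c k * c l * (min (u k) (u l) - u k * u l))"
proof
  have int: "integrable \<mu> (\<lambda>y. c k * ind (u k) x y)" for k x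
    by (intro integrable_bdd_meas bdd_meas_mult bdd_meas_const bdd_meas_ind_section)
  have int2: "integrable \<mu> (\<lambda>y. ind (u k) x y * ind (u l) x y)" for k l x
    by (intro integrable_bdd_meas bdd_meas_mult bdd_meas_const bdd_meas_ind_section)
  show "bdd_meas (\<mu> \<Otimes>\<^sub>M \<mu>) (\<lambda>(x, y). \<Sum>k<d. c k * ind (u k) x y)"
    unfolding case_prod_beta
    by (intro bdd_meas_sum bdd_meas_mult bdd_meas_const bdd_meas_ind[unfolded case_prod_beta])
  show "(\<Sum>k<d. c k * ind (u k) x y) = (\<Sum>k<d. c k * ind (u k) y x)" for x y
    by (simp add: ind_commute)
  show "0 < 1 + (\<Sum>k<d. \<bar>c k\<bar>)" by (simp add: add_pos_nonneg sum_nonneg)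
  show "\<bar>\<Sum>k<d. c k * ind (u k) x y\<bar> \<le> 1 + (\<Sum>k<d. \<bar>c k\<bar>)" for x y
  proof -
    have "\<bar>\<Sum>k<d. c k * ind (u k) x y\<bar> \<le> (\<Sum>k<d. \<bar>c k\<bar> * 1)"
      using abs_ind_le u by (intro order_trans[OF sum_abs] sum_mono) (simp add: abs_mult mult_left_le)
    then show ?thesis by simp
  qed
  show "(\<integral>y. (\<Sum>k<d. c k * ind (u k) x y) \<partial>\<mu>) = 0" for x
    using u int by (simp add: Bochner_Integration.integral_sum integral_ind)
  show "(\<integral>y. (\<Sum>k<d. c k * ind (u k) x y)\<^sup>2 \<partial>\<mu>)
      = (\<Sum>k<d. \<Sum>l<d. c k * c l * (min (u k) (u l) - u k * u l))" for x
  proof -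
    have "(\<integral>y. (\<Sum>k<d. c k * ind (u k) x y)\<^sup>2 \<partial>\<mu>)
        = (\<integral>y. (\<Sum>k<d. \<Sum>l<d. c k * c l * (ind (u k) x y * ind (u l) x y)) \<partial>\<mu>)"
      by (simp add: power2_eq_square sum_product mult_ac)
    also have "\<dots> = (\<Sum>k<d. \<Sum>l<d. c k * c l * (\<integral>y. ind (u k) x y * ind (u l) x y \<partial>\<mu>))"
      using int2 by (simp add: Bochner_Integration.integral_sum)
    finally show ?thesis using u by (simp add: integral_ind_ind)
  qed
qed

text \<open>The increment is the indicator of a band between two quantiles minus its probability v -
  u: hence the bound 1, which the fourth-moment estimate asks for, and a Bernoulli variance.\<close>

lemma degenerate_increment:
  assumes uv: "u \<in> {0..1}" "v \<in> {0..1}" "u \<le> v"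
  shows "degenerate_kernel \<mu> (\<lambda>x y. ind v x y - ind u x y) 1 ((v - u) - (v - u)\<^sup>2)"
proof
  show "bdd_meas (\<mu> \<Otimes>\<^sub>M \<mu>) (\<lambda>(x, y). ind v x y - ind u x y)"
    unfolding case_prod_beta by (intro bdd_meas_diff bdd_meas_ind[unfolded case_prod_beta])
  show "ind v x y - ind u x y = ind v y x - ind u y x" for x y
    by (simp add: ind_commute)
  show "\<bar>ind v x y - ind u x y\<bar> \<le> 1" for x y
    using uv q_mono[OF uv] unfolding ind_def by (auto simp: of_bool_def)
  show "(\<integral>y. ind v x y - ind u x y \<partial>\<mu>) = 0" for x
    using integrable_bdd_meas[OF bdd_meas_ind_section] uv by (simp add: integral_ind)
  have int2: "integrable \<mu> (\<lambda>y. ind u x y * ind v x y)" for u v x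
    by (intro integrable_bdd_meas bdd_meas_mult bdd_meas_ind_section)
  show "(\<integral>y. (ind v x y - ind u x y)\<^sup>2 \<partial>\<mu>) = (v - u) - (v - u)\<^sup>2" for x
  proof -
    have "(\<integral>y. (ind v x y - ind u x y)\<^sup>2 \<partial>\<mu>)
        = (\<integral>y. ind v x y * ind v x y - 2 * (ind u x y * ind v x y) + ind u x y * ind u x y \<partial>\<mu>)"
      by (simp add: power2_eq_square algebra_simps)
    also have "\<dots> = (min v v - v * v) - 2 * (min u v - u * v) + (min u u - u * u)"
      using int2 uv by (simp add: integral_ind_ind)
    also have "\<dots> = (v - u) - (v - u)\<^sup>2"
      using uv by (simp add: min_def power2_eq_square algebra_simps)
    finally show ?thesis .
  qed
qed simp

lemma bdd_meas_kern_compose: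
  assumes "f \<in> measurable N \<mu>" "g \<in> measurable N \<mu>"
  shows "bdd_meas N (\<lambda>\<omega>. kern (f \<omega>) (g \<omega>))"
  using bdd_meas_compose[OF bdd_meas_kern, of "\<lambda>\<omega>. (f \<omega>, g \<omega>)" N] assms by simp

text \<open>The 4-cycle with vertices \<open>z, x, w, y\<close> has the edges \<open>zx, zy, wx, wy\<close>.\<close>

definition cycle_space :: "((nat \<Rightarrow> real) \<times> (nat \<Rightarrow> real) \<times> (nat \<Rightarrow> real) \<times> (nat \<Rightarrow> real)) measure" where
  "cycle_space = \<mu> \<Otimes>\<^sub>M (\<mu> \<Otimes>\<^sub>M (\<mu> \<Otimes>\<^sub>M \<mu>))"

definition cycle_edge :: "nat \<Rightarrow> (nat \<Rightarrow> real) \<times> (nat \<Rightarrow> real) \<times> (nat \<Rightarrow> real) \<times> (nat \<Rightarrow> real)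
    \<Rightarrow> (nat \<Rightarrow> real) \<times> (nat \<Rightarrow> real)" where
  "cycle_edge k = (\<lambda>(z, w, x, y). if k = 0 then (z, x) else if k = 1 then (z, y) else if k = 2 then (w, x) else (w, y))"

lemma prob_space_cycle: "prob_space cycle_space"
  unfolding cycle_space_def by (intro prob_space_pair) unfold_locales

lemma integral_cycle:
  fixes f :: "_ \<Rightarrow> 'b::{banach, second_countable_topology}"
  assumes "bdd_meas cycle_space f"
  shows "(\<integral>v. f v \<partial>cycle_space) = (\<integral>z. \<integral>w. \<integral>x. \<integral>y. f (z, w, x, y) \<partial>\<mu> \<partial>\<mu> \<partial>\<mu> \<partial>\<mu>)"
proof -
  have P2: "prob_space (\<mu> \<Otimes>\<^sub>M \<mu>)" and P3: "prob_space (\<mu> \<Otimes>\<^sub>M (\<mu> \<Otimes>\<^sub>M \<mu>))"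
    by (intro prob_space_pair prob_space_axioms)+
  note b = assms[unfolded cycle_space_def]
  have b3: "bdd_meas (\<mu> \<Otimes>\<^sub>M (\<mu> \<Otimes>\<^sub>M \<mu>)) (\<lambda>v. f (z, v))" if "z \<in> space \<mu>" for z
    by (rule bdd_meas_pair_section[OF b that])
  have b2: "bdd_meas (\<mu> \<Otimes>\<^sub>M \<mu>) (\<lambda>v. f (z, w, v))" if "z \<in> space \<mu>" "w \<in> space \<mu>" for z w
    by (rule bdd_meas_pair_section[OF b3[OF that(1)] that(2)])
  have "(\<integral>v. f v \<partial>cycle_space) = (\<integral>z. \<integral>v. f (z, v) \<partial>(\<mu> \<Otimes>\<^sub>M (\<mu> \<Otimes>\<^sub>M \<mu>)) \<partial>\<mu>)"
    unfolding cycle_space_def by (rule integral_pair_bdd[OF P3 b])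
  also have "\<dots> = (\<integral>z. \<integral>w. \<integral>v. f (z, w, v) \<partial>(\<mu> \<Otimes>\<^sub>M \<mu>) \<partial>\<mu> \<partial>\<mu>)"
    by (intro Bochner_Integration.integral_cong refl integral_pair_bdd P2 b3)
  also have "\<dots> = (\<integral>z. \<integral>w. \<integral>x. \<integral>y. f (z, w, x, y) \<partial>\<mu> \<partial>\<mu> \<partial>\<mu> \<partial>\<mu>)"
    by (intro Bochner_Integration.integral_cong refl integral_pair_bdd prob_space_axioms b2)
  finally show ?thesis .
qed

lemma measurable_cycle_edge:
  "(\<lambda>v. fst (cycle_edge k v)) \<in> measurable cycle_space \<mu>" "(\<lambda>v. snd (cycle_edge k v)) \<in> measurable cycle_space \<mu>"
  "cycle_edge k \<in> measurable cycle_space (\<mu> \<Otimes>\<^sub>M \<mu>)"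
  unfolding cycle_edge_def cycle_space_def case_prod_beta by (cases "k = 0"; cases "k = 1"; cases "k = 2"; simp)+

text \<open>Whichever edge is taken, its ends are two independent points and the other two vertices
  integrate out.\<close>

lemma integral_cycle_edge:
  fixes g :: "_ \<Rightarrow> real"
  assumes g: "bdd_meas (\<mu> \<Otimes>\<^sub>M \<mu>) g" and B: "\<And>x. x \<in> space \<mu> \<Longrightarrow> (\<integral>y. g (x, y) \<partial>\<mu>) \<le> B"
  shows "(\<integral>v. g (cycle_edge k v) \<partial>cycle_space) \<le> B"
proof -
  have b: "bdd_meas cycle_space (\<lambda>v. g (cycle_edge k v))"
    by (rule bdd_meas_compose[OF g measurable_cycle_edge(3)])
  have B': "(\<integral>x. \<integral>y. g (x, y) \<partial>\<mu> \<partial>\<mu>) \<le> B"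
    by (rule integral_le_const[OF bdd_meas_integral B]) (simp add: g)
  have eq: "(\<integral>v. g (cycle_edge k v) \<partial>cycle_space)
      = (\<integral>z. \<integral>w. \<integral>x. \<integral>y. g (cycle_edge k (z, w, x, y)) \<partial>\<mu> \<partial>\<mu> \<partial>\<mu> \<partial>\<mu>)"
    by (rule integral_cycle[OF b])
  show ?thesis
    unfolding eq unfolding cycle_edge_def
    by (cases "k = 0"; cases "k = 1"; cases "k = 2"; simp add: prob_space B')
qed

end

lemma char_prod_std_normal:
  fixes \<xi> :: "nat \<Rightarrow> real" and d :: nat
  shows
  "(\<integral>\<omega>. iexp (\<Sum>k<d. \<xi> k * \<omega> k) \<partial>PiM {..<d} (\<lambda>_. std_normal_distribution))
    = exp (- (\<Sum>k<d. (\<xi> k)\<^sup>2) / 2)"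
proof -
  interpret S: real_distribution std_normal_distribution by (rule real_dist_normal_dist)
  interpret product_prob_space "\<lambda>_::nat. std_normal_distribution" "{..<d}" by unfold_locales
  have "(\<integral>\<omega>. iexp (\<Sum>k<d. \<xi> k * \<omega> k) \<partial>PiM {..<d} (\<lambda>_. std_normal_distribution))
      = (\<integral>\<omega>. (\<Prod>k<d. iexp (\<xi> k * \<omega> k)) \<partial>PiM {..<d} (\<lambda>_. std_normal_distribution))"
    by (simp add: exp_sum sum_distrib_left)
  also have "\<dots> = (\<Prod>k<d. \<integral>x. iexp (\<xi> k * x) \<partial>std_normal_distribution)"
    by (intro product_integral_prod S.integrable_bdd_meas bdd_meas_iexp) auto
  also have "\<dots> = (\<Prod>k<d. complex_of_real (exp (- ((\<xi> k)\<^sup>2) / 2)))"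
    using char_std_normal_distribution unfolding char_def fun_eq_iff by simp
  also have "\<dots> = exp (- (\<Sum>k<d. (\<xi> k)\<^sup>2) / 2)"
  proof -
    have "(\<Prod>k<d. exp (- ((\<xi> k)\<^sup>2) / 2)) = exp (\<Sum>k<d. - ((\<xi> k)\<^sup>2) / 2)"
      by (rule exp_sum[symmetric]) simp
    also have "(\<Sum>k<d. - ((\<xi> k)\<^sup>2) / 2) = - (\<Sum>k<d. (\<xi> k)\<^sup>2) / 2"
      by (simp add: sum_negf sum_divide_distrib)
    finally show ?thesis by (simp only: of_real_prod[symmetric])
  qed
  finally show ?thesis .
qed

text \<open>The telescoping bound for factors of modulus at most 1, applied after dividing every
  factor by \<open>A\<close>.\<close>

lemma abs_prod_diff_le:
  fixes a b :: "nat \<Rightarrow> real"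
  assumes "\<And>k. \<bar>a k\<bar> \<le> A" "\<And>k. \<bar>b k\<bar> \<le> A" "A \<ge> 1"
  shows "\<bar>(\<Prod>k<d. a k) - (\<Prod>k<d. b k)\<bar> \<le> A ^ d * (\<Sum>k<d. \<bar>a k - b k\<bar>)"
proof -
  have A: "A > 0" using assms(3) by simp
  have "\<bar>(\<Prod>k<d. a k / A) - (\<Prod>k<d. b k / A)\<bar> \<le> (\<Sum>k<d. \<bar>a k / A - b k / A\<bar>)"
    using norm_prod_diff[of "{..<d}" "\<lambda>k. a k / A" "\<lambda>k. b k / A"] assms A by simp
  also have "(\<Prod>k<d. a k / A) - (\<Prod>k<d. b k / A) = ((\<Prod>k<d. a k) - (\<Prod>k<d. b k)) / A ^ d"
    by (simp add: prod_dividef diff_divide_distrib)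
  finally have "\<bar>(\<Prod>k<d. a k) - (\<Prod>k<d. b k)\<bar> \<le> A ^ d * (\<Sum>k<d. \<bar>a k / A - b k / A\<bar>)"
    using A by (simp add: abs_divide divide_le_eq mult.commute)
  also have "(\<Sum>k<d. \<bar>a k / A - b k / A\<bar>) \<le> (\<Sum>k<d. \<bar>a k - b k\<bar>)"
  proof (rule sum_mono)
    fix k
    have "\<bar>a k / A - b k / A\<bar> = \<bar>a k - b k\<bar> / A"
      using A by (simp add: abs_divide flip: diff_divide_distrib)
    also have "\<dots> \<le> \<bar>a k - b k\<bar>" using assms(3) by (simp add: divide_le_eq mult_left_le mult_le_cancel_left1)
    finally show "\<bar>a k / A - b k / A\<bar> \<le> \<bar>a k - b k\<bar>" .
  qed
  finally show ?thesis using A by (simp add: mult_left_mono)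
qed

section \<open>Growing dimension: normal limits and decay of the 4-cycle\<close>

locale sphere_sequence =
  fixes p :: "nat \<Rightarrow> nat" and \<mu> :: "nat \<Rightarrow> (nat \<Rightarrow> real) measure" and q :: "nat \<Rightarrow> real \<Rightarrow> real"
  assumes sph: "quantile_sphere (p n) (\<mu> n) (q n)"
    and p_lim: "filterlim p at_top sequentially"
begin

sublocale Q: quantile_sphere "p n" "\<mu> n" "q n" for n
  by (rule sph)

lemma real_p_lim: "filterlim (\<lambda>n. real (p n)) at_top sequentially"
  using filterlim_compose[OF filterlim_real_sequentially p_lim] .

lemma tendsto_inverse_p: "(\<lambda>n. c / (2 * (real (p n) - 1))) \<longlonglongrightarrow> 0"
proof -
  have "filterlim (\<lambda>n. 2 * (real (p n) - 1)) at_top sequentially"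
    by (rule filterlim_at_top_mono[OF real_p_lim]) (use Q.p2 in simp)
  then show ?thesis
    by (intro tendsto_divide_0[OF tendsto_const] filterlim_at_top_imp_at_infinity)
qed

lemma tendsto_inverse_sqrt_p: "(\<lambda>n. c / sqrt (p n)) \<longlonglongrightarrow> 0"
  by (intro tendsto_divide_0[OF tendsto_const] filterlim_at_top_imp_at_infinity
    filterlim_compose[OF sqrt_at_top real_p_lim])

text \<open>By invariance this is the law of sqrt p times the inner product of a uniform point with
  any fixed point of the sphere; Poincare's limit theorem makes it asymptotically standard
  normal.\<close>

definition scaled_law :: "nat \<Rightarrow> real measure" where
  "scaled_law n = distr (\<mu> n) borel (\<lambda>y. sqrt (p n) * dot (p n) (Q.unit_vec 0) (Q.onto n y))"

lemma measurable_scaled: "(\<lambda>y. sqrt (p n) * dot (p n) u (Q.onto n y)) \<in> borel_measurable (\<mu> n)"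
  by (intro borel_measurable_times borel_measurable_const bdd_meas_measurable[OF Q.bdd_meas_dot_onto])

lemma real_distribution_scaled_law: "real_distribution (scaled_law n)"
  unfolding scaled_law_def by (rule Q.real_distribution_distr[OF measurable_scaled])

lemma dot_unit0: "dot (p n) (Q.unit_vec 0) (Q.unit_vec 0) = 1"
  using Q.p2[of n] by (simp add: Q.dot_unit_vecs)

lemma weak_conv_scaled_law: "weak_conv_m scaled_law std_normal_distribution"
proof (rule levy_continuity[OF real_distribution_scaled_law real_dist_normal_dist])
  fix t :: real
  have "cmod (char (scaled_law n) t - exp (- (t\<^sup>2) / 2)) \<le> (t\<^sup>2)\<^sup>2 / (2 * (real (p n) - 1))" for n
  proof -
    define u where "u = (\<lambda>i. t * sqrt (p n) * Q.unit_vec 0 i)"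
    have "char (scaled_law n) t = (\<integral>y. iexp (t * (sqrt (p n) * dot (p n) (Q.unit_vec 0) (Q.onto n y))) \<partial>\<mu> n)"
      unfolding char_def scaled_law_def by (rule integral_distr[OF measurable_scaled]) simp
    also have "\<dots> = (\<integral>y. iexp (dot (p n) u (Q.onto n y)) \<partial>\<mu> n)"
      unfolding u_def Q.dot_scale by (simp add: mult.assoc)
    finally have c: "char (scaled_law n) t = (\<integral>y. iexp (dot (p n) u (Q.onto n y)) \<partial>\<mu> n)" .
    have "dot (p n) u u = p n * t\<^sup>2"
      unfolding u_def Q.dot_scale dot_unit0 by (simp add: power2_eq_square)
    then have "dot (p n) u u / p n = t\<^sup>2" "- dot (p n) u u / real (2 * p n) = - (t\<^sup>2) / 2"
      using Q.p2[of n] by simp_all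
    then show ?thesis
      using Q.char_dot_approx[of n u] unfolding c by (simp only:)
  qed
  then have "(\<lambda>n. char (scaled_law n) t - exp (- (t\<^sup>2) / 2)) \<longlonglongrightarrow> 0"
    by (intro Lim_null_comparison[OF always_eventually tendsto_inverse_p[of "(t\<^sup>2)\<^sup>2"]]) simp
  then show "(\<lambda>n. char (scaled_law n) t) \<longlonglongrightarrow> char std_normal_distribution t"
    unfolding char_std_normal_distribution by (rule LIM_zero_cancel)
qed

lemma isCont_cdf_std_normal: "isCont (cdf std_normal_distribution) x"
proof -
  interpret S: real_distribution std_normal_distribution by (rule real_dist_normal_dist)
  have "emeasure std_normal_distribution {x} = 0"
    by (subst emeasure_density) (auto simp: nn_integral_null_delta)
  then show ?thesis unfolding S.isCont_cdf by (simp add: measure_def)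
qed

lemma integral_scaled:
  fixes g :: "real \<Rightarrow> real"
  assumes "g \<in> borel_measurable borel"
  shows "(\<integral>y. g (sqrt (p n) * Q.kern n x y) \<partial>\<mu> n) = (\<integral>t. g t \<partial>scaled_law n)"
proof -
  have "(\<integral>t. g t \<partial>scaled_law n) = (\<integral>y. g (sqrt (p n) * dot (p n) (Q.unit_vec 0) (Q.onto n y)) \<partial>\<mu> n)"
    unfolding scaled_law_def by (rule integral_distr[OF measurable_scaled assms])
  also have "\<dots> = (\<integral>y. g (sqrt (p n) * dot (p n) (Q.onto n x) (Q.onto n y)) \<partial>\<mu> n)"
    by (rule Q.integral_dot_onto[where g = "\<lambda>t. g (sqrt (p n) * t)"])
      (use assms in \<open>simp_all add: dot_unit0 Q.dot_onto\<close>)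
  finally show ?thesis unfolding Q.kern_def ..
qed

lemma cdf_scaled_law: "cdf (scaled_law n) a = Q.cdf_kern n (a / sqrt (p n))"
proof -
  interpret S: real_distribution "scaled_law n" by (rule real_distribution_scaled_law)
  obtain x where "x \<in> space (\<mu> n)" using Q.not_empty by blast
  have "cdf (scaled_law n) a = (\<integral>t. of_bool (t \<le> a) \<partial>scaled_law n)"
    unfolding S.integral_of_bool_le cdf_def by (auto intro!: arg_cong[of _ _ S.prob])
  also have "\<dots> = (\<integral>y. of_bool (sqrt (p n) * Q.kern n x y \<le> a) \<partial>\<mu> n)"
    by (rule integral_scaled[symmetric]) (rule bdd_meas_measurable[OF bdd_meas_of_bool_le], simp)
  also have "\<dots> = (\<integral>y. of_bool (Q.kern n x y \<le> a / sqrt (p n)) \<partial>\<mu> n)"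
    using Q.p2[of n] by (simp add: pos_le_divide_eq mult.commute)
  also have "\<dots> = Q.cdf_kern n (a / sqrt (p n))" by (rule Q.integral_kern_le)
  finally show ?thesis .
qed

lemma cdf_scaled_law_tendsto: "(\<lambda>n. cdf (scaled_law n) a) \<longlonglongrightarrow> cdf std_normal_distribution a"
  using weak_conv_scaled_law isCont_cdf_std_normal unfolding weak_conv_m_def weak_conv_def by blast

text \<open>One of the two events contains the other, so the distance in mean is a difference of
  probabilities.\<close>

lemma integral_abs_of_bool_diff:
  "(\<integral>y. \<bar>(of_bool (Q.kern n x y \<le> s) :: real) - of_bool (Q.kern n x y \<le> t)\<bar> \<partial>\<mu> n) = \<bar>Q.cdf_kern n s - Q.cdf_kern n t\<bar>"
proof -
  have *: "(\<integral>y. \<bar>(of_bool (Q.kern n x y \<le> s) :: real) - of_bool (Q.kern n x y \<le> t)\<bar> \<partial>\<mu> n) = Q.cdf_kern n t - Q.cdf_kern n s"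
    if "s \<le> t" for s t
  proof -
    have "(\<integral>y. \<bar>(of_bool (Q.kern n x y \<le> s) :: real) - of_bool (Q.kern n x y \<le> t)\<bar> \<partial>\<mu> n)
      = (\<integral>y. of_bool (Q.kern n x y \<le> t) - of_bool (Q.kern n x y \<le> s) \<partial>\<mu> n)"
      using that by (intro Bochner_Integration.integral_cong) auto
    also have "\<dots> = Q.cdf_kern n t - Q.cdf_kern n s"
      unfolding Q.integral_kern_le[of n x, symmetric]
      by (intro Bochner_Integration.integral_diff Q.integrable_bdd_meas bdd_meas_of_bool_le Q.kern_section)
    finally show ?thesis .
  qed
  show ?thesis
  proof (cases "s \<le> t")
    case True
    then show ?thesis using *[OF True] Q.cdf_kern_mono[OF True, of n] by simp
  next
    case False
    then have "t \<le> s" by simp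
    then show ?thesis using *[of t s] Q.cdf_kern_mono[of t s n] by (simp add: abs_minus_commute)
  qed
qed

text \<open>Convergence of quantiles is bypassed: with \<open>a\<close> the normal quantile of
  \<open>u\<close>, the scaled distribution function at \<open>a\<close> tends to \<open>u\<close>,
  and nested threshold events are compared through their probabilities. The jump is then smoothed
  over a short interval [a, b] of small normal mass. For \<open>u\<close> equal to 0 or 1 the normal
  quantile is infinite and a constant serves instead.\<close>

lemma approx_ind:
  assumes u: "u \<in> {0..1}" and \<epsilon>: "\<epsilon> > 0"
  obtains \<psi> where "continuous_on UNIV \<psi>" "\<And>w. \<psi> w \<in> {0..1::real}"
    "\<forall>\<^sub>F n in sequentially. \<forall>x. (\<integral>y. \<bar>of_bool (Q.kern n x y \<le> q n u) - \<psi> (sqrt (p n) * Q.kern n x y)\<bar> \<partial>\<mu> n) \<le> \<epsilon>"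
proof (cases "u = 0 \<or> u = 1")
  case True
  have "(\<integral>y. \<bar>of_bool (Q.kern n x y \<le> q n u) - u\<bar> \<partial>\<mu> n) \<le> \<epsilon>" for n x
  proof (cases "u = 0")
    case True
    then have "(\<integral>y. \<bar>of_bool (Q.kern n x y \<le> q n u) - u\<bar> \<partial>\<mu> n) = u"
      using Q.integral_kern_le[of n x "q n u"] Q.cdf_q[OF u] by simp
    then show ?thesis using True \<epsilon> by simp
  next
    case False
    then have "u = 1" using \<open>u = 0 \<or> u = 1\<close> by simp
    then have "of_bool (Q.kern n x y \<le> q n u) = (1::real)" for y
      using Q.abs_kern_le[of n x y] by (simp add: Q.q1 abs_le_iff)
    then show ?thesis using \<open>u = 1\<close> \<epsilon> by simp
  qed
  then show ?thesis
    using u by (intro that[of "\<lambda>_. u"]) auto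
next
  case False
  then have u: "0 < u" "u < 1" using u by auto
  interpret S: real_distribution std_normal_distribution by (rule real_dist_normal_dist)
  let ?F = "cdf std_normal_distribution"
  have "\<forall>\<^sub>F x in at_bot. ?F x < u" using S.cdf_lim_at_bot u(1) by (rule order_tendstoD)
  then obtain l where l: "?F l < u" by (metis eventually_at_bot_linorder order_refl)
  have "\<forall>\<^sub>F x in at_top. u < ?F x" using S.cdf_lim_at_top_prob u(2) by (rule order_tendstoD)
  then obtain r where r: "u < ?F r" by (metis eventually_at_top_linorder order_refl)
  have "l \<le> r" using l r S.cdf_nondecreasing[of r l] by force
  then obtain a where a: "?F a = u"
    using IVT[of ?F l u r] l r isCont_cdf_std_normal by auto
  obtain \<delta> where \<delta>: "\<delta> > 0" "\<And>x. \<bar>x - a\<bar> < \<delta> \<Longrightarrow> \<bar>?F x - ?F a\<bar> < \<epsilon> / 2"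
    using isCont_cdf_std_normal[of a] \<epsilon> unfolding continuous_at_eps_delta dist_real_def by (metis half_gt_zero)
  define b where "b = a + \<delta> / 2"
  have ab: "a < b" and Fb: "\<bar>?F b - u\<bar> < \<epsilon> / 2" using \<delta> a unfolding b_def by auto
  have bound: "(\<integral>y. \<bar>of_bool (Q.kern n x y \<le> q n u) - cts_step a b (sqrt (p n) * Q.kern n x y)\<bar> \<partial>\<mu> n)
      \<le> \<bar>u - cdf (scaled_law n) a\<bar> + \<bar>cdf (scaled_law n) a - cdf (scaled_law n) b\<bar>" for n x
  proof -
    define k where "k y = Q.kern n x y" for y
    define s where "s = sqrt (p n)"
    have s: "s > 0" unfolding s_def using Q.p2[of n] by simp
    have k: "k \<in> borel_measurable (\<mu> n)" unfolding k_def by (rule Q.kern_section)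
    have bc: "bdd_meas (\<mu> n) (\<lambda>y. cts_step a b (s * k y))"
    proof (rule bdd_measI[of _ _ 1])
      have "cts_step a b \<in> borel_measurable borel"
        by (intro borel_measurable_continuous_onI uniformly_continuous_imp_continuous cts_step_uniformly_continuous ab)
      then show "(\<lambda>y. cts_step a b (s * k y)) \<in> borel_measurable (\<mu> n)"
        using k by simp
      show "norm (cts_step a b (s * k y)) \<le> 1" for y
        using ab by (auto simp: cts_step_def)
    qed
    note bo = bdd_meas_of_bool_le[OF k]
    have "(\<integral>y. \<bar>of_bool (k y \<le> q n u) - cts_step a b (s * k y)\<bar> \<partial>\<mu> n)
      \<le> (\<integral>y. \<bar>of_bool (k y \<le> q n u) - of_bool (k y \<le> a / s)\<bar> + \<bar>of_bool (k y \<le> a / s) - of_bool (k y \<le> b / s)\<bar> \<partial>\<mu> n)"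
    proof (intro integral_mono Q.integrable_bdd_meas bdd_meas_abs bdd_meas_diff bdd_meas_add bo bc)
      fix y
      have e: "k y \<le> a / s \<longleftrightarrow> s * k y \<le> a" "k y \<le> b / s \<longleftrightarrow> s * k y \<le> b"
        using s by (auto simp: pos_le_divide_eq mult.commute)
      have "\<bar>of_bool (s * k y \<le> a) - cts_step a b (s * k y)\<bar> \<le> \<bar>of_bool (s * k y \<le> a) - of_bool (s * k y \<le> b)\<bar>"
        using ab by (auto simp: cts_step_def)
      then show "\<bar>of_bool (k y \<le> q n u) - cts_step a b (s * k y)\<bar>
        \<le> \<bar>of_bool (k y \<le> q n u) - of_bool (k y \<le> a / s)\<bar> + \<bar>of_bool (k y \<le> a / s) - of_bool (k y \<le> b / s)\<bar>"
        unfolding e by linarith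
    qed
    also have "\<dots> = (\<integral>y. \<bar>of_bool (k y \<le> q n u) - of_bool (k y \<le> a / s)\<bar> \<partial>\<mu> n)
        + (\<integral>y. \<bar>of_bool (k y \<le> a / s) - of_bool (k y \<le> b / s)\<bar> \<partial>\<mu> n)"
      by (intro Bochner_Integration.integral_add Q.integrable_bdd_meas bdd_meas_abs bdd_meas_diff bo)
    also have "\<dots> = \<bar>Q.cdf_kern n (q n u) - Q.cdf_kern n (a / s)\<bar> + \<bar>Q.cdf_kern n (a / s) - Q.cdf_kern n (b / s)\<bar>"
      unfolding k_def integral_abs_of_bool_diff ..
    also have "Q.cdf_kern n (q n u) = u" using u by (intro Q.cdf_q) auto
    finally show ?thesis unfolding k_def s_def cdf_scaled_law .
  qed
  have "(\<lambda>n. \<bar>u - cdf (scaled_law n) a\<bar> + \<bar>cdf (scaled_law n) a - cdf (scaled_law n) b\<bar>) \<longlonglongrightarrow> \<bar>u - ?F a\<bar> + \<bar>?F a - ?F b\<bar>"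
    by (intro tendsto_intros cdf_scaled_law_tendsto)
  moreover have "\<bar>u - ?F a\<bar> + \<bar>?F a - ?F b\<bar> < \<epsilon>" using a Fb \<epsilon> by (simp add: abs_minus_commute)
  ultimately have "\<forall>\<^sub>F n in sequentially. \<bar>u - cdf (scaled_law n) a\<bar> + \<bar>cdf (scaled_law n) a - cdf (scaled_law n) b\<bar> < \<epsilon>"
    by (rule order_tendstoD)
  then have "\<forall>\<^sub>F n in sequentially. \<forall>x. (\<integral>y. \<bar>of_bool (Q.kern n x y \<le> q n u) - cts_step a b (sqrt (p n) * Q.kern n x y)\<bar> \<partial>\<mu> n) \<le> \<epsilon>"
    by eventually_elim (use bound in \<open>meson order_trans less_imp_le\<close>)
  moreover have "continuous_on UNIV (cts_step a b)"
    by (intro uniformly_continuous_imp_continuous cts_step_uniformly_continuous ab)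
  moreover have "cts_step a b w \<in> {0..1}" for w
    using ab by (auto simp: cts_step_def divide_simps)
  ultimately show ?thesis by (rule that[rotated 2])
qed

end

context quantile_sphere
begin

text \<open>Given z and w, the vertices x and y contribute equal independent factors, whence the
  square. The right-hand side is \<open>cov_norm\<close> of the kernel.\<close>

lemma integral_cycle_product:
  assumes h: "bdd_meas (\<mu> \<Otimes>\<^sub>M \<mu>) (\<lambda>(x, y). h x y)"
  shows "(\<integral>v. (\<Prod>k<4. h (fst (cycle_edge k v)) (snd (cycle_edge k v))) \<partial>cycle_space)
    = (\<integral>z. \<integral>w. (\<integral>x. h z x * h w x \<partial>\<mu>)\<^sup>2 \<partial>\<mu> \<partial>\<mu> :: real)"
proof -
  have b: "bdd_meas cycle_space (\<lambda>v. \<Prod>k<4. h (fst (cycle_edge k v)) (snd (cycle_edge k v)))"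
    using bdd_meas_compose[OF h measurable_cycle_edge(3)]
    by (intro bdd_meas_prod) (simp add: case_prod_beta)
  have four: "{..<4::nat} = {0, 1, 2, 3}" by auto
  have e: "(\<Prod>k<4. h (fst (cycle_edge k (z, w, x, y))) (snd (cycle_edge k (z, w, x, y))))
      = (h z x * h w x) * (h z y * h w y)" for z w x y
    unfolding four cycle_edge_def by (simp add: mult_ac)
  show ?thesis
    unfolding integral_cycle[OF b] e by (simp add: power2_eq_square)
qed

lemma char_cycle:
  "(\<integral>v. iexp (\<Sum>k<4. \<xi> k * (sqrt p * kern (fst (cycle_edge k v)) (snd (cycle_edge k v)))) \<partial>cycle_space)
    = (\<integral>z. \<integral>w. (\<integral>x. iexp (sqrt p * (\<xi> 0 * kern z x + \<xi> 2 * kern w x)) \<partial>\<mu>)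
        * (\<integral>y. iexp (sqrt p * (\<xi> 1 * kern z y + \<xi> 3 * kern w y)) \<partial>\<mu>) \<partial>\<mu> \<partial>\<mu>)"
proof -
  have k: "bdd_meas cycle_space (\<lambda>v. kern (fst (cycle_edge k v)) (snd (cycle_edge k v)))" for k
    by (intro bdd_meas_kern_compose measurable_cycle_edge)
  have b: "bdd_meas cycle_space (\<lambda>v. iexp (\<Sum>k<4. \<xi> k * (sqrt p * kern (fst (cycle_edge k v)) (snd (cycle_edge k v)))))"
    by (intro bdd_meas_iexp' bdd_meas_sum bdd_meas_mult bdd_meas_const k)
  have four: "{..<4::nat} = {0, 1, 2, 3}" by auto
  have e: "iexp (\<Sum>k<4. \<xi> k * (sqrt p * kern (fst (cycle_edge k (z, w, x, y))) (snd (cycle_edge k (z, w, x, y)))))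
      = iexp (sqrt p * (\<xi> 0 * kern z x + \<xi> 2 * kern w x)) * iexp (sqrt p * (\<xi> 1 * kern z y + \<xi> 3 * kern w y))"
    for z w x y
    unfolding four cycle_edge_def exp_add[symmetric]
    by (rule arg_cong[of _ _ exp]) (simp add: algebra_simps)
  show ?thesis
    unfolding integral_cycle[OF b] e by simp
qed

end

context sphere_sequence
begin

text \<open>The scaled inner products along the cycle become independent normals, because the limit
  in \<open>char_cycle_approx\<close> is a product over the edges. \<open>C = 1\<close> is the exact
  second moment of a scaled inner product.\<close>

lemma cycle_tendsto:
  fixes f :: "(nat \<Rightarrow> real) \<Rightarrow> real"
  assumes f: "continuous_on UNIV f" "\<And>x. \<bar>f x\<bar> \<le> B"
  shows "(\<lambda>n. \<integral>v. f (trunc_vec 4 (\<lambda>k. sqrt (p n) * Q.kern n (fst (Q.cycle_edge k v)) (snd (Q.cycle_edge k v)))) \<partial>Q.cycle_space n)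
    \<longlonglongrightarrow> (\<integral>\<omega>. f (trunc_vec 4 (\<lambda>k. \<omega> k)) \<partial>PiM {..<4} (\<lambda>_. std_normal_distribution))"
proof (rule multivariate_continuity[where C = 1, OF Q.prob_space_cycle _ _ _ _ _ _ _ _ f])
  interpret S: real_distribution std_normal_distribution by (rule real_dist_normal_dist)
  interpret P: product_prob_space "\<lambda>_::nat. std_normal_distribution" "{..<4}" by unfold_locales
  show "prob_space (PiM {..<4::nat} (\<lambda>_. std_normal_distribution))"
    by (rule prob_space_PiM) unfold_locales
  have k: "bdd_meas (Q.cycle_space n) (\<lambda>v. sqrt (p n) * Q.kern n (fst (Q.cycle_edge k v)) (snd (Q.cycle_edge k v)))" for n k
    by (intro bdd_meas_mult bdd_meas_const Q.bdd_meas_kern_compose Q.measurable_cycle_edge)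
  interpret C: prob_space "Q.cycle_space n" for n by (rule Q.prob_space_cycle)
  fix n k :: nat
  show "(\<lambda>v. sqrt (p n) * Q.kern n (fst (Q.cycle_edge k v)) (snd (Q.cycle_edge k v))) \<in> borel_measurable (Q.cycle_space n)"
    by (rule bdd_meas_measurable[OF k])
  show "integrable (Q.cycle_space n) (\<lambda>v. (sqrt (p n) * Q.kern n (fst (Q.cycle_edge k v)) (snd (Q.cycle_edge k v)))\<^sup>2)"
    by (intro C.integrable_bdd_meas bdd_meas_power k)
  show "(\<integral>v. (sqrt (p n) * Q.kern n (fst (Q.cycle_edge k v)) (snd (Q.cycle_edge k v)))\<^sup>2 \<partial>Q.cycle_space n) \<le> 1"
  proof (rule Q.integral_cycle_edge[where g = "\<lambda>e. (sqrt (p n) * Q.kern n (fst e) (snd e))\<^sup>2"])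
    show "bdd_meas (\<mu> n \<Otimes>\<^sub>M \<mu> n) (\<lambda>e. (sqrt (p n) * Q.kern n (fst e) (snd e))\<^sup>2)"
      by (intro bdd_meas_power bdd_meas_mult bdd_meas_const Q.bdd_meas_kern[unfolded case_prod_beta])
    fix x
    have "(\<integral>y. (sqrt (p n) * Q.kern n x y)\<^sup>2 \<partial>\<mu> n) = p n * (\<integral>y. (Q.kern n x y)\<^sup>2 \<partial>\<mu> n)"
      by (simp add: power_mult_distrib)
    also have "\<dots> = 1"
      unfolding Q.kern_def Q.second_moment using Q.p2[of n] by (simp add: Q.dot_onto)
    finally show "(\<integral>y. (sqrt (p n) * Q.kern n (fst (x, y)) (snd (x, y)))\<^sup>2 \<partial>\<mu> n) \<le> 1" by simp
  qed
  assume k4: "k < 4"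
  then show "(\<lambda>\<omega>. \<omega> k) \<in> borel_measurable (PiM {..<4} (\<lambda>_. std_normal_distribution))"
    using measurable_component_singleton[of k "{..<4}" "\<lambda>_. std_normal_distribution"] by simp
  have distr_k: "distr (PiM {..<4} (\<lambda>_. std_normal_distribution)) std_normal_distribution (\<lambda>\<omega>. \<omega> k) = std_normal_distribution"
    using k4 by (intro distr_PiM_component) (auto intro: S.prob_space_axioms)
  have meas_k: "(\<lambda>\<omega>. \<omega> k) \<in> measurable (PiM {..<4} (\<lambda>_. std_normal_distribution)) std_normal_distribution"
    using k4 by (intro measurable_component_singleton) simp
  have i2: "integrable std_normal_distribution (\<lambda>x. x\<^sup>2)"
    by (rule integrable_std_normal_distribution_moment)
  show "integrable (PiM {..<4} (\<lambda>_. std_normal_distribution)) (\<lambda>\<omega>. (\<omega> k)\<^sup>2)"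
    using integrable_distr[OF meas_k, of "\<lambda>x. x\<^sup>2"] i2 unfolding distr_k by simp
  have "(\<integral>\<omega>. (\<omega> k)\<^sup>2 \<partial>PiM {..<4} (\<lambda>_. std_normal_distribution)) = (\<integral>x. x\<^sup>2 \<partial>std_normal_distribution)"
    using integral_distr[OF meas_k, of "\<lambda>x. x\<^sup>2"] unfolding distr_k by simp
  also have "\<dots> = 1"
    using std_normal_distribution_even_moments(1)[of 1] by simp
  finally show "(\<integral>\<omega>. (\<omega> k)\<^sup>2 \<partial>PiM {..<4} (\<lambda>_. std_normal_distribution)) \<le> 1" by simp
next
  fix \<xi> :: "nat \<Rightarrow> real"
  define \<Phi> where "\<Phi> n = (\<integral>v. iexp (\<Sum>k<4. \<xi> k * (sqrt (p n) * Q.kern n (fst (Q.cycle_edge k v)) (snd (Q.cycle_edge k v)))) \<partial>Q.cycle_space n)" for n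
  define E where "E = complex_of_real (exp (- ((\<xi> 0)\<^sup>2 + (\<xi> 1)\<^sup>2 + (\<xi> 2)\<^sup>2 + (\<xi> 3)\<^sup>2) / 2))"
  define c where "c = (\<bar>\<xi> 0\<bar> + \<bar>\<xi> 2\<bar>) ^ 4 + (\<bar>\<xi> 1\<bar> + \<bar>\<xi> 3\<bar>) ^ 4"
  define d where "d = \<bar>\<xi> 0 * \<xi> 2 + \<xi> 1 * \<xi> 3\<bar>"
  have le: "cmod (\<Phi> n - E) \<le> c / (2 * (real (p n) - 1)) + d / sqrt (p n)" for n
    unfolding \<Phi>_def E_def c_def d_def Q.char_cycle by (rule Q.char_cycle_approx)
  have "(\<lambda>n. c / (2 * (real (p n) - 1)) + d / sqrt (p n)) \<longlonglongrightarrow> 0"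
    using tendsto_add[OF tendsto_inverse_p[of c] tendsto_inverse_sqrt_p[of d]] by (simp only: add_0_left)
  then have "(\<lambda>n. \<Phi> n - E) \<longlonglongrightarrow> 0"
    by (rule Lim_null_comparison[OF always_eventually[OF allI[OF le]]])
  then have "\<Phi> \<longlonglongrightarrow> E" by (rule LIM_zero_cancel)
  moreover have "(\<integral>\<omega>. iexp (\<Sum>k<4. \<xi> k * \<omega> k) \<partial>PiM {..<4} (\<lambda>_. std_normal_distribution)) = E"
    unfolding char_prod_std_normal E_def
    by (simp add: eval_nat_numeral)
  ultimately show "(\<lambda>n. \<integral>v. iexp (\<Sum>k<4. \<xi> k * (sqrt (p n) * Q.kern n (fst (Q.cycle_edge k v)) (snd (Q.cycle_edge k v)))) \<partial>Q.cycle_space n)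
    \<longlonglongrightarrow> (\<integral>\<omega>. iexp (\<Sum>k<4. \<xi> k * \<omega> k) \<partial>PiM {..<4} (\<lambda>_. std_normal_distribution))"
    unfolding \<Phi>_def by simp
qed

lemma continuous_prod_coordinates:
  fixes \<Psi> :: "real \<Rightarrow> real"
  assumes "continuous_on UNIV \<Psi>"
  shows "continuous_on UNIV (\<lambda>x :: nat \<Rightarrow> real. \<Prod>k<d. \<Psi> (x k))"
  by (intro continuous_on_prod continuous_on_compose2[OF assms] continuous_on_product_coordinates) simp

text \<open>Replacing \<open>h\<close> by \<Psi> on all four edges costs 4 A^4 \<eta>. The cycle of
  \<Psi> tends to m^4 with m the normal mean of \<Psi>, and |m| <= \<eta> since \<open>h\<close> is
  centred; 2 \<eta> leaves strict room above m^4 <= \<eta>.\<close>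

lemma cov_norm_eventually_le:
  fixes h :: "nat \<Rightarrow> (nat \<Rightarrow> real) \<Rightarrow> (nat \<Rightarrow> real) \<Rightarrow> real"
  assumes \<Psi>: "continuous_on UNIV \<Psi>" "\<And>w. \<bar>\<Psi> w\<bar> \<le> A" and A: "A \<ge> 1"
    and h: "\<And>n. bdd_meas (\<mu> n \<Otimes>\<^sub>M \<mu> n) (\<lambda>(x, y). h n x y)" "\<And>n x y. \<bar>h n x y\<bar> \<le> A"
      "\<And>n x. x \<in> space (\<mu> n) \<Longrightarrow> (\<integral>y. h n x y \<partial>\<mu> n) = 0"
    and approx: "\<forall>\<^sub>F n in sequentially. \<forall>x. (\<integral>y. \<bar>h n x y - \<Psi> (sqrt (p n) * Q.kern n x y)\<bar> \<partial>\<mu> n) \<le> \<eta>"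
    and \<eta>: "0 < \<eta>" "\<eta> \<le> 1"
  shows "\<forall>\<^sub>F n in sequentially. (\<integral>z. \<integral>w. (\<integral>x. h n z x * h n w x \<partial>\<mu> n)\<^sup>2 \<partial>\<mu> n \<partial>\<mu> n) \<le> (4 * A ^ 4 + 2) * \<eta>"
proof -
  interpret S: real_distribution std_normal_distribution by (rule real_dist_normal_dist)
  interpret P: product_prob_space "\<lambda>_::nat. std_normal_distribution" "{..<4}" by unfold_locales
  interpret C: prob_space "Q.cycle_space n" for n by (rule Q.prob_space_cycle)
  have \<Psi>m: "\<Psi> \<in> borel_measurable borel" by (rule borel_measurable_continuous_onI[OF \<Psi>(1)])
  define m where "m = (\<integral>t. \<Psi> t \<partial>std_normal_distribution)"
  define K where "K n e = \<Psi> (sqrt (p n) * Q.kern n (fst e) (snd e))" for n and e :: "(nat \<Rightarrow> real) \<times> (nat \<Rightarrow> real)"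
  define H where "H n e = h n (fst e) (snd e)" for n and e :: "(nat \<Rightarrow> real) \<times> (nat \<Rightarrow> real)"
  have bH: "bdd_meas (\<mu> n \<Otimes>\<^sub>M \<mu> n) (H n)" for n
    using h(1)[of n] unfolding H_def case_prod_unfold .
  have bK: "bdd_meas (\<mu> n \<Otimes>\<^sub>M \<mu> n) (K n)" for n
  proof (rule bdd_measI[of _ _ A])
    have "(\<lambda>e. sqrt (p n) * Q.kern n (fst e) (snd e)) \<in> borel_measurable (\<mu> n \<Otimes>\<^sub>M \<mu> n)"
      by (intro borel_measurable_times borel_measurable_const
        bdd_meas_measurable[OF Q.bdd_meas_kern[unfolded case_prod_beta]])
    from measurable_compose[OF this \<Psi>m] show "K n \<in> borel_measurable (\<mu> n \<Otimes>\<^sub>M \<mu> n)"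
      unfolding K_def .
  qed (simp add: K_def \<Psi>(2))
  note bHc = bdd_meas_compose[OF bH Q.measurable_cycle_edge(3)]
  note bKc = bdd_meas_compose[OF bK Q.measurable_cycle_edge(3)]

  have m_tendsto: "(\<lambda>n. \<integral>t. \<Psi> t \<partial>scaled_law n) \<longlonglongrightarrow> m"
    unfolding m_def
    using weak_conv_imp_integral_bdd_continuous_conv[OF real_distribution_scaled_law real_dist_normal_dist
      weak_conv_scaled_law, of \<Psi> A] \<Psi> by (simp add: continuous_on_eq_continuous_at)
  have m_le: "\<bar>m\<bar> \<le> \<eta>"
  proof (rule tendsto_upperbound[OF tendsto_rabs[OF m_tendsto]])
    show "\<forall>\<^sub>F n in sequentially. \<bar>\<integral>t. \<Psi> t \<partial>scaled_law n\<bar> \<le> \<eta>"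
      using approx
    proof eventually_elim
      fix n assume n: "\<forall>x. (\<integral>y. \<bar>h n x y - \<Psi> (sqrt (p n) * Q.kern n x y)\<bar> \<partial>\<mu> n) \<le> \<eta>"
      obtain x where x: "x \<in> space (\<mu> n)" using Q.not_empty by blast
      have bh: "bdd_meas (\<mu> n) (h n x)" by (rule bdd_meas_section[OF h(1) x])
      have bk: "bdd_meas (\<mu> n) (\<lambda>y. \<Psi> (sqrt (p n) * Q.kern n x y))"
        using bdd_meas_pair_section[OF bK x] unfolding K_def by simp
      have "(\<integral>t. \<Psi> t \<partial>scaled_law n) = (\<integral>y. \<Psi> (sqrt (p n) * Q.kern n x y) \<partial>\<mu> n)"
        by (rule integral_scaled[OF \<Psi>m, symmetric])
      also have "\<dots> = - (\<integral>y. h n x y - \<Psi> (sqrt (p n) * Q.kern n x y) \<partial>\<mu> n)"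
        using Q.integrable_bdd_meas[OF bh] Q.integrable_bdd_meas[OF bk] h(3)[OF x] by simp
      finally have "\<bar>\<integral>t. \<Psi> t \<partial>scaled_law n\<bar> \<le> (\<integral>y. \<bar>h n x y - \<Psi> (sqrt (p n) * Q.kern n x y)\<bar> \<partial>\<mu> n)"
        using integral_abs_bound[of "\<mu> n" "\<lambda>y. h n x y - \<Psi> (sqrt (p n) * Q.kern n x y)"] by simp
      also have "\<dots> \<le> \<eta>" using n by simp
      finally show "\<bar>\<integral>t. \<Psi> t \<partial>scaled_law n\<bar> \<le> \<eta>" .
    qed
  qed simp
  have lim: "(\<lambda>n. \<integral>v. (\<Prod>k<4. K n (Q.cycle_edge k v)) \<partial>Q.cycle_space n) \<longlonglongrightarrow> m ^ 4"
  proof -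
    have "\<bar>\<Prod>k<4. \<Psi> (x k)\<bar> \<le> A ^ 4" for x :: "nat \<Rightarrow> real"
    proof -
      have "\<bar>\<Prod>k<4. \<Psi> (x k)\<bar> \<le> (\<Prod>k<4::nat. A)"
        unfolding abs_prod using \<Psi>(2) by (intro prod_mono) auto
      then show ?thesis by simp
    qed
    from cycle_tendsto[OF continuous_prod_coordinates[OF \<Psi>(1)] this]
    have "(\<lambda>n. \<integral>v. (\<Prod>k<4. K n (Q.cycle_edge k v)) \<partial>Q.cycle_space n)
      \<longlonglongrightarrow> (\<integral>\<omega>. (\<Prod>k<4. \<Psi> (\<omega> k)) \<partial>PiM {..<4::nat} (\<lambda>_. std_normal_distribution))"
      unfolding K_def trunc_vec_def by simp
    also have "(\<integral>\<omega>. (\<Prod>k<4. \<Psi> (\<omega> k)) \<partial>PiM {..<4::nat} (\<lambda>_. std_normal_distribution)) = (\<Prod>k<4::nat. m)"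
      unfolding m_def
      by (intro P.product_integral_prod S.integrable_bdd_meas bdd_measI[of _ _ A]) (use \<Psi>m \<Psi>(2) in auto)
    finally show ?thesis by simp
  qed
  have "m ^ 4 \<le> \<eta>"
  proof -
    have "m ^ 4 = \<bar>m\<bar> ^ 4" by simp
    also have "\<dots> \<le> \<eta> ^ 4" using m_le by (intro power_mono) auto
    also have "\<dots> \<le> \<eta> ^ 1" using \<eta> by (intro power_decreasing) auto
    finally show ?thesis by simp
  qed
  then have "m ^ 4 < 2 * \<eta>" using \<eta> by simp
  from order_tendstoD(2)[OF lim this] approx
  show ?thesis
  proof eventually_elim
    fix n
    assume 1: "(\<integral>v. (\<Prod>k<4. K n (Q.cycle_edge k v)) \<partial>Q.cycle_space n) < 2 * \<eta>"
      and n: "\<forall>x. (\<integral>y. \<bar>h n x y - \<Psi> (sqrt (p n) * Q.kern n x y)\<bar> \<partial>\<mu> n) \<le> \<eta>"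
    have edge: "(\<integral>v. \<bar>H n (Q.cycle_edge k v) - K n (Q.cycle_edge k v)\<bar> \<partial>Q.cycle_space n) \<le> \<eta>" for k
    proof (rule Q.integral_cycle_edge[where g = "\<lambda>e. \<bar>H n e - K n e\<bar>"])
      show "bdd_meas (\<mu> n \<Otimes>\<^sub>M \<mu> n) (\<lambda>e. \<bar>H n e - K n e\<bar>)" by (intro bdd_meas_abs bdd_meas_diff bH bK)
    qed (use n in \<open>simp add: H_def K_def\<close>)
    have "(\<integral>v. (\<Prod>k<4. H n (Q.cycle_edge k v)) \<partial>Q.cycle_space n) - (\<integral>v. (\<Prod>k<4. K n (Q.cycle_edge k v)) \<partial>Q.cycle_space n)
      = (\<integral>v. (\<Prod>k<4. H n (Q.cycle_edge k v)) - (\<Prod>k<4. K n (Q.cycle_edge k v)) \<partial>Q.cycle_space n)"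
      by (rule Bochner_Integration.integral_diff[symmetric])
        (intro C.integrable_bdd_meas bdd_meas_prod bHc bKc)+
    also have "\<dots> \<le> (\<integral>v. A ^ 4 * (\<Sum>k<4. \<bar>H n (Q.cycle_edge k v) - K n (Q.cycle_edge k v)\<bar>) \<partial>Q.cycle_space n)"
    proof (intro integral_mono C.integrable_bdd_meas bdd_meas_diff bdd_meas_prod bdd_meas_mult bdd_meas_sum bdd_meas_abs
        bdd_meas_const bHc bKc)
      fix v
      show "(\<Prod>k<4. H n (Q.cycle_edge k v)) - (\<Prod>k<4. K n (Q.cycle_edge k v))
        \<le> A ^ 4 * (\<Sum>k<4. \<bar>H n (Q.cycle_edge k v) - K n (Q.cycle_edge k v)\<bar>)"
        by (rule order_trans[OF abs_ge_self abs_prod_diff_le]) (simp_all add: H_def K_def h(2) \<Psi>(2) A)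
    qed
    also have "\<dots> = A ^ 4 * (\<Sum>k<4. \<integral>v. \<bar>H n (Q.cycle_edge k v) - K n (Q.cycle_edge k v)\<bar> \<partial>Q.cycle_space n)"
    proof -
      have "integrable (Q.cycle_space n) (\<lambda>v. \<bar>H n (Q.cycle_edge k v) - K n (Q.cycle_edge k v)\<bar>)" for k
        by (intro C.integrable_bdd_meas bdd_meas_abs bdd_meas_diff bHc bKc)
      then show ?thesis by (simp only: integral_mult_right_zero Bochner_Integration.integral_sum)
    qed
    also have "\<dots> \<le> A ^ 4 * (\<Sum>k<4::nat. \<eta>)"
      using edge A by (intro mult_left_mono sum_mono) auto
    finally have "(\<integral>v. (\<Prod>k<4. H n (Q.cycle_edge k v)) \<partial>Q.cycle_space n) \<le> 4 * A ^ 4 * \<eta> + 2 * \<eta>"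
      using 1 by simp
    then show "(\<integral>z. \<integral>w. (\<integral>x. h n z x * h n w x \<partial>\<mu> n)\<^sup>2 \<partial>\<mu> n \<partial>\<mu> n) \<le> (4 * A ^ 4 + 2) * \<eta>"
      unfolding H_def Q.integral_cycle_product[OF h(1)] by (simp add: algebra_simps)
  qed
qed

lemma cov_norm_tendsto:
  fixes d :: nat
  assumes u: "\<And>k. k < d \<Longrightarrow> u k \<in> {0..1}"
  shows "(\<lambda>n. degenerate_kernel.cov_norm (\<mu> n) (\<lambda>x y. \<Sum>k<d. c k * Q.ind n (u k) x y)) \<longlonglongrightarrow> 0"
proof (rule order_tendstoI)
  interpret D: degenerate_kernel "\<mu> n" "\<lambda>x y. \<Sum>k<d. c k * Q.ind n (u k) x y" "1 + (\<Sum>k<d. \<bar>c k\<bar>)"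
    "\<Sum>k<d. \<Sum>l<d. c k * c l * (min (u k) (u l) - u k * u l)" for n
    by (rule Q.degenerate_combination[OF u])
  fix e :: real
  show "\<forall>\<^sub>F n in sequentially. e < D.cov_norm n" if "e < 0"
    using that by (intro always_eventually allI) (simp add: D.cov_norm_def less_le_trans)
  assume e: "0 < e"
  define A where "A = 1 + (\<Sum>k<d. \<bar>c k\<bar>)"
  have A: "A \<ge> 1" unfolding A_def by (simp add: sum_nonneg)
  define \<eta> where "\<eta> = min 1 (e / (2 * (4 * A ^ 4 + 2)))"
  have A4: "4 * A ^ 4 + 2 > 0" using A by (simp add: add_pos_pos)
  have \<eta>: "0 < \<eta>" "\<eta> \<le> 1" using e A4 unfolding \<eta>_def by auto
  have "(4 * A ^ 4 + 2) * \<eta> \<le> (4 * A ^ 4 + 2) * (e / (2 * (4 * A ^ 4 + 2)))"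
    unfolding \<eta>_def using A4 by (intro mult_left_mono) auto
  also have "\<dots> = e / 2" using A4 by (simp add: field_simps)
  finally have \<eta>e: "(4 * A ^ 4 + 2) * \<eta> < e" using e by simp
  \<comment> \<open>The accuracy \<eta> / A per threshold gives \<eta> for the combination, as the
    moduli of the coefficients sum to A - 1.\<close>
  define good where "good k \<psi> \<longleftrightarrow> continuous_on UNIV \<psi> \<and> (\<forall>w. \<psi> w \<in> {0..1::real}) \<and>
    (\<forall>\<^sub>F n in sequentially. \<forall>x. (\<integral>y. \<bar>of_bool (Q.kern n x y \<le> q n (u k)) - \<psi> (sqrt (p n) * Q.kern n x y)\<bar> \<partial>\<mu> n) \<le> \<eta> / A)"
    for k and \<psi> :: "real \<Rightarrow> real"
  have "\<exists>\<psi>. good k \<psi>" if "k < d" for k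
  proof -
    from approx_ind[OF u[OF that], of "\<eta> / A"] \<eta> A obtain \<psi> where "continuous_on UNIV \<psi>" "\<And>w. \<psi> w \<in> {0..1::real}"
      "\<forall>\<^sub>F n in sequentially. \<forall>x. (\<integral>y. \<bar>of_bool (Q.kern n x y \<le> q n (u k)) - \<psi> (sqrt (p n) * Q.kern n x y)\<bar> \<partial>\<mu> n) \<le> \<eta> / A"
      by auto
    then show ?thesis unfolding good_def by (intro exI[of _ \<psi>] conjI allI)
  qed
  then have "\<forall>k. \<exists>\<psi>. k < d \<longrightarrow> good k \<psi>" by blast
  from choice[OF this] obtain \<psi> where good: "\<And>k. k < d \<Longrightarrow> good k (\<psi> k)" by blast
  have \<psi>: "continuous_on UNIV (\<psi> k)" "\<psi> k w \<in> {0..1::real}"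
    "\<forall>\<^sub>F n in sequentially. \<forall>x. (\<integral>y. \<bar>of_bool (Q.kern n x y \<le> q n (u k)) - \<psi> k (sqrt (p n) * Q.kern n x y)\<bar> \<partial>\<mu> n) \<le> \<eta> / A"
    if "k < d" for k w
    using good[OF that] unfolding good_def by blast+
  define \<Psi> where "\<Psi> w = (\<Sum>k<d. c k * (\<psi> k w - u k))" for w
  have "\<forall>\<^sub>F n in sequentially. \<forall>k\<in>{..<d}. \<forall>x. (\<integral>y. \<bar>of_bool (Q.kern n x y \<le> q n (u k)) - \<psi> k (sqrt (p n) * Q.kern n x y)\<bar> \<partial>\<mu> n) \<le> \<eta> / A"
    using \<psi>(3) by (intro eventually_ball_finite) auto
  then have approx: "\<forall>\<^sub>F n in sequentially. \<forall>x. (\<integral>y. \<bar>(\<Sum>k<d. c k * Q.ind n (u k) x y) - \<Psi> (sqrt (p n) * Q.kern n x y)\<bar> \<partial>\<mu> n) \<le> \<eta>"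
  proof eventually_elim
    fix n
    assume n: "\<forall>k\<in>{..<d}. \<forall>x. (\<integral>y. \<bar>of_bool (Q.kern n x y \<le> q n (u k)) - \<psi> k (sqrt (p n) * Q.kern n x y)\<bar> \<partial>\<mu> n) \<le> \<eta> / A"
    show "\<forall>x. (\<integral>y. \<bar>(\<Sum>k<d. c k * Q.ind n (u k) x y) - \<Psi> (sqrt (p n) * Q.kern n x y)\<bar> \<partial>\<mu> n) \<le> \<eta>"
    proof
      fix x
      let ?D = "\<lambda>k y. of_bool (Q.kern n x y \<le> q n (u k)) - \<psi> k (sqrt (p n) * Q.kern n x y)"
      have bD: "bdd_meas (\<mu> n) (?D k)" if k: "k < d" for k
      proof (intro bdd_meas_diff bdd_meas_of_bool_le Q.kern_section)
        show "bdd_meas (\<mu> n) (\<lambda>y. \<psi> k (sqrt (p n) * Q.kern n x y))"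
        proof (rule bdd_measI[of _ _ 1])
          have "(\<lambda>y. sqrt (p n) * Q.kern n x y) \<in> borel_measurable (\<mu> n)"
            by (intro borel_measurable_times borel_measurable_const Q.kern_section)
          from measurable_compose[OF this borel_measurable_continuous_onI[OF \<psi>(1)[OF k]]]
          show "(\<lambda>y. \<psi> k (sqrt (p n) * Q.kern n x y)) \<in> borel_measurable (\<mu> n)" .
        qed (use \<psi>(2)[OF k] in auto)
      qed
      have "(\<Sum>k<d. c k * Q.ind n (u k) x y) - \<Psi> (sqrt (p n) * Q.kern n x y) = (\<Sum>k<d. c k * ?D k y)" for y
        unfolding \<Psi>_def Q.ind_def sum_subtractf[symmetric] by (simp add: algebra_simps)
      then have "(\<integral>y. \<bar>(\<Sum>k<d. c k * Q.ind n (u k) x y) - \<Psi> (sqrt (p n) * Q.kern n x y)\<bar> \<partial>\<mu> n)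
        = (\<integral>y. \<bar>\<Sum>k<d. c k * ?D k y\<bar> \<partial>\<mu> n)" by (simp only:)
      also have "\<dots> \<le> (\<integral>y. (\<Sum>k<d. \<bar>c k\<bar> * \<bar>?D k y\<bar>) \<partial>\<mu> n)"
        by (intro integral_mono Q.integrable_bdd_meas bdd_meas_abs bdd_meas_sum bdd_meas_mult bdd_meas_const bD)
          (auto intro!: order_trans[OF sum_abs] simp: abs_mult)
      also have "\<dots> = (\<Sum>k<d. \<bar>c k\<bar> * (\<integral>y. \<bar>?D k y\<bar> \<partial>\<mu> n))"
      proof -
        have "integrable (\<mu> n) (\<lambda>y. \<bar>c k\<bar> * \<bar>?D k y\<bar>)" if "k \<in> {..<d}" for k
          using that by (intro Q.integrable_bdd_meas bdd_meas_abs bdd_meas_mult bdd_meas_const bD) auto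
        from Bochner_Integration.integral_sum[OF this] show ?thesis
          by (simp only: integral_mult_right_zero)
      qed
      also have "\<dots> \<le> (\<Sum>k<d. \<bar>c k\<bar> * (\<eta> / A))"
        using n by (intro sum_mono mult_left_mono) auto
      also have "\<dots> \<le> A * (\<eta> / A)"
        unfolding sum_distrib_right[symmetric] using \<eta> A by (intro mult_right_mono) (auto simp: A_def)
      also have "\<dots> = \<eta>" using A by simp
      finally show "(\<integral>y. \<bar>(\<Sum>k<d. c k * Q.ind n (u k) x y) - \<Psi> (sqrt (p n) * Q.kern n x y)\<bar> \<partial>\<mu> n) \<le> \<eta>" .
    qed
  qed
  have "continuous_on UNIV \<Psi>"
    unfolding \<Psi>_def by (intro continuous_on_sum continuous_on_mult continuous_on_diff continuous_on_const \<psi>(1)) simp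
  moreover have "\<bar>\<Psi> w\<bar> \<le> A" for w
  proof -
    have "\<bar>c k * (\<psi> k w - u k)\<bar> \<le> \<bar>c k\<bar>" if "k < d" for k
      using \<psi>(2)[OF that, of w] u[OF that] unfolding abs_mult by (intro mult_left_le) (auto simp: abs_le_iff)
    then have "\<bar>\<Psi> w\<bar> \<le> (\<Sum>k<d. \<bar>c k\<bar>)"
      unfolding \<Psi>_def by (intro order_trans[OF sum_abs] sum_mono) auto
    then show ?thesis unfolding A_def by simp
  qed
  ultimately have "\<forall>\<^sub>F n in sequentially. D.cov_norm n \<le> (4 * A ^ 4 + 2) * \<eta>"
    unfolding D.cov_norm_def D.cov_kernel_def
    using D.h_bdd D.h_bound D.h_mean A approx \<eta>
    by (intro cov_norm_eventually_le[of \<Psi>]) (auto simp: A_def)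
  then show "\<forall>\<^sub>F n in sequentially. D.cov_norm n < e"
    by eventually_elim (use \<eta>e in simp)
qed

end

section \<open>The empirical process: finite-dimensional limits and increments\<close>

locale sample_sequence = sphere_sequence +
  fixes N :: "nat \<Rightarrow> nat"
  assumes N2: "2 \<le> N n" and N_lim: "filterlim N at_top sequentially"
begin

definition sample :: "nat \<Rightarrow> (nat \<Rightarrow> nat \<Rightarrow> real) measure" where
  "sample n = PiM {1..N n} (\<lambda>_. \<mu> n)"

text \<open>The factor is half of the sqrt (2 / (n (n - 1))) of the overview because
  \<open>ustat\<close> counts every pair twice.\<close>

definition emp :: "nat \<Rightarrow> real \<Rightarrow> (nat \<Rightarrow> nat \<Rightarrow> real) \<Rightarrow> real" where
  "emp n u x = sqrt (1 / (2 * real (N n) * (real (N n) - 1))) * ustat (Q.ind n u) {1..N n} x"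

lemma prob_space_sample: "prob_space (sample n)"
  unfolding sample_def by (rule prob_space_PiM) (rule Q.prob_space_axioms)

lemma bdd_meas_emp: "bdd_meas (sample n) (emp n u)"
  unfolding emp_def[abs_def] sample_def
  by (intro bdd_meas_mult bdd_meas_const bdd_meas_ustat[OF Q.bdd_meas_ind] order_refl)

text \<open>A combination of values of \<open>emp\<close> is the normalised U-statistic of the
  combined kernel. Of the two errors in \<open>char_ustat\<close>, one vanishes through the growth
  of the dimension alone, the other through the growth of the sample alone.\<close>

lemma char_emp_tendsto:
  fixes d :: nat
  assumes u: "\<And>k. k < d \<Longrightarrow> u k \<in> {0..1}"
  shows "(\<lambda>n. \<integral>x. iexp (\<Sum>k<d. c k * emp n (u k) x) \<partial>sample n)
    \<longlonglongrightarrow> exp (- (\<Sum>k<d. \<Sum>l<d. c k * c l * (min (u k) (u l) - u k * u l)) / 2)"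
proof -
  define s where "s = (\<Sum>k<d. \<Sum>l<d. c k * c l * (min (u k) (u l) - u k * u l))"
  define A where "A = 1 + (\<Sum>k<d. \<bar>c k\<bar>)"
  interpret D: degenerate_kernel "\<mu> n" "\<lambda>x y. \<Sum>k<d. c k * Q.ind n (u k) x y" A s for n
    unfolding A_def s_def by (rule Q.degenerate_combination[OF u])
  define \<Phi> where "\<Phi> n = (\<integral>x. iexp (\<Sum>k<d. c k * emp n (u k) x) \<partial>sample n)" for n
  have sum: "(\<Sum>k<d. c k * emp n (u k) x) = sqrt (1 / (2 * real (N n) * (real (N n) - 1))) *
      ustat (\<lambda>x y. \<Sum>k<d. c k * Q.ind n (u k) x y) {1..N n} x" for n x
  proof -
    have "ustat (\<lambda>x y. \<Sum>k<d. c k * Q.ind n (u k) x y) {1..N n} x = (\<Sum>k<d. c k * ustat (Q.ind n (u k)) {1..N n} x)"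
    proof -
      have "ustat (\<lambda>x y. \<Sum>k<d. c k * Q.ind n (u k) x y) {1..N n} x
        = (\<Sum>i\<in>{1..N n}. \<Sum>k<d. \<Sum>j\<in>{1..N n} - {i}. c k * Q.ind n (u k) (x i) (x j))"
        unfolding ustat_def by (intro sum.cong refl sum.swap)
      also have "\<dots> = (\<Sum>k<d. \<Sum>i\<in>{1..N n}. \<Sum>j\<in>{1..N n} - {i}. c k * Q.ind n (u k) (x i) (x j))"
        by (rule sum.swap)
      finally show ?thesis by (simp only: ustat_def sum_distrib_left)
    qed
    then show ?thesis unfolding emp_def by (simp add: sum_distrib_left mult_ac)
  qed
  have le: "cmod (\<Phi> n - exp (- s / 2)) \<le> sqrt (2 * D.cov_norm n) + 9 * A ^ 3 / sqrt (N n)" for n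
    using D.char_ustat[of "{1..N n}" n] N2[of n] unfolding \<Phi>_def sum sample_def by simp
  have "(\<lambda>n. sqrt (2 * D.cov_norm n) + 9 * A ^ 3 / sqrt (N n)) \<longlonglongrightarrow> sqrt (2 * 0) + 0"
    by (intro tendsto_intros cov_norm_tendsto u tendsto_divide_0[OF tendsto_const] filterlim_at_top_imp_at_infinity
      filterlim_compose[OF sqrt_at_top] filterlim_compose[OF filterlim_real_sequentially N_lim])
  then have "(\<lambda>n. sqrt (2 * D.cov_norm n) + 9 * A ^ 3 / sqrt (N n)) \<longlonglongrightarrow> 0"
    by (simp only: mult_zero_right real_sqrt_zero add_0_left)
  then have "(\<lambda>n. \<Phi> n - exp (- s / 2)) \<longlonglongrightarrow> 0"
    by (rule Lim_null_comparison[OF always_eventually[OF allI[OF le]]])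
  then show ?thesis
    unfolding \<Phi>_def s_def by (rule LIM_zero_cancel)
qed

lemma emp_increment:
  assumes uv: "u \<in> {0..1}" "v \<in> {0..1}" "u \<le> v"
  shows "(\<integral>x. (emp n v x - emp n u x) ^ 4 \<partial>sample n) \<le> 4096 * ((v - u) / N n + (v - u)\<^sup>2)"
proof -
  define s where "s = (v - u) - (v - u)\<^sup>2"
  interpret D: degenerate_kernel "\<mu> n" "\<lambda>x y. Q.ind n v x y - Q.ind n u x y" 1 s
    unfolding s_def by (rule Q.degenerate_increment[OF uv])
  have "emp n v x - emp n u x = sqrt (1 / (2 * real (N n) * (real (N n) - 1))) *
      ustat (\<lambda>x y. Q.ind n v x y - Q.ind n u x y) {1..N n} x" for x
    unfolding emp_def ustat_def by (simp add: sum_subtractf right_diff_distrib)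
  then have "(\<integral>x. (emp n v x - emp n u x) ^ 4 \<partial>sample n) \<le> 4096 * (s / N n + s\<^sup>2)"
    using D.ustat_fourth_moment[of "{1..N n}"] N2[of n] unfolding sample_def by simp
  also have "\<dots> \<le> 4096 * ((v - u) / N n + (v - u)\<^sup>2)"
    using D.s_nonneg unfolding s_def
    by (intro mult_left_mono add_mono divide_right_mono power_mono) auto
  finally show ?thesis .
qed

end

section \<open>Brownian bridge\<close>

lemma (in prob_space) std_normal_transfer:
  assumes Z: "Z \<in> borel_measurable M" "distr M borel Z = std_normal_distribution"
  shows "integrable M Z" "integrable M (\<lambda>\<omega>. (Z \<omega>)\<^sup>2)" "expectation Z = 0" "expectation (\<lambda>\<omega>. (Z \<omega>)\<^sup>2) = 1"
    "(\<integral>\<omega>. iexp (t * Z \<omega>) \<partial>M) = exp (- (t\<^sup>2) / 2)"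
proof -
  have i: "integrable std_normal_distribution (\<lambda>x. x ^ k)" for k
    by (rule integrable_std_normal_distribution_moment)
  show "integrable M Z" using integrable_distr[OF Z(1), of "\<lambda>x. x"] i[of 1] unfolding Z(2) by simp
  show "integrable M (\<lambda>\<omega>. (Z \<omega>)\<^sup>2)" using integrable_distr[OF Z(1), of "\<lambda>x. x\<^sup>2"] i[of 2] unfolding Z(2) by simp
  show "expectation Z = 0"
    using integral_distr[OF Z(1), of "\<lambda>x. x"] integral_std_normal_distribution_moment_odd[of 1] unfolding Z(2) by simp
  show "expectation (\<lambda>\<omega>. (Z \<omega>)\<^sup>2) = 1"
    using integral_distr[OF Z(1), of "\<lambda>x. x\<^sup>2"] std_normal_distribution_even_moments(1)[of 1] unfolding Z(2) by simp
  show "(\<integral>\<omega>. iexp (t * Z \<omega>) \<partial>M) = exp (- (t\<^sup>2) / 2)"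
    using integral_distr[OF Z(1), of "\<lambda>x. iexp (t * x)"] fun_cong[OF char_std_normal_distribution, of t]
    unfolding Z(2) char_def by simp
qed

text \<open>Only a positive standard deviation allows standardisation, so point masses are treated
  as almost surely constant variables.\<close>

lemma (in prob_space) gaussian_rv_moments:
  assumes Y: "gaussian_rv M Y"
  shows "integrable M Y" "integrable M (\<lambda>\<omega>. (Y \<omega>)\<^sup>2)"
    "expectation Y = 0 \<Longrightarrow> (\<integral>\<omega>. iexp (Y \<omega>) \<partial>M) = exp (- expectation (\<lambda>\<omega>. (Y \<omega>)\<^sup>2) / 2)"
proof -
  from Y obtain m \<sigma> where m: "Y \<in> borel_measurable M" "0 \<le> \<sigma>" "distr M borel Y = gaussian_law m \<sigma>"
    unfolding gaussian_rv_def by auto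
  have "integrable M Y \<and> integrable M (\<lambda>\<omega>. (Y \<omega>)\<^sup>2) \<and>
    (expectation Y = 0 \<longrightarrow> (\<integral>\<omega>. iexp (Y \<omega>) \<partial>M) = exp (- expectation (\<lambda>\<omega>. (Y \<omega>)\<^sup>2) / 2))"
  proof (cases "\<sigma> = 0")
    case True
    then have d: "distr M borel Y = return borel m" using m(3) unfolding gaussian_law_def by simp
    have "AE x in distr M borel Y. x = m"
      unfolding d by (subst AE_return) auto
    then have ae: "AE \<omega> in M. Y \<omega> = m"
      by (subst (asm) AE_distr_iff[OF m(1)]) auto
    have 1: "integrable M Y"
      using integrable_cong_AE[of Y M "\<lambda>_. m"] m(1) ae by simp
    have 2: "integrable M (\<lambda>\<omega>. (Y \<omega>)\<^sup>2)"
    proof -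
      have "AE \<omega> in M. (Y \<omega>)\<^sup>2 = m\<^sup>2" using ae by eventually_elim simp
      then show ?thesis using integrable_cong_AE[of "\<lambda>\<omega>. (Y \<omega>)\<^sup>2" M "\<lambda>_. m\<^sup>2"] m(1) by simp
    qed
    have "expectation Y = m"
      using integral_cong_AE[of Y M "\<lambda>_. m"] m(1) ae by (simp add: prob_space)
    moreover have "expectation (\<lambda>\<omega>. (Y \<omega>)\<^sup>2) = m\<^sup>2"
    proof -
      have "AE \<omega> in M. (Y \<omega>)\<^sup>2 = m\<^sup>2" using ae by eventually_elim simp
      then show ?thesis
        using integral_cong_AE[of "\<lambda>\<omega>. (Y \<omega>)\<^sup>2" M "\<lambda>_. m\<^sup>2"] m(1) by (simp add: prob_space)
    qed
    moreover have "(\<integral>\<omega>. iexp (Y \<omega>) \<partial>M) = iexp m"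
    proof -
      have "AE \<omega> in M. iexp (Y \<omega>) = iexp m" using ae by eventually_elim simp
      then show ?thesis
        using integral_cong_AE[of "\<lambda>\<omega>. iexp (Y \<omega>)" M "\<lambda>_. iexp m"] m(1) by (simp add: prob_space)
    qed
    ultimately show ?thesis using 1 2 by simp
  next
    case False
    then have \<sigma>: "0 < \<sigma>" using m(2) by simp
    define Z where "Z \<omega> = (Y \<omega> - m) / \<sigma>" for \<omega>
    have "distributed M lborel Y (\<lambda>x. ennreal (normal_density m \<sigma> x))"
    proof -
      have "distr M lborel Y = distr M borel Y" by (rule distr_cong) auto
      then show ?thesis using m False unfolding distributed_def gaussian_law_def by simp
    qed
    then have "distributed M lborel Z (\<lambda>x. ennreal (std_normal_density x))"
      unfolding Z_def using normal_standard_normal_convert[OF \<sigma>, of Y m] by simp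
    then have Z: "Z \<in> borel_measurable M" "distr M borel Z = std_normal_distribution"
    proof -
      assume Z: "distributed M lborel Z (\<lambda>x. ennreal (std_normal_density x))"
      have "distr M lborel Z = distr M borel Z" by (rule distr_cong) auto
      then show "Z \<in> borel_measurable M" "distr M borel Z = std_normal_distribution"
        using Z unfolding distributed_def by simp_all
    qed
    note t = std_normal_transfer[OF Z]
    have YZ: "Y \<omega> = m + \<sigma> * Z \<omega>" for \<omega> unfolding Z_def using \<sigma> by simp
    have sq: "(Y \<omega>)\<^sup>2 = m\<^sup>2 + 2 * m * \<sigma> * Z \<omega> + \<sigma>\<^sup>2 * (Z \<omega>)\<^sup>2" for \<omega>
      unfolding YZ by (simp add: power2_eq_square algebra_simps)
    have 1: "integrable M Y" unfolding YZ using t(1) by simp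
    have 2: "integrable M (\<lambda>\<omega>. (Y \<omega>)\<^sup>2)" unfolding sq using t(1,2) by simp
    have "expectation Y = m" unfolding YZ using t by (simp add: prob_space)
    moreover have "expectation (\<lambda>\<omega>. (Y \<omega>)\<^sup>2) = m\<^sup>2 + \<sigma>\<^sup>2" unfolding sq using t by (simp add: prob_space)
    moreover have "(\<integral>\<omega>. iexp (Y \<omega>) \<partial>M) = exp (- (\<sigma>\<^sup>2) / 2)" if "m = 0"
      using t(5)[of \<sigma>] unfolding YZ that by simp
    ultimately show ?thesis using 1 2 by simp
  qed
  then show "integrable M Y" "integrable M (\<lambda>\<omega>. (Y \<omega>)\<^sup>2)"
    "expectation Y = 0 \<Longrightarrow> (\<integral>\<omega>. iexp (Y \<omega>) \<partial>M) = exp (- expectation (\<lambda>\<omega>. (Y \<omega>)\<^sup>2) / 2)" by auto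
qed

text \<open>The definition of the process attaches coefficients to times; injectivity of
  \<open>u\<close> turns coefficients attached to indices into such.\<close>

lemma brownian_bridge_gaussian:
  assumes B: "brownian_bridge M B" and u: "\<And>k. k < d \<Longrightarrow> u k \<in> {0..1}" "inj_on u {..<d::nat}"
  shows "gaussian_rv M (\<lambda>\<omega>. \<Sum>k<d. c k * B (u k) \<omega>)"
proof -
  have g: "\<And>I c. finite I \<Longrightarrow> I \<subseteq> {0..1} \<Longrightarrow> gaussian_rv M (\<lambda>\<omega>. \<Sum>t\<in>I. c t * B t \<omega>)"
    using B unfolding brownian_bridge_def gaussian_process_on_def by blast
  have "gaussian_rv M (\<lambda>\<omega>. \<Sum>t\<in>u ` {..<d}. c (inv_into {..<d} u t) * B t \<omega>)"
    using u(1) by (intro g) auto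
  also have "(\<lambda>\<omega>. \<Sum>t\<in>u ` {..<d}. c (inv_into {..<d} u t) * B t \<omega>) = (\<lambda>\<omega>. \<Sum>k<d. c k * B (u k) \<omega>)"
    using u(2) by (simp add: sum.reindex)
  finally show ?thesis .
qed

lemma brownian_bridge_rv:
  assumes B: "brownian_bridge M B" and t: "t \<in> {0..1}"
  shows "B t \<in> borel_measurable M" "integrable M (B t)" "integrable M (\<lambda>\<omega>. (B t \<omega>)\<^sup>2)"
proof -
  interpret prob_space M using B unfolding brownian_bridge_def by simp
  have "gaussian_rv M (\<lambda>\<omega>. \<Sum>k<(1::nat). 1 * B t \<omega>)"
    by (rule brownian_bridge_gaussian[OF B, of 1 "\<lambda>_. t" "\<lambda>_. 1"]) (use t in \<open>auto simp: inj_on_def\<close>)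
  then have g: "gaussian_rv M (B t)" by simp
  then show "B t \<in> borel_measurable M" unfolding gaussian_rv_def by simp
  show "integrable M (B t)" "integrable M (\<lambda>\<omega>. (B t \<omega>)\<^sup>2)"
    using gaussian_rv_moments[OF g] by auto
qed

lemma brownian_bridge_char:
  assumes B: "brownian_bridge M B" and u: "\<And>k. k < d \<Longrightarrow> u k \<in> {0..1}" "inj_on u {..<d::nat}"
  shows "(\<integral>\<omega>. iexp (\<Sum>k<d. c k * B (u k) \<omega>) \<partial>M)
    = exp (- (\<Sum>k<d. \<Sum>l<d. c k * c l * (min (u k) (u l) - u k * u l)) / 2)"
proof -
  interpret prob_space M using B unfolding brownian_bridge_def by simp
  define Y where "Y \<omega> = (\<Sum>k<d. c k * B (u k) \<omega>)" for \<omega>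
  have Y: "gaussian_rv M Y" unfolding Y_def[abs_def] by (rule brownian_bridge_gaussian[OF B u])
  have mean: "(\<integral>\<omega>. B t \<omega> \<partial>M) = 0" if "t \<in> {0..1}" for t
    using B that unfolding brownian_bridge_def by blast
  have cov: "(\<integral>\<omega>. B s \<omega> * B t \<omega> \<partial>M) = min s t - s * t" if "s \<in> {0..1}" "t \<in> {0..1}" for s t
    using B that unfolding brownian_bridge_def by blast
  note rv = brownian_bridge_rv[OF B u(1)]
  have iB: "integrable M (\<lambda>\<omega>. B (u k) \<omega> * B (u l) \<omega>)" if "k < d" "l < d" for k l
  proof (rule Bochner_Integration.integrable_bound)
    show "integrable M (\<lambda>\<omega>. (B (u k) \<omega>)\<^sup>2 + (B (u l) \<omega>)\<^sup>2)" using rv(3) that by simp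
    show "(\<lambda>\<omega>. B (u k) \<omega> * B (u l) \<omega>) \<in> borel_measurable M"
      using rv(1) that by (intro borel_measurable_times)
    have "\<bar>x * y\<bar> \<le> x\<^sup>2 + y\<^sup>2" for x y :: real
    proof -
      have "0 \<le> (\<bar>x\<bar> - \<bar>y\<bar>)\<^sup>2" by simp
      then have "2 * (\<bar>x\<bar> * \<bar>y\<bar>) \<le> x\<^sup>2 + y\<^sup>2" by (simp add: power2_diff)
      moreover have "0 \<le> \<bar>x\<bar> * \<bar>y\<bar>" by simp
      ultimately show ?thesis unfolding abs_mult by linarith
    qed
    then show "AE \<omega> in M. norm (B (u k) \<omega> * B (u l) \<omega>) \<le> norm ((B (u k) \<omega>)\<^sup>2 + (B (u l) \<omega>)\<^sup>2)" by simp
  qed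
  have "expectation Y = 0"
    unfolding Y_def using rv(2) u(1) mean by (simp add: Bochner_Integration.integral_sum)
  moreover have "expectation (\<lambda>\<omega>. (Y \<omega>)\<^sup>2) = (\<Sum>k<d. \<Sum>l<d. c k * c l * (min (u k) (u l) - u k * u l))"
  proof -
    have "(Y \<omega>)\<^sup>2 = (\<Sum>k<d. \<Sum>l<d. c k * c l * (B (u k) \<omega> * B (u l) \<omega>))" for \<omega>
      unfolding Y_def power2_eq_square sum_product by (simp add: mult_ac)
    then have "expectation (\<lambda>\<omega>. (Y \<omega>)\<^sup>2) = expectation (\<lambda>\<omega>. \<Sum>k<d. \<Sum>l<d. c k * c l * (B (u k) \<omega> * B (u l) \<omega>))"
      by (simp only:)
    also have "\<dots> = (\<Sum>k<d. expectation (\<lambda>\<omega>. \<Sum>l<d. c k * c l * (B (u k) \<omega> * B (u l) \<omega>)))"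
      using iB by (intro Bochner_Integration.integral_sum Bochner_Integration.integrable_sum integrable_mult_right) auto
    also have "\<dots> = (\<Sum>k<d. \<Sum>l<d. expectation (\<lambda>\<omega>. c k * c l * (B (u k) \<omega> * B (u l) \<omega>)))"
      using iB by (intro sum.cong refl Bochner_Integration.integral_sum integrable_mult_right) auto
    finally have "expectation (\<lambda>\<omega>. (Y \<omega>)\<^sup>2) = (\<Sum>k<d. \<Sum>l<d. c k * c l * expectation (\<lambda>\<omega>. B (u k) \<omega> * B (u l) \<omega>))"
      by (simp only: integral_mult_right_zero)
    then show ?thesis using cov u(1) by simp
  qed
  ultimately show ?thesis
    using gaussian_rv_moments(3)[OF Y] unfolding Y_def by simp
qed

section \<open>Maxima over finite grids and suprema of monotone differences\<close>

primrec gmax :: "nat \<Rightarrow> (nat \<Rightarrow> real) \<Rightarrow> real" where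
  "gmax 0 x = \<bar>x 0\<bar>"
| "gmax (Suc d) x = max (gmax d x) \<bar>x (Suc d)\<bar>"

lemma gmax_ge: "k \<le> d \<Longrightarrow> \<bar>x k\<bar> \<le> gmax d x"
  by (induction d) (auto simp: le_Suc_eq max_def)

lemma gmax_le: "(\<And>k. k \<le> d \<Longrightarrow> \<bar>x k\<bar> \<le> b) \<Longrightarrow> gmax d x \<le> b"
  by (induction d) auto

lemma gmax_cong: "(\<And>k. k \<le> d \<Longrightarrow> x k = y k) \<Longrightarrow> gmax d x = gmax d y"
  by (induction d) auto

lemma gmax_scale: "c \<ge> 0 \<Longrightarrow> gmax d (\<lambda>k. c * x k) = c * gmax d x"
  by (induction d) (auto simp: abs_mult max_mult_distrib_left)

text \<open>Thanks to the recursive form of \<open>gmax\<close>, continuity in the product topology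
  is an induction, as is measurability.\<close>

lemma continuous_gmax: "continuous_on UNIV (gmax d)"
proof -
  have "continuous_on UNIV (\<lambda>x. gmax d x)"
    by (induction d) (auto intro!: continuous_intros continuous_on_product_coordinates)
  then show ?thesis by simp
qed

lemma measurable_gmax:
  "(\<And>k. k \<le> d \<Longrightarrow> W k \<in> borel_measurable M) \<Longrightarrow> (\<lambda>\<omega>. gmax d (\<lambda>k. W k \<omega>)) \<in> borel_measurable M"
  by (induction d) (auto intro!: borel_measurable_max)

lemma bdd_meas_gmax:
  "(\<And>k. k \<le> d \<Longrightarrow> bdd_meas M (W k)) \<Longrightarrow> bdd_meas M (\<lambda>\<omega>. gmax d (\<lambda>k. W k \<omega>))"
proof -
  assume W: "\<And>k. k \<le> d \<Longrightarrow> bdd_meas M (W k)"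
  then have "\<forall>k. \<exists>B. k \<le> d \<longrightarrow> (\<forall>\<omega>\<in>space M. \<bar>W k \<omega>\<bar> \<le> B)"
    unfolding bdd_meas_def by auto
  from choice[OF this] obtain B where B: "\<And>k \<omega>. k \<le> d \<Longrightarrow> \<omega> \<in> space M \<Longrightarrow> \<bar>W k \<omega>\<bar> \<le> B k" by blast
  show ?thesis
  proof (rule bdd_measI[of _ _ "Max (B ` {..d})"])
    fix \<omega> assume \<omega>: "\<omega> \<in> space M"
    have "gmax d (\<lambda>k. W k \<omega>) \<le> Max (B ` {..d})"
      using B[OF _ \<omega>] by (intro gmax_le) (auto simp: Max_ge_iff)
    moreover have "0 \<le> gmax d (\<lambda>k. W k \<omega>)"
      using gmax_ge[of 0 d "\<lambda>k. W k \<omega>"] by simp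
    ultimately show "norm (gmax d (\<lambda>k. W k \<omega>)) \<le> Max (B ` {..d})" by simp
  qed (intro measurable_gmax bdd_meas_measurable W)
qed

text \<open>A discrete intermediate value argument: descend from the top index until the sequence no
  longer exceeds \<open>t\<close>.\<close>

lemma ex_straddling_index:
  fixes a :: "nat \<Rightarrow> real"
  assumes "a 0 \<le> t" "t \<le> a K" "1 \<le> K"
  shows "\<exists>k<K. a k \<le> t \<and> t \<le> a (Suc k)"
  using assms
proof (induction K)
  case (Suc K)
  show ?case
  proof (cases "K = 0 \<or> a K \<le> t")
    case True
    then show ?thesis using Suc by (intro exI[of _ K]) auto
  next
    case False
    then obtain k where "k < K" "a k \<le> t \<and> t \<le> a (Suc k)" using Suc by force
    then show ?thesis by (intro exI[of _ k]) simp
  qed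
qed simp

text \<open>Between neighbouring quantiles both functions are squeezed by their values at the ends,
  and \<open>m\<close> grows by exactly 1 / K there; so the deviation inside a cell exceeds that at
  its ends by at most 1 / K.\<close>

lemma sup_sandwich:
  fixes G m q :: "real \<Rightarrow> real"
  assumes G: "mono G" and m: "mono m"
    and q: "q 0 = - 1" "q 1 = 1" "\<And>u. u \<in> {0..1} \<Longrightarrow> q u \<in> {-1..1} \<and> m (q u) = u"
    and K: "1 \<le> K"
  shows "gmax K (\<lambda>k. G (q (k / K)) - k / K) \<le> (SUP t\<in>{-1..1}. \<bar>G t - m t\<bar>)" (is "?M \<le> ?S")
    and "(SUP t\<in>{-1..1}. \<bar>G t - m t\<bar>) \<le> gmax K (\<lambda>k. G (q (k / K)) - k / K) + 1 / K"
proof -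
  have K': "real K > 0" using K by simp
  have u: "real k / real K \<in> {0..1}" if "k \<le> K" for k using that K' by simp
  have le: "\<bar>G t - m t\<bar> \<le> ?M + 1 / K" if t: "t \<in> {-1..1}" for t
  proof -
    obtain k where k: "k < K" "q (k / K) \<le> t" "t \<le> q (Suc k / K)"
      using ex_straddling_index[of "\<lambda>k. q (k / K)" t K] t q(1,2) K by auto
    have "G (q (k / K)) \<le> G t" "G t \<le> G (q (Suc k / K))" "m (q (k / K)) \<le> m t" "m t \<le> m (q (Suc k / K))"
      using k G m by (auto simp: mono_def)
    moreover have "m (q (k / K)) = k / K" "m (q (Suc k / K)) = k / K + 1 / K"
      using q(3)[OF u[of k]] q(3)[OF u[of "Suc k"]] k(1) by (auto simp: add_divide_distrib)
    moreover have "\<bar>G (q (k / K)) - k / K\<bar> \<le> ?M" "\<bar>G (q (Suc k / K)) - Suc k / K\<bar> \<le> ?M"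
      using gmax_ge[of k K "\<lambda>k. G (q (k / K)) - k / K"] gmax_ge[of "Suc k" K "\<lambda>k. G (q (k / K)) - k / K"] k(1) by auto
    moreover have "real (Suc k) / K = k / K + 1 / K" by (simp add: add_divide_distrib)
    ultimately show ?thesis by linarith
  qed
  show "?S \<le> ?M + 1 / K" by (rule cSUP_least) (use le in auto)
  have bdd: "bdd_above ((\<lambda>t. \<bar>G t - m t\<bar>) ` {-1..1})" using le by (auto intro!: bdd_aboveI[of _ "?M + 1 / K"])
  show "?M \<le> ?S"
  proof (rule gmax_le)
    fix k assume "k \<le> K"
    then have "q (k / K) \<in> {-1..1} \<and> m (q (k / K)) = k / K" by (intro q(3) u)
    then show "\<bar>G (q (k / K)) - k / K\<bar> \<le> ?S"
      using cSUP_upper[OF _ bdd, of "q (k / K)"] by simp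
  qed
qed

definition pairs :: "nat \<Rightarrow> (nat \<times> nat) set" where
  "pairs n = {(i, j). 1 \<le> i \<and> i < j \<and> j \<le> n}"

lemma finite_pairs: "finite (pairs n)"
  by (rule finite_subset[of _ "{1..n} \<times> {1..n}"]) (auto simp: pairs_def)

lemma sum_offdiag_pairs:
  fixes h :: "nat \<Rightarrow> nat \<Rightarrow> real"
  assumes sym: "\<And>i j. h i j = h j i"
  shows "(\<Sum>i\<in>{1..n}. \<Sum>j\<in>{1..n} - {i}. h i j) = 2 * (\<Sum>(i, j)\<in>pairs n. h i j)"
proof -
  have "(\<Sum>i\<in>{1..n}. \<Sum>j\<in>{1..n} - {i}. h i j) = (\<Sum>(i, j)\<in>(SIGMA i:{1..n}. {1..n} - {i}). h i j)"
    by (rule sum.Sigma) auto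
  also have "(SIGMA i:{1..n}. {1..n} - {i}) = pairs n \<union> prod.swap ` pairs n"
    unfolding pairs_def by (auto simp: image_def)
  also have "(\<Sum>(i, j)\<in>pairs n \<union> prod.swap ` pairs n. h i j)
      = (\<Sum>(i, j)\<in>pairs n. h i j) + (\<Sum>(i, j)\<in>prod.swap ` pairs n. h i j)"
    by (rule sum.union_disjoint) (auto simp: finite_pairs, auto simp: pairs_def)
  also have "(\<Sum>(i, j)\<in>prod.swap ` pairs n. h i j) = (\<Sum>(i, j)\<in>pairs n. h i j)"
    by (subst sum.reindex) (auto simp: inj_on_def case_prod_unfold sym)
  finally show ?thesis by simp
qed

lemma card_pairs: "2 * real (card (pairs n)) = real n * (real n - 1)"
proof -
  have "2 * real (card (pairs n)) = (\<Sum>i\<in>{1..n}. \<Sum>j\<in>{1..n} - {i}. 1)"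
    using sum_offdiag_pairs[of "\<lambda>_ _. 1" n] by (simp add: case_prod_unfold)
  also have "\<dots> = (\<Sum>i\<in>{1..n}. real n - 1)"
    by (intro sum.cong refl) (auto simp: of_nat_diff)
  finally show ?thesis by simp
qed

text \<open>First \<open>r\<close> is fixed so that a r and the distance from z r to z' are small,
  then n grows. In the application \<open>r\<close> is a grid level and the limit y r of fixed level
  is the bridge on that grid.\<close>

lemma tendsto_two_scale:
  fixes x :: "nat \<Rightarrow> real"
  assumes bound: "\<And>r. \<forall>\<^sub>F n in sequentially. \<bar>x n - y r n\<bar> \<le> a r + b n"
    and y: "\<And>r. y r \<longlonglongrightarrow> z r" and a: "a \<longlonglongrightarrow> 0" and b: "b \<longlonglongrightarrow> 0" and z: "z \<longlonglongrightarrow> z'"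
  shows "x \<longlonglongrightarrow> z'"
proof (rule tendstoI)
  fix e :: real assume e: "e > 0"
  have "\<forall>\<^sub>F r in sequentially. dist (z r) z' < e / 4" using tendstoD[OF z, of "e / 4"] e by simp
  moreover have "\<forall>\<^sub>F r in sequentially. a r < e / 4" using order_tendstoD(2)[OF a, of "e / 4"] e by simp
  ultimately have "\<forall>\<^sub>F r in sequentially. dist (z r) z' < e / 4 \<and> a r < e / 4" by (rule eventually_conj)
  then obtain r where r: "dist (z r) z' < e / 4" "a r < e / 4" by (auto dest: eventually_happens)
  have "\<forall>\<^sub>F n in sequentially. dist (y r n) (z r) < e / 4" using tendstoD[OF y, of "e / 4"] e by simp
  moreover have "\<forall>\<^sub>F n in sequentially. b n < e / 4" using order_tendstoD(2)[OF b, of "e / 4"] e by simp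
  ultimately show "\<forall>\<^sub>F n in sequentially. dist (x n) z' < e"
    using bound[of r]
  proof eventually_elim
    case (elim n)
    then show ?case using r unfolding dist_real_def by linarith
  qed
qed

section \<open>Chaining and convergence of the supremum\<close>

lemma cts_step_bounds: "a < b \<Longrightarrow> 0 \<le> cts_step a b x" "a < b \<Longrightarrow> cts_step a b x \<le> 1"
  by (auto simp: cts_step_def divide_simps)

lemma cts_step_lipschitz:
  assumes "a < b"
  shows "\<bar>cts_step a b x - cts_step a b y\<bar> \<le> \<bar>x - y\<bar> / (b - a)"
proof -
  have eq: "cts_step a b z = max 0 (min 1 ((b - z) / (b - a)))" for z
    using assms by (auto simp: cts_step_def max_def min_def field_simps)
  have "\<bar>max 0 (min 1 s) - max 0 (min 1 t)\<bar> \<le> \<bar>s - t\<bar>" for s t :: real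
    by (auto simp: max_def min_def)
  from this[of "(b - x) / (b - a)" "(b - y) / (b - a)"]
  have "\<bar>cts_step a b x - cts_step a b y\<bar> \<le> \<bar>(b - x) / (b - a) - (b - y) / (b - a)\<bar>"
    unfolding eq .
  also have "\<dots> = \<bar>x - y\<bar> / (b - a)"
    using assms by (simp add: abs_minus_commute flip: diff_divide_distrib)
  finally show ?thesis .
qed

lemma continuous_cts_step: "a < b \<Longrightarrow> continuous_on UNIV (cts_step a b)"
  by (intro uniformly_continuous_imp_continuous cts_step_uniformly_continuous)

text \<open>Either y <= l or y^3 >= l^3. Summed over a grid, it bounds the mean of a maximum by
  fourth moments, with \<open>l\<close> still to be tuned.\<close>

lemma le_add_power4:
  fixes y l :: real
  assumes "l > 0"
  shows "y \<le> l + y ^ 4 / l ^ 3"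
proof (cases "y \<le> l")
  case True
  have "0 \<le> y ^ 4 / l ^ 3" using assms by simp
  with True show ?thesis by linarith
next
  case False
  then have "l ^ 3 \<le> y ^ 3" using assms by (intro power_mono) auto
  then have "y * l ^ 3 \<le> y * y ^ 3" using False assms by (intro mult_left_mono) auto
  then have "y \<le> y ^ 4 / l ^ 3" using assms by (simp add: pos_le_divide_eq eval_nat_numeral)
  then show ?thesis using assms by linarith
qed

lemma gmax_le_power4:
  assumes l: "l > 0"
  shows "gmax d x \<le> l + (\<Sum>k\<le>d. x k ^ 4) / l ^ 3"
proof (rule gmax_le)
  fix k assume k: "k \<le> d"
  have "\<bar>x k\<bar> \<le> l + \<bar>x k\<bar> ^ 4 / l ^ 3" by (rule le_add_power4[OF l])
  also have "\<dots> \<le> l + (\<Sum>k\<le>d. x k ^ 4) / l ^ 3"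
    using k l by (intro add_left_mono divide_right_mono) (auto intro!: member_le_sum)
  finally show "\<bar>x k\<bar> \<le> l + (\<Sum>k\<le>d. x k ^ 4) / l ^ 3" .
qed

text \<open>The supremum is attained at some \<open>t\<close>, and the dyadic points just below
  \<open>t\<close> converge to it, which squeezes the grid maxima.\<close>

lemma dyadic_gmax_tendsto_sup:
  fixes h :: "real \<Rightarrow> real"
  assumes h: "continuous_on {0..1} h"
  shows "(\<lambda>r. gmax (2 ^ r) (\<lambda>k. h (k / 2 ^ r))) \<longlonglongrightarrow> (SUP t\<in>{0..1}. \<bar>h t\<bar>)"
proof -
  have c: "continuous_on {0..1} (\<lambda>t. \<bar>h t\<bar>)" by (intro continuous_intros h)
  obtain t where t: "t \<in> {0..1}" "\<And>s. s \<in> {0..1} \<Longrightarrow> \<bar>h s\<bar> \<le> \<bar>h t\<bar>"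
    using continuous_attains_sup[OF _ _ c] by auto
  have sup: "(SUP t\<in>{0..1}. \<bar>h t\<bar>) = \<bar>h t\<bar>"
    using t by (intro cSup_eq_maximum) auto
  define k where "k r = nat \<lfloor>2 ^ r * t\<rfloor>" for r
  have k: "real (k r) = of_int \<lfloor>2 ^ r * t\<rfloor>" for r using t(1) unfolding k_def by simp
  have kt: "real (k r) \<le> 2 ^ r * t" "2 ^ r * t < real (k r) + 1" for r unfolding k by linarith+
  have k_le: "k r \<le> 2 ^ r" for r
  proof -
    have "real (k r) \<le> 2 ^ r * 1" using kt(1)[of r] t(1) by (meson atLeastAtMost_iff mult_left_mono order_trans zero_le_numeral zero_le_power)
    then show ?thesis by (simp flip: of_nat_le_iff)
  qed
  have "(\<lambda>r. real (k r) / 2 ^ r) \<longlonglongrightarrow> t"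
  proof (rule tendsto_sandwich[OF _ _ _ tendsto_const])
    show "\<forall>\<^sub>F r in sequentially. t - (1 / 2) ^ r \<le> real (k r) / 2 ^ r"
    proof (intro always_eventually allI)
      fix r
      have "t \<le> (real (k r) + 1) / 2 ^ r"
        using kt(2)[of r] by (simp add: pos_le_divide_eq mult.commute less_imp_le)
      also have "\<dots> = real (k r) / 2 ^ r + (1 / 2) ^ r"
        by (simp add: add_divide_distrib power_one_over)
      finally show "t - (1 / 2) ^ r \<le> real (k r) / 2 ^ r" by simp
    qed
    show "\<forall>\<^sub>F r in sequentially. real (k r) / 2 ^ r \<le> t"
      using kt(1) by (intro always_eventually allI) (simp add: field_simps)
    show "(\<lambda>r. t - (1 / 2) ^ r) \<longlonglongrightarrow> t"
      using tendsto_diff[OF tendsto_const LIMSEQ_realpow_zero[of "1 / 2"], of t] by simp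
  qed
  then have lim: "(\<lambda>r. \<bar>h (real (k r) / 2 ^ r)\<bar>) \<longlonglongrightarrow> \<bar>h t\<bar>"
    by (rule continuous_on_tendsto_compose[OF c _ t(1)])
      (use k_le in \<open>simp add: divide_le_eq flip: of_nat_le_iff\<close>)
  show ?thesis
    unfolding sup
  proof (rule tendsto_sandwich[OF _ _ lim tendsto_const])
    show "\<forall>\<^sub>F r in sequentially. \<bar>h (real (k r) / 2 ^ r)\<bar> \<le> gmax (2 ^ r) (\<lambda>k. h (k / 2 ^ r))"
      using gmax_ge[OF k_le, of "\<lambda>k. h (k / 2 ^ _)"] by simp
    show "\<forall>\<^sub>F r in sequentially. gmax (2 ^ r) (\<lambda>k. h (k / 2 ^ r)) \<le> \<bar>h t\<bar>"
    proof (intro always_eventually allI gmax_le)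
      fix r k :: nat assume "k \<le> 2 ^ r"
      then have "real k \<le> 2 ^ r" by (simp flip: of_nat_le_iff)
      then show "\<bar>h (k / 2 ^ r)\<bar> \<le> \<bar>h t\<bar>" by (intro t(2)) simp
    qed
  qed
qed

context sample_sequence
begin

definition grid :: "nat \<Rightarrow> nat \<Rightarrow> (nat \<Rightarrow> nat \<Rightarrow> real) \<Rightarrow> real" where
  "grid l n x = gmax (2 ^ l) (\<lambda>k. emp n (k / 2 ^ l) x)"

text \<open>\<open>gmax\<close> includes its upper index, so 2^l - 1 accounts for all 2^l cells of
  level \<open>l\<close>.\<close>

definition incr :: "nat \<Rightarrow> nat \<Rightarrow> (nat \<Rightarrow> nat \<Rightarrow> real) \<Rightarrow> real" where
  "incr l n x = gmax (2 ^ l - 1) (\<lambda>k. emp n (Suc k / 2 ^ l) x - emp n (k / 2 ^ l) x)"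

lemma grid_Suc_ge: "grid l n x \<le> grid (Suc l) n x"
  unfolding grid_def
proof (rule gmax_le)
  fix k :: nat assume "k \<le> 2 ^ l"
  then have "2 * k \<le> 2 ^ Suc l" by simp
  from gmax_ge[OF this, of "\<lambda>k. emp n (k / 2 ^ Suc l) x"]
  show "\<bar>emp n (k / 2 ^ l) x\<bar> \<le> gmax (2 ^ Suc l) (\<lambda>k. emp n (k / 2 ^ Suc l) x)" by simp
qed

text \<open>Even points already belong to level \<open>l\<close>; an odd point is one increment away
  from its left neighbour, which is even.\<close>

lemma grid_Suc_le: "grid (Suc l) n x \<le> grid l n x + incr (Suc l) n x"
  unfolding grid_def[of "Suc l"]
proof (rule gmax_le)
  fix k :: nat assume k: "k \<le> 2 ^ Suc l"
  have even: "\<bar>emp n (real (2 * j) / 2 ^ Suc l) x\<bar> \<le> grid l n x" if "j \<le> 2 ^ l" for j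
    using gmax_ge[OF that, of "\<lambda>k. emp n (k / 2 ^ l) x"] unfolding grid_def by simp
  have incr0: "0 \<le> incr (Suc l) n x"
    unfolding incr_def using gmax_ge[of 0 "2 ^ Suc l - 1" "\<lambda>k. emp n (Suc k / 2 ^ Suc l) x - emp n (k / 2 ^ Suc l) x"]
    by (meson abs_ge_zero le0 order_trans)
  show "\<bar>emp n (k / 2 ^ Suc l) x\<bar> \<le> grid l n x + incr (Suc l) n x"
  proof (cases "even k")
    case True
    then obtain j where j: "k = 2 * j" by (rule evenE)
    then show ?thesis using even[of j] k incr0 by simp
  next
    case False
    then obtain j where j: "k = Suc (2 * j)" by (metis oddE Suc_eq_plus1)
    then have "j \<le> 2 ^ l" "2 * j \<le> 2 ^ Suc l - 1" using k by auto
    from gmax_ge[OF this(2), of "\<lambda>k. emp n (Suc k / 2 ^ Suc l) x - emp n (k / 2 ^ Suc l) x"]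
    have "\<bar>emp n (k / 2 ^ Suc l) x - emp n (real (2 * j) / 2 ^ Suc l) x\<bar> \<le> incr (Suc l) n x"
      unfolding incr_def j .
    then show ?thesis using even[OF \<open>j \<le> 2 ^ l\<close>] by linarith
  qed
qed

lemma grid_chain: "r \<le> R \<Longrightarrow> grid r n x \<le> grid R n x \<and> grid R n x \<le> grid r n x + (\<Sum>l\<in>{r<..R}. incr l n x)"
proof (induction R rule: dec_induct)
  case (step R)
  have "{r<..Suc R} = insert (Suc R) {r<..R}" using step by auto
  then show ?case
    using step grid_Suc_ge[of R n x] grid_Suc_le[of R n x] by simp
qed simp

lemma bdd_meas_grid: "bdd_meas (sample n) (grid l n)"
  unfolding grid_def[abs_def] by (intro bdd_meas_gmax bdd_meas_emp)

lemma bdd_meas_incr: "bdd_meas (sample n) (incr l n)"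
  unfolding incr_def[abs_def] by (intro bdd_meas_gmax bdd_meas_diff bdd_meas_emp)

text \<open>\<alpha> and \<theta>^l are the fourth roots of 1 / N and 2^-l, the two terms in the sum
  of the fourth moments of the level-l increments.\<close>

definition \<alpha> :: "nat \<Rightarrow> real" where "\<alpha> n = 1 / real (N n) powr (1 / 4)"

definition \<theta> :: real where "\<theta> = (1 / 2) powr (1 / 4)"

lemma \<theta>: "0 < \<theta>" "\<theta> < 1" "\<theta> ^ 4 = 1 / 2"
proof -
  show "0 < \<theta>" unfolding \<theta>_def by simp
  show "\<theta> ^ 4 = 1 / 2" unfolding \<theta>_def by (simp add: powr_realpow[symmetric] powr_powr)
  show "\<theta> < 1"
  proof (rule ccontr)
    assume "\<not> \<theta> < 1"
    then have "1 ^ 4 \<le> \<theta> ^ 4" by (intro power_mono) auto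
    with \<open>\<theta> ^ 4 = 1 / 2\<close> show False by simp
  qed
qed

lemma \<alpha>: "0 < \<alpha> n" "\<alpha> n ^ 4 = 1 / N n"
proof -
  have N: "0 < real (N n)" using N2[of n] by simp
  then show "0 < \<alpha> n" unfolding \<alpha>_def by simp
  show "\<alpha> n ^ 4 = 1 / N n"
    unfolding \<alpha>_def power_one_over using N by (simp add: powr_realpow[symmetric] powr_powr)
qed

text \<open>With \<rho> = \<alpha> + \<theta>^l as threshold in \<open>gmax_le_power4\<close>, the
  2^l fourth moments add up to at most 4096 \<rho>^4, so the mean is at most \<rho> + 4096
  \<rho>.\<close>

lemma integral_incr: "(\<integral>x. incr l n x \<partial>sample n) \<le> 4097 * (\<alpha> n + \<theta> ^ l)"
proof -
  interpret S: prob_space "sample n" by (rule prob_space_sample)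
  define \<rho> where "\<rho> = \<alpha> n + \<theta> ^ l"
  have \<rho>: "\<rho> > 0" unfolding \<rho>_def using \<theta> \<alpha> by (simp add: add_pos_pos)
  define D where "D k x = emp n (Suc k / 2 ^ l) x - emp n (k / 2 ^ l) x" for k :: nat and x
  have bD: "bdd_meas (sample n) (D k)" for k
    unfolding D_def by (intro bdd_meas_diff bdd_meas_emp)
  have D4: "(\<integral>x. D k x ^ 4 \<partial>sample n) \<le> 4096 * ((1 / 2 ^ l) / N n + (1 / 2 ^ l)\<^sup>2)" if "k \<le> 2 ^ l - 1" for k
  proof -
    have "Suc k \<le> 2 ^ l" using that by (simp add: Suc_le_eq less_le_trans[of k "2 ^ l"] le_less_trans)
    then have "real (Suc k) \<le> 2 ^ l" "k \<le> 2 ^ l" by (simp_all flip: of_nat_le_iff del: of_nat_Suc)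
    then have "(\<integral>x. D k x ^ 4 \<partial>sample n) \<le> 4096 * ((Suc k / 2 ^ l - k / 2 ^ l) / N n + (Suc k / 2 ^ l - k / 2 ^ l)\<^sup>2)"
      unfolding D_def by (intro emp_increment) (auto simp: divide_right_mono)
    then show ?thesis by (simp flip: diff_divide_distrib)
  qed
  have "(\<integral>x. incr l n x \<partial>sample n) \<le> (\<integral>x. \<rho> + 1 / \<rho> ^ 3 * (\<Sum>k\<le>2 ^ l - 1. D k x ^ 4) \<partial>sample n)"
    by (intro integral_mono S.integrable_bdd_meas bdd_meas_incr bdd_meas_add bdd_meas_mult bdd_meas_const bdd_meas_sum
      bdd_meas_power bD) (use gmax_le_power4[OF \<rho>] in \<open>simp add: incr_def D_def\<close>)
  also have "\<dots> = \<rho> + 1 / \<rho> ^ 3 * (\<integral>x. (\<Sum>k\<le>2 ^ l - 1. D k x ^ 4) \<partial>sample n)"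
    by (rule S.integral_affine) (intro bdd_meas_sum bdd_meas_power bD)
  also have "(\<integral>x. (\<Sum>k\<le>2 ^ l - 1. D k x ^ 4) \<partial>sample n) = (\<Sum>k\<le>2 ^ l - 1. \<integral>x. D k x ^ 4 \<partial>sample n)"
    by (intro Bochner_Integration.integral_sum S.integrable_bdd_meas bdd_meas_power bD)
  also have "\<rho> + 1 / \<rho> ^ 3 * \<dots> \<le> \<rho> + 1 / \<rho> ^ 3 * (\<Sum>k\<le>(2::nat) ^ l - 1. 4096 * ((1 / 2 ^ l) / N n + (1 / 2 ^ l)\<^sup>2))"
    using \<rho> D4 by (intro add_left_mono mult_left_mono sum_mono) auto
  also have "(\<Sum>k\<le>(2::nat) ^ l - 1. 4096 * ((1 / 2 ^ l) / N n + (1 / 2 ^ l)\<^sup>2)) = 4096 * (1 / N n + (1 / 2) ^ l)"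
    by (simp add: power2_eq_square power_one_over distrib_left)
  also have "\<rho> + 1 / \<rho> ^ 3 * (4096 * (1 / N n + (1 / 2) ^ l)) \<le> \<rho> + 1 / \<rho> ^ 3 * (4096 * \<rho> ^ 4)"
  proof -
    have "1 / N n + (1 / 2) ^ l = \<alpha> n ^ 4 + (\<theta> ^ l) ^ 4"
      unfolding \<alpha>(2) \<theta>(3)[symmetric] by (simp add: power_mult[symmetric] mult.commute)
    also have "\<dots> \<le> \<rho> ^ 4"
    proof -
      have "a ^ 4 + b ^ 4 \<le> (a + b) ^ 4" if "0 \<le> a" "0 \<le> b" for a b :: real
      proof -
        have "(a + b) ^ 4 = a ^ 4 + b ^ 4 + (4 * a ^ 3 * b + 6 * a\<^sup>2 * b\<^sup>2 + 4 * a * b ^ 3)"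
          by (simp add: eval_nat_numeral algebra_simps)
        then show ?thesis using that by simp
      qed
      then show ?thesis unfolding \<rho>_def using \<alpha>(1)[of n] \<theta>(1) by (simp add: less_imp_le)
    qed
    finally show ?thesis using \<rho> by (intro add_left_mono mult_left_mono) auto
  qed
  also have "\<dots> = 4097 * \<rho>"
    using \<rho> by (simp add: eval_nat_numeral)
  finally show ?thesis unfolding \<rho>_def .
qed

text \<open>The part \<theta>^l is geometric in the level; \<alpha> does not decay and is paid once
  per level, hence the factor \<open>R\<close>.\<close>

lemma integral_sum_incr:
  "(\<integral>x. (\<Sum>l\<in>{r<..R}. incr l n x) \<partial>sample n) \<le> 4097 * (R * \<alpha> n) + 4097 * \<theta> ^ r / (1 - \<theta>)"
proof -
  interpret S: prob_space "sample n" by (rule prob_space_sample)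
  have "(\<integral>x. (\<Sum>l\<in>{r<..R}. incr l n x) \<partial>sample n) = (\<Sum>l\<in>{r<..R}. \<integral>x. incr l n x \<partial>sample n)"
    by (intro Bochner_Integration.integral_sum S.integrable_bdd_meas bdd_meas_incr)
  also have "\<dots> \<le> (\<Sum>l\<in>{r<..R}. 4097 * \<alpha> n + 4097 * \<theta> ^ l)"
    using integral_incr by (intro sum_mono) (simp add: distrib_left)
  also have "\<dots> = 4097 * \<alpha> n * card {r<..R} + 4097 * (\<Sum>l\<in>{r<..R}. \<theta> ^ l)"
    by (simp add: sum.distrib sum_distrib_left)
  also have "\<dots> \<le> 4097 * \<alpha> n * R + 4097 * (\<theta> ^ r / (1 - \<theta>))"
  proof (intro add_mono mult_left_mono)
    have "(\<Sum>l\<in>{r<..R}. \<theta> ^ l) \<le> (\<Sum>l\<in>{r..R}. \<theta> ^ l)"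
      using \<theta> by (intro sum_mono2) auto
    also have "\<dots> \<le> \<theta> ^ r / (1 - \<theta>)"
      using \<theta> by (cases "r \<le> R") (auto simp: sum_gp divide_right_mono)
    finally show "(\<Sum>l\<in>{r<..R}. \<theta> ^ l) \<le> \<theta> ^ r / (1 - \<theta>)" .
  qed (use \<alpha>(1)[of n] in auto)
  finally show ?thesis by (simp add: mult_ac)
qed

section \<open>From the empirical process to the statistic\<close>

definition edf :: "nat \<Rightarrow> (nat \<Rightarrow> nat \<Rightarrow> real) \<Rightarrow> real \<Rightarrow> real" where
  "edf n D t = 2 / (real (N n) * (real (N n) - 1)) * (\<Sum>(i, j)\<in>pairs (N n). of_bool (D i j \<le> t))"

definition root_pairs :: "nat \<Rightarrow> real" where
  "root_pairs n = sqrt (real (N n) * (real (N n) - 1) / 2)"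

lemma edf_mono: "mono (edf n D)"
proof (rule monoI)
  fix s t :: real assume "s \<le> t"
  then show "edf n D s \<le> edf n D t"
    unfolding edf_def using N2[of n] by (intro mult_left_mono sum_mono) auto
qed

lemma root_pairs_bounds: "0 \<le> root_pairs n" "root_pairs n \<le> N n"
proof -
  have "real (N n) * (real (N n) - 1) / 2 \<le> (real (N n))\<^sup>2"
    using N2[of n] by (simp add: power2_eq_square algebra_simps)
  then show "0 \<le> root_pairs n" "root_pairs n \<le> N n"
    unfolding root_pairs_def using N2[of n] by (auto intro: real_le_lsqrt)
qed

text \<open>The estimate is deterministic in the array \<open>D\<close>, so it serves the raw inner
  products (for measurability) as well as those of the points moved onto the sphere (for
  \<open>emp\<close>).\<close>

lemma sup_edf_sandwich:
  fixes n R :: nat and D :: "nat \<Rightarrow> nat \<Rightarrow> real"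
  defines "g \<equiv> gmax (2 ^ R) (\<lambda>k. root_pairs n * (edf n D (q n (k / 2 ^ R)) - k / 2 ^ R))"
    and "s \<equiv> root_pairs n * (SUP t\<in>{-1..1}. \<bar>edf n D t - Q.cdf_kern n t\<bar>)"
  shows "g \<le> s" "s \<le> g + N n / 2 ^ R"
proof -
  have m: "mono (Q.cdf_kern n)" by (intro monoI Q.cdf_kern_mono)
  have q: "q n u \<in> {-1..1} \<and> Q.cdf_kern n (q n u) = u" if "u \<in> {0..1}" for u
    using Q.q_range[OF that] Q.cdf_q[OF that] by blast
  have K: "1 \<le> (2::nat) ^ R" by simp
  note sw = sup_sandwich[OF edf_mono[of n D] m Q.q0 Q.q1 q K, unfolded of_nat_power of_nat_numeral]
  have g: "g = root_pairs n * gmax (2 ^ R) (\<lambda>k. edf n D (q n (k / 2 ^ R)) - k / 2 ^ R)"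
    unfolding g_def by (rule gmax_scale) (rule root_pairs_bounds)
  show "g \<le> s" unfolding g s_def
    using sw(1) root_pairs_bounds(1)[of n] by (rule mult_left_mono)
  have "s \<le> root_pairs n * (gmax (2 ^ R) (\<lambda>k. edf n D (q n (k / 2 ^ R)) - k / 2 ^ R) + 1 / 2 ^ R)"
    unfolding s_def using sw(2) root_pairs_bounds(1)[of n] by (rule mult_left_mono)
  also have "\<dots> = g + root_pairs n / 2 ^ R" unfolding g by (simp add: distrib_left)
  also have "\<dots> \<le> g + N n / 2 ^ R"
    using root_pairs_bounds(2)[of n] by (intro add_left_mono divide_right_mono) auto
  finally show "s \<le> g + N n / 2 ^ R" .
qed

lemma emp_eq_edf: "emp n u x = root_pairs n * (edf n (\<lambda>i j. Q.kern n (x i) (x j)) (q n u) - u)"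
proof -
  define m where "m = real (N n) * (real (N n) - 1)"
  have m: "m > 0" using N2[of n] unfolding m_def by simp
  define S where "S = (\<Sum>(i, j)\<in>pairs (N n). of_bool (Q.kern n (x i) (x j) \<le> q n u) :: real)"
  have "ustat (Q.ind n u) {1..N n} x = 2 * (\<Sum>(i, j)\<in>pairs (N n). Q.ind n u (x i) (x j))"
    unfolding ustat_def by (rule sum_offdiag_pairs) (rule Q.ind_commute)
  also have "(\<Sum>(i, j)\<in>pairs (N n). Q.ind n u (x i) (x j)) = S - u * card (pairs (N n))"
    unfolding Q.ind_def S_def by (simp add: case_prod_unfold sum_subtractf)
  also have "real (card (pairs (N n))) = m / 2"
    using card_pairs[of "N n"] unfolding m_def by simp
  also have "2 * (S - u * (m / 2)) = m * (2 / m * S - u)"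
    using m by (simp add: field_simps)
  finally have U: "ustat (Q.ind n u) {1..N n} x = m * (2 / m * S - u)" .
  have "emp n u x = sqrt (1 / (2 * m)) * m * (2 / m * S - u)"
    unfolding emp_def U m_def by (simp add: mult.assoc)
  also have "sqrt (1 / (2 * m)) * m = sqrt (m / 2)"
  proof -
    have "sqrt (1 / (2 * m)) * m = sqrt (1 / (2 * m)) * sqrt (m\<^sup>2)" using m by simp
    also have "\<dots> = sqrt (m / 2)" unfolding real_sqrt_mult[symmetric] using m by (simp add: power2_eq_square)
    finally show ?thesis .
  qed
  finally show ?thesis unfolding root_pairs_def edf_def S_def m_def by simp
qed

definition stat :: "nat \<Rightarrow> (nat \<Rightarrow> nat \<Rightarrow> real) \<Rightarrow> real" where
  "stat n x = root_pairs n * T_stat (N n) (p n) (\<mu> n) x"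

lemma stat_eq: "stat n x = root_pairs n * (SUP t\<in>{-1..1}. \<bar>edf n (\<lambda>i j. dot (p n) (x i) (x j)) t - Q.cdf_kern n t\<bar>)"
  unfolding stat_def T_stat_def edf_def pairs_def Q.inner_cdf_eq ..

lemma measurable_dot_sample:
  assumes "i \<in> {1..N n}" "j \<in> {1..N n}"
  shows "(\<lambda>x. dot (p n) (x i) (x j)) \<in> borel_measurable (sample n)"
proof -
  have "(\<lambda>x. x i k) \<in> borel_measurable (sample n)" if "i \<in> {1..N n}" "k < p n" for i k
  proof -
    have "(\<lambda>x. x i) \<in> measurable (sample n) (\<mu> n)"
      unfolding sample_def using that by (intro measurable_component_singleton)
    moreover have "(\<lambda>y. y k) \<in> borel_measurable (\<mu> n)"
      unfolding Q.measurable_mu rspace_def using that by (intro measurable_component_singleton) simp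
    ultimately show ?thesis by (rule measurable_compose)
  qed
  then show ?thesis
    unfolding dot_def using assms by (intro borel_measurable_sum borel_measurable_times) auto
qed

text \<open>The supremum runs over uncountably many thresholds; it is the limit of maxima over
  dyadic grids of quantiles, with error at most N / 2^R.\<close>

lemma measurable_stat: "stat n \<in> borel_measurable (sample n)"
proof (rule borel_measurable_LIMSEQ_real)
  let ?g = "\<lambda>R x. gmax (2 ^ R) (\<lambda>k. root_pairs n * (edf n (\<lambda>i j. dot (p n) (x i) (x j)) (q n (k / 2 ^ R)) - k / 2 ^ R))"
  fix R
  have "(\<lambda>x. edf n (\<lambda>i j. dot (p n) (x i) (x j)) t) \<in> borel_measurable (sample n)" for t
    unfolding edf_def case_prod_unfold
    by (intro borel_measurable_times borel_measurable_const borel_measurable_sum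
      bdd_meas_measurable[OF bdd_meas_of_bool_le] measurable_dot_sample) (auto simp: pairs_def)
  then show "?g R \<in> borel_measurable (sample n)"
    by (intro measurable_gmax borel_measurable_times borel_measurable_diff borel_measurable_const)
next
  fix x assume "x \<in> space (sample n)"
  let ?g = "\<lambda>R. gmax (2 ^ R) (\<lambda>k. root_pairs n * (edf n (\<lambda>i j. dot (p n) (x i) (x j)) (q n (k / 2 ^ R)) - k / 2 ^ R))"
  have "(\<lambda>R. (1 / 2 :: real) ^ R) \<longlonglongrightarrow> 0" by (rule LIMSEQ_realpow_zero) auto
  from tendsto_diff[OF tendsto_const[of "stat n x"] tendsto_mult[OF tendsto_const[of "real (N n)"] this]]
  have "(\<lambda>R. stat n x - N n * (1 / 2) ^ R) \<longlonglongrightarrow> stat n x" by simp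
  then show "?g \<longlonglongrightarrow> stat n x"
  proof (rule tendsto_sandwich[OF _ _ _ tendsto_const, rotated 2])
    show "\<forall>\<^sub>F R in sequentially. stat n x - N n * (1 / 2) ^ R \<le> ?g R"
      using sup_edf_sandwich(2)[where D = "\<lambda>i j. dot (p n) (x i) (x j)"] unfolding stat_eq
      by (intro always_eventually allI) (simp add: power_one_over algebra_simps)
    show "\<forall>\<^sub>F R in sequentially. ?g R \<le> stat n x"
      unfolding stat_eq by (intro always_eventually allI sup_edf_sandwich(1))
  qed
qed

text \<open>Almost surely all sample points lie on the sphere, where \<open>dot\<close> and
  \<open>kern\<close> agree. A single null set serves all levels.\<close>

lemma AE_stat_sandwich: "AE x in sample n. \<forall>R. grid R n x \<le> stat n x \<and> stat n x \<le> grid R n x + N n / 2 ^ R"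
proof -
  have "AE x in sample n. Q.onto n (x i) = x i" if "i \<in> {1..N n}" for i
    unfolding sample_def by (rule AE_PiM_component[OF Q.prob_space_axioms that Q.AE_onto])
  then have "AE x in sample n. \<forall>i\<in>{1..N n}. Q.onto n (x i) = x i"
    by (intro AE_finite_allI) auto
  then show ?thesis
  proof eventually_elim
    case (elim x)
    have "edf n (\<lambda>i j. dot (p n) (x i) (x j)) t = edf n (\<lambda>i j. Q.kern n (x i) (x j)) t" for t
      unfolding edf_def Q.kern_def using elim
      by (intro arg_cong2[of _ _ _ _ "(*)"] refl sum.cong) (auto simp: pairs_def)
    then have "stat n x = root_pairs n * (SUP t\<in>{-1..1}. \<bar>edf n (\<lambda>i j. Q.kern n (x i) (x j)) t - Q.cdf_kern n t\<bar>)"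
      unfolding stat_eq by (simp only:)
    then show ?case
      using sup_edf_sandwich[where D = "\<lambda>i j. Q.kern n (x i) (x j)" and n = n]
      unfolding grid_def emp_eq_edf by simp
  qed
qed


section \<open>Limit on a fixed grid and limit of the supremum\<close>

lemma emp_second_moment:
  assumes u: "u \<in> {0..1}"
  shows "(\<integral>x. (emp n u x)\<^sup>2 \<partial>sample n) \<le> 2"
proof -
  interpret K: mean_zero_kernel "\<mu> n" "Q.ind n u"
    by unfold_locales (auto intro: Q.bdd_meas_ind Q.ind_commute Q.integral_ind u)
  have N: "real (N n) \<ge> 2" using N2[of n] by simp
  have var: "(\<integral>y. (Q.ind n u x y)\<^sup>2 \<partial>\<mu> n) = u - u * u" for x
    using Q.integral_ind_ind[OF u u, of n x] by (simp add: power2_eq_square)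
  have "(\<integral>x. (emp n u x)\<^sup>2 \<partial>sample n)
      = 1 / (2 * real (N n) * (real (N n) - 1)) * (\<integral>x. (ustat (Q.ind n u) {1..N n} x)\<^sup>2 \<partial>sample n)"
    unfolding emp_def using N by (simp add: power_mult_distrib)
  also have "\<dots> \<le> 1 / (2 * real (N n) * (real (N n) - 1)) * (2 * (real (N n))\<^sup>2 * (u - u * u))"
    using K.ustat_second_moment[of "{1..N n}"] N
    unfolding sample_def var by (intro mult_left_mono) (simp_all add: Q.prob_space)
  also have "\<dots> \<le> 1 / (2 * real (N n) * (real (N n) - 1)) * (2 * (real (N n))\<^sup>2 * 1)"
    using u N by (intro mult_left_mono) (auto intro: order_trans[of _ u])
  also have "\<dots> = real (N n) / (real (N n) - 1)"
    using N by (simp add: power2_eq_square)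
  also have "\<dots> \<le> 2" using N by (simp add: divide_le_eq)
  finally show ?thesis .
qed

text \<open>The limit characteristic function of the grid values of \<open>emp\<close> is that of
  the bridge on the grid, and the maximum is a continuous function of these values. Both sides have
  second moments at most 2.\<close>

lemma grid_tendsto:
  assumes B: "brownian_bridge M B" and ab: "a < b"
  shows "(\<lambda>n. \<integral>x. cts_step a b (grid r n x) \<partial>sample n)
    \<longlonglongrightarrow> (\<integral>\<omega>. cts_step a b (gmax (2 ^ r) (\<lambda>k. B (k / 2 ^ r) \<omega>)) \<partial>M)"
proof -
  \<comment> \<open>Level r has 2^r + 1 grid points, both end points included.\<close>
  define d :: nat where "d = Suc (2 ^ r)"
  define u where "u k = real k / 2 ^ r" for k :: nat
  have u: "u k \<in> {0..1}" if "k < d" for k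
  proof -
    have "real k \<le> 2 ^ r" using that unfolding d_def by (simp add: less_Suc_eq_le flip: of_nat_le_iff)
    then show ?thesis unfolding u_def by simp
  qed
  have inj: "inj_on u {..<d}" unfolding u_def by (auto simp: inj_on_def)
  have trunc: "gmax (2 ^ r) (trunc_vec d w) = gmax (2 ^ r) w" for w
    by (rule gmax_cong) (simp add: trunc_vec_def d_def)
  have P: "prob_space M" using B unfolding brownian_bridge_def by simp
  have var: "(\<integral>\<omega>. (B t \<omega>)\<^sup>2 \<partial>M) \<le> 2" if "t \<in> {0..1}" for t
  proof -
    have "(\<integral>\<omega>. B t \<omega> * B t \<omega> \<partial>M) = min t t - t * t"
      using B that unfolding brownian_bridge_def by blast
    moreover have "min t t - t * t \<le> 2" using that by (simp add: order_trans[of _ t])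
    ultimately show ?thesis by (simp add: power2_eq_square)
  qed
  interpret S: prob_space "sample n" for n by (rule prob_space_sample)
  have "(\<lambda>n. \<integral>x. cts_step a b (gmax (2 ^ r) (trunc_vec d (\<lambda>k. emp n (u k) x))) \<partial>sample n)
    \<longlonglongrightarrow> (\<integral>\<omega>. cts_step a b (gmax (2 ^ r) (trunc_vec d (\<lambda>k. B (u k) \<omega>))) \<partial>M)"
  proof (rule multivariate_continuity[where C = 2 and B = 1 and f = "\<lambda>x. cts_step a b (gmax (2 ^ r) x)", OF prob_space_sample P])
    show "continuous_on UNIV (\<lambda>x. cts_step a b (gmax (2 ^ r) x))"
      by (rule continuous_on_compose2[OF continuous_cts_step[OF ab] continuous_gmax]) simp
    show "\<bar>cts_step a b (gmax (2 ^ r) x)\<bar> \<le> 1" for x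
      using cts_step_bounds[OF ab] by (simp add: abs_le_iff order_trans[of _ 0])
    show "(\<lambda>n. \<integral>x. iexp (\<Sum>k<d. \<xi> k * emp n (u k) x) \<partial>sample n)
      \<longlonglongrightarrow> (\<integral>\<omega>. iexp (\<Sum>k<d. \<xi> k * B (u k) \<omega>) \<partial>M)" for \<xi>
    proof -
      have "(\<integral>\<omega>. iexp (\<Sum>k<d. \<xi> k * B (u k) \<omega>) \<partial>M)
          = exp (- (\<Sum>k<d. \<Sum>l<d. \<xi> k * \<xi> l * (min (u k) (u l) - u k * u l)) / 2)"
        by (rule brownian_bridge_char[OF B _ inj]) (rule u)
      then show ?thesis using char_emp_tendsto[of d u \<xi>] u by simp
    qed
  qed (auto intro: bdd_meas_measurable[OF bdd_meas_emp] S.integrable_bdd_meas bdd_meas_power bdd_meas_emp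
      emp_second_moment u brownian_bridge_rv[OF B] var)
  then show ?thesis unfolding trunc grid_def u_def .
qed

text \<open>All paths of the bridge are continuous, so dyadic maxima converge pointwise to the
  supremum; measurability of the supremum comes from the same limit.\<close>

lemma sup_bridge_tendsto:
  assumes B: "brownian_bridge M B" and ab: "a < b"
  shows "(\<lambda>r. \<integral>\<omega>. cts_step a b (gmax (2 ^ r) (\<lambda>k. B (k / 2 ^ r) \<omega>)) \<partial>M)
    \<longlonglongrightarrow> (\<integral>\<omega>. cts_step a b (SUP t\<in>{0..1}. \<bar>B t \<omega>\<bar>) \<partial>M)"
    and "(\<lambda>\<omega>. SUP t\<in>{0..1}. \<bar>B t \<omega>\<bar>) \<in> borel_measurable M"
proof -
  interpret prob_space M using B unfolding brownian_bridge_def by simp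
  have lim: "(\<lambda>r. gmax (2 ^ r) (\<lambda>k. B (k / 2 ^ r) \<omega>)) \<longlonglongrightarrow> (SUP t\<in>{0..1}. \<bar>B t \<omega>\<bar>)" if "\<omega> \<in> space M" for \<omega>
    using dyadic_gmax_tendsto_sup[of "\<lambda>t. B t \<omega>"] B that unfolding brownian_bridge_def by blast
  have m: "(\<lambda>\<omega>. gmax (2 ^ r) (\<lambda>k. B (k / 2 ^ r) \<omega>)) \<in> borel_measurable M" for r
  proof (rule measurable_gmax)
    fix k :: nat assume "k \<le> 2 ^ r"
    then have "real k \<le> 2 ^ r" by (simp flip: of_nat_le_iff)
    then show "B (k / 2 ^ r) \<in> borel_measurable M" by (intro brownian_bridge_rv[OF B]) simp
  qed
  show ms: "(\<lambda>\<omega>. SUP t\<in>{0..1}. \<bar>B t \<omega>\<bar>) \<in> borel_measurable M"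
    by (rule borel_measurable_LIMSEQ_real[OF lim m])
  have cm: "cts_step a b \<in> borel_measurable borel"
    by (rule borel_measurable_continuous_onI[OF continuous_cts_step[OF ab]])
  show "(\<lambda>r. \<integral>\<omega>. cts_step a b (gmax (2 ^ r) (\<lambda>k. B (k / 2 ^ r) \<omega>)) \<partial>M)
    \<longlonglongrightarrow> (\<integral>\<omega>. cts_step a b (SUP t\<in>{0..1}. \<bar>B t \<omega>\<bar>) \<partial>M)"
  proof (rule integral_dominated_convergence[where w = "\<lambda>_. 1"])
    show "(\<lambda>\<omega>. cts_step a b (SUP t\<in>{0..1}. \<bar>B t \<omega>\<bar>)) \<in> borel_measurable M"
      by (rule measurable_compose[OF ms cm])
    show "(\<lambda>\<omega>. cts_step a b (gmax (2 ^ r) (\<lambda>k. B (k / 2 ^ r) \<omega>))) \<in> borel_measurable M" for r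
      by (rule measurable_compose[OF m cm])
    show "AE \<omega> in M. (\<lambda>r. cts_step a b (gmax (2 ^ r) (\<lambda>k. B (k / 2 ^ r) \<omega>))) \<longlonglongrightarrow> cts_step a b (SUP t\<in>{0..1}. \<bar>B t \<omega>\<bar>)"
    proof (rule AE_I2)
      fix \<omega> assume "\<omega> \<in> space M"
      from lim[OF this] show "(\<lambda>r. cts_step a b (gmax (2 ^ r) (\<lambda>k. B (k / 2 ^ r) \<omega>))) \<longlonglongrightarrow> cts_step a b (SUP t\<in>{0..1}. \<bar>B t \<omega>\<bar>)"
        by (rule continuous_on_tendsto_compose[OF continuous_cts_step[OF ab]]) auto
    qed
    show "AE \<omega> in M. norm (cts_step a b (gmax (2 ^ r) (\<lambda>k. B (k / 2 ^ r) \<omega>))) \<le> 1" for r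
      using cts_step_bounds[OF ab] by (intro AE_I2) simp
  qed simp
qed

text \<open>The dyadic level \<open>R\<close> is chosen with \<open>N\<^sup>2 \<le> 2\<^sup>R\<close>, so that the discretisation error \<open>N / 2\<^sup>R\<close>
  vanishes while \<open>R\<close> is still negligible against \<open>N\<^sup>1\<^sup>/\<^sup>4\<close>.\<close>

definition level :: "nat \<Rightarrow> nat" where
  "level n = nat \<lceil>2 * log 2 (N n)\<rceil>"

lemma level_bounds: "real (N n) / 2 ^ level n \<le> 1 / N n" "real (level n) \<le> 2 / ln 2 * ln (N n) + 1"
proof -
  have N: "real (N n) \<ge> 2" using N2[of n] by simp
  then have l0: "0 \<le> log 2 (N n)" by simp
  then show "real (level n) \<le> 2 / ln 2 * ln (N n) + 1"
    unfolding level_def log_def by simp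
  have "(2::real) powr (2 * log 2 (N n)) = (2 powr log 2 (N n)) powr 2"
    unfolding powr_powr by (rule arg_cong[of _ _ "(powr) 2"]) (rule mult.commute)
  also have "2 powr log 2 (N n) = N n" using N by (intro powr_log_cancel) auto
  also have "real (N n) powr 2 = (real (N n))\<^sup>2" using N by simp
  finally have "(real (N n))\<^sup>2 = 2 powr (2 * log 2 (N n))" ..
  also have "\<dots> \<le> 2 powr real (level n)"
    unfolding level_def using l0 by (intro powr_mono) auto
  also have "\<dots> = 2 ^ level n" by (simp add: powr_realpow)
  finally show "real (N n) / 2 ^ level n \<le> 1 / N n"
    using N by (simp add: field_simps power2_eq_square)
qed

lemma level_alpha_tendsto: "(\<lambda>n. level n * \<alpha> n) \<longlonglongrightarrow> 0"
proof (rule tendsto_sandwich[OF _ _ tendsto_const])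
  show "\<forall>\<^sub>F n in sequentially. 0 \<le> level n * \<alpha> n"
    using \<alpha>(1) by (intro always_eventually allI) (simp add: less_imp_le)
  show "\<forall>\<^sub>F n in sequentially. level n * \<alpha> n \<le> 2 / ln 2 * (ln (N n) / N n powr (1 / 4)) + 1 / N n powr (1 / 4)"
  proof (intro always_eventually allI)
    fix n
    have "level n * \<alpha> n \<le> (2 / ln 2 * ln (N n) + 1) * \<alpha> n"
      using level_bounds(2)[of n] \<alpha>(1)[of n] by (intro mult_right_mono) auto
    then show "level n * \<alpha> n \<le> 2 / ln 2 * (ln (N n) / N n powr (1 / 4)) + 1 / N n powr (1 / 4)"
      unfolding \<alpha>_def by (simp add: add_divide_distrib)
  qed
  have "(\<lambda>m. ln (real m) / real m powr (1 / 4)) \<longlonglongrightarrow> 0"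
    by (rule lim_ln_over_power) simp
  from filterlim_compose[OF this N_lim]
  have 1: "(\<lambda>n. ln (real (N n)) / real (N n) powr (1 / 4)) \<longlonglongrightarrow> 0" .
  have "(\<lambda>m. 1 / real m powr (1 / 4)) \<longlonglongrightarrow> 0"
    by (rule lim_1_over_real_power) simp
  from filterlim_compose[OF this N_lim]
  have 2: "(\<lambda>n. 1 / real (N n) powr (1 / 4)) \<longlonglongrightarrow> 0" .
  from tendsto_add[OF tendsto_mult[OF tendsto_const[of "2 / ln 2"] 1] 2]
  show "(\<lambda>n. 2 / ln 2 * (ln (N n) / N n powr (1 / 4)) + 1 / N n powr (1 / 4)) \<longlonglongrightarrow> 0"
    by simp
qed

text \<open>\<open>cts_step\<close> has Lipschitz constant 1 / (b - a), and the distance from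
  \<open>stat\<close> to level \<open>r\<close> is at most the discretisation error 1 / N plus the
  increments between \<open>r\<close> and \<open>level n\<close>. A term in \<open>r\<close> alone
  and a term in \<open>n\<close> alone are kept apart, as \<open>tendsto_two_scale\<close>
  expects.\<close>

lemma stat_grid_bound:
  assumes ab: "a < b" and r: "r \<le> level n"
  shows "\<bar>(\<integral>x. cts_step a b (stat n x) \<partial>sample n) - (\<integral>x. cts_step a b (grid r n x) \<partial>sample n)\<bar>
    \<le> 4097 / (b - a) * (\<theta> ^ r / (1 - \<theta>)) + 1 / (b - a) * (4097 * (level n * \<alpha> n) + 1 / N n)"
proof -
  interpret S: prob_space "sample n" by (rule prob_space_sample)
  define W where "W x = (\<Sum>l\<in>{r<..level n}. incr l n x)" for x
  have bW: "bdd_meas (sample n) W" unfolding W_def[abs_def] by (intro bdd_meas_sum bdd_meas_incr)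
  have cm: "cts_step a b \<in> borel_measurable borel"
    by (rule borel_measurable_continuous_onI[OF continuous_cts_step[OF ab]])
  have bc: "bdd_meas (sample n) (\<lambda>x. cts_step a b (V x))" if "V \<in> borel_measurable (sample n)" for V
    using measurable_compose[OF that cm] cts_step_bounds[OF ab] by (intro bdd_measI[of _ _ 1]) auto
  note b1 = bc[OF measurable_stat] and b2 = bc[OF bdd_meas_measurable[OF bdd_meas_grid[of n r]]]
  have "AE x in sample n. \<bar>cts_step a b (stat n x) - cts_step a b (grid r n x)\<bar> \<le> 1 / (b - a) * 1 / N n + 1 / (b - a) * W x"
    using AE_stat_sandwich[of n]
  proof eventually_elim
    case (elim x)
    have "grid (level n) n x \<le> stat n x" "stat n x \<le> grid (level n) n x + N n / 2 ^ level n" using elim by auto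
    moreover have "grid r n x \<le> grid (level n) n x" "grid (level n) n x \<le> grid r n x + W x"
      using grid_chain[OF r, of n x] unfolding W_def by auto
    ultimately have "\<bar>stat n x - grid r n x\<bar> \<le> 1 / N n + W x"
      using level_bounds(1)[of n] by linarith
    then have "\<bar>stat n x - grid r n x\<bar> / (b - a) \<le> (1 / N n + W x) / (b - a)"
      using ab by (intro divide_right_mono) auto
    with cts_step_lipschitz[OF ab, of "stat n x" "grid r n x"] show ?case
      by (simp add: add_divide_distrib mult.commute)
  qed
  then have "(\<integral>x. \<bar>cts_step a b (stat n x) - cts_step a b (grid r n x)\<bar> \<partial>sample n)
      \<le> (\<integral>x. 1 / (b - a) * 1 / N n + 1 / (b - a) * W x \<partial>sample n)"
    by (intro integral_mono_AE S.integrable_bdd_meas bdd_meas_abs bdd_meas_diff bdd_meas_add bdd_meas_mult bdd_meas_const b1 b2 bW)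
  also have "\<dots> = 1 / (b - a) * 1 / N n + 1 / (b - a) * (\<integral>x. W x \<partial>sample n)"
    by (rule S.integral_affine[OF bW])
  also have "\<dots> \<le> 1 / (b - a) * 1 / N n + 1 / (b - a) * (4097 * (level n * \<alpha> n) + 4097 * \<theta> ^ r / (1 - \<theta>))"
    using integral_sum_incr[of n r "level n"] ab unfolding W_def by (intro add_left_mono mult_left_mono) auto
  also have "\<dots> = 4097 / (b - a) * (\<theta> ^ r / (1 - \<theta>)) + 1 / (b - a) * (4097 * (level n * \<alpha> n) + 1 / N n)"
    by (simp add: distrib_left)
  finally have *: "(\<integral>x. \<bar>cts_step a b (stat n x) - cts_step a b (grid r n x)\<bar> \<partial>sample n)
      \<le> 4097 / (b - a) * (\<theta> ^ r / (1 - \<theta>)) + 1 / (b - a) * (4097 * (level n * \<alpha> n) + 1 / N n)" .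
  have "(\<integral>x. cts_step a b (stat n x) \<partial>sample n) - (\<integral>x. cts_step a b (grid r n x) \<partial>sample n)
      = (\<integral>x. cts_step a b (stat n x) - cts_step a b (grid r n x) \<partial>sample n)"
    by (rule Bochner_Integration.integral_diff[OF S.integrable_bdd_meas[OF b1] S.integrable_bdd_meas[OF b2], symmetric])
  then show ?thesis
    using integral_abs_bound[of "sample n" "\<lambda>x. cts_step a b (stat n x) - cts_step a b (grid r n x)"] *
    by linarith
qed

lemma filterlim_level: "filterlim level at_top sequentially"
  unfolding filterlim_at_top
proof
  fix r
  have "\<forall>\<^sub>F n in sequentially. 2 ^ r \<le> N n"
    using N_lim unfolding filterlim_at_top by blast
  then show "\<forall>\<^sub>F n in sequentially. r \<le> level n"
  proof eventually_elim
    case (elim n)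
    have N: "real (N n) \<ge> 2" using N2[of n] by simp
    have "real (2 ^ r) \<le> real (N n)" using elim by (simp only: of_nat_le_iff)
    also have "\<dots> \<le> N n * N n" using N by simp
    also have "\<dots> \<le> 2 ^ level n"
      using level_bounds(1)[of n] N by (simp add: field_simps)
    finally have "(2::real) ^ r \<le> 2 ^ level n" by simp
    then show "r \<le> level n" by (rule power_le_imp_le_exp[rotated]) simp
  qed
qed

lemma stat_tendsto:
  assumes B: "brownian_bridge M B" and ab: "a < b"
  shows "(\<lambda>n. \<integral>x. cts_step a b (stat n x) \<partial>sample n) \<longlonglongrightarrow> (\<integral>\<omega>. cts_step a b (SUP t\<in>{0..1}. \<bar>B t \<omega>\<bar>) \<partial>M)"
proof (rule tendsto_two_scale[OF _ grid_tendsto[OF B ab] _ _ sup_bridge_tendsto(1)[OF B ab]])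
  fix r
  have "\<forall>\<^sub>F n in sequentially. r \<le> level n"
    using filterlim_level unfolding filterlim_at_top by blast
  then show "\<forall>\<^sub>F n in sequentially. \<bar>(\<integral>x. cts_step a b (stat n x) \<partial>sample n) - (\<integral>x. cts_step a b (grid r n x) \<partial>sample n)\<bar>
      \<le> 4097 / (b - a) * (\<theta> ^ r / (1 - \<theta>)) + 1 / (b - a) * (4097 * (level n * \<alpha> n) + 1 / N n)"
    by eventually_elim (rule stat_grid_bound[OF ab])
next
  have "(\<lambda>r. \<theta> ^ r) \<longlonglongrightarrow> 0" using \<theta> by (intro LIMSEQ_realpow_zero) auto
  from tendsto_mult[OF tendsto_const[of "4097 / (b - a)"] tendsto_mult[OF this tendsto_const[of "1 / (1 - \<theta>)"]]]
  show "(\<lambda>r. 4097 / (b - a) * (\<theta> ^ r / (1 - \<theta>))) \<longlonglongrightarrow> 0" by simp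
  have "(\<lambda>m. 1 / real m) \<longlonglongrightarrow> 0" by (rule lim_1_over_n)
  from filterlim_compose[OF this N_lim] have 1: "(\<lambda>n. 1 / real (N n)) \<longlonglongrightarrow> 0" .
  from tendsto_mult[OF tendsto_const[of "1 / (b - a)"] tendsto_add[OF tendsto_mult[OF tendsto_const[of 4097] level_alpha_tendsto] 1]]
  show "(\<lambda>n. 1 / (b - a) * (4097 * (level n * \<alpha> n) + 1 / N n)) \<longlonglongrightarrow> 0" by simp
qed


text \<open>On the real line weak convergence may be tested on the functions
  \<open>cts_step\<close>, which is why the limits above are stated for them.\<close>

lemma weak_conv_stat:
  assumes B: "brownian_bridge M B"
  shows "weak_conv_m (\<lambda>n. distr (sample n) borel (stat n)) (distr M borel (\<lambda>\<omega>. SUP t\<in>{0..1}. \<bar>B t \<omega>\<bar>))"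
proof (rule integral_cts_step_conv_imp_weak_conv)
  interpret S: prob_space "sample n" for n by (rule prob_space_sample)
  interpret M: prob_space M using B unfolding brownian_bridge_def by simp
  note ms = sup_bridge_tendsto(2)[OF B zero_less_one]
  show "real_distribution (distr (sample n) borel (stat n))" for n
    by (rule S.real_distribution_distr[OF measurable_stat])
  show "real_distribution (distr M borel (\<lambda>\<omega>. SUP t\<in>{0..1}. \<bar>B t \<omega>\<bar>))"
    by (rule M.real_distribution_distr[OF ms])
  fix a b :: real assume ab: "a < b"
  have cm: "cts_step a b \<in> borel_measurable borel"
    by (rule borel_measurable_continuous_onI[OF continuous_cts_step[OF ab]])
  show "(\<lambda>n. integral\<^sup>L (distr (sample n) borel (stat n)) (cts_step a b))
    \<longlonglongrightarrow> integral\<^sup>L (distr M borel (\<lambda>\<omega>. SUP t\<in>{0..1}. \<bar>B t \<omega>\<bar>)) (cts_step a b)"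
    unfolding integral_distr[OF measurable_stat cm] integral_distr[OF ms cm] by (rule stat_tendsto[OF B ab])
qed

text \<open>The statistic sees only the indices from 1 to \<open>N n\<close>. Restricted to these,
  the independent points have the product law \<open>sample n\<close>.\<close>

lemma distr_stat:
  assumes M: "prob_space M" and indep: "prob_space.indep_vars M (\<lambda>_. rspace (p n)) X {1..N n}"
    and X: "\<And>i. i \<in> {1..N n} \<Longrightarrow> distr M (rspace (p n)) (X i) = \<mu> n"
  shows "distr M borel (\<lambda>\<omega>. stat n (\<lambda>i. X i \<omega>)) = distr (sample n) borel (stat n)"
proof -
  interpret M: prob_space M by fact
  define V where "V \<omega> = (\<lambda>i\<in>{1..N n}. X i \<omega>)" for \<omega>
  have rv: "X i \<in> measurable M (rspace (p n))" if "i \<in> {1..N n}" for i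
    using indep that unfolding M.indep_vars_def by auto
  have V: "V \<in> measurable M (PiM {1..N n} (\<lambda>_. rspace (p n)))"
    unfolding V_def[abs_def] by (rule measurable_restrict) (rule rv)
  have ne: "{1..N n} \<noteq> {}" using N2[of n] by simp
  have "distr M (PiM {1..N n} (\<lambda>_. rspace (p n))) V = PiM {1..N n} (\<lambda>i. distr M (rspace (p n)) (X i))"
  proof -
    have "M.indep_vars (\<lambda>_. rspace (p n)) X {1..N n} \<longleftrightarrow>
        distr M (PiM {1..N n} (\<lambda>_. rspace (p n))) V = PiM {1..N n} (\<lambda>i. distr M (rspace (p n)) (X i))"
      unfolding V_def[abs_def] by (rule M.indep_vars_iff_distr_eq_PiM'[OF ne]) (rule rv)
    with indep show ?thesis by blast
  qed
  also have "\<dots> = sample n"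
    unfolding sample_def by (intro PiM_cong refl X)
  finally have VS: "distr M (PiM {1..N n} (\<lambda>_. rspace (p n))) V = sample n" .
  have "sets (sample n) = sets (PiM {1..N n} (\<lambda>_. rspace (p n)))"
    unfolding VS[symmetric] by simp
  then have st: "stat n \<in> borel_measurable (PiM {1..N n} (\<lambda>_. rspace (p n)))"
    using measurable_stat[of n] measurable_cong_sets by blast
  have "stat n (\<lambda>i. X i \<omega>) = stat n (V \<omega>)" for \<omega>
  proof -
    have "edf n (\<lambda>i j. dot (p n) (X i \<omega>) (X j \<omega>)) t = edf n (\<lambda>i j. dot (p n) (V \<omega> i) (V \<omega> j)) t" for t
      unfolding edf_def V_def by (intro arg_cong2[of _ _ _ _ "(*)"] refl sum.cong) (auto simp: pairs_def)
    then show ?thesis unfolding stat_eq by (simp only:)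
  qed
  then have "distr M borel (\<lambda>\<omega>. stat n (\<lambda>i. X i \<omega>)) = distr M borel (stat n \<circ> V)"
    by (simp add: comp_def)
  also have "\<dots> = distr (sample n) borel (stat n)"
    unfolding distr_distr[OF st V, symmetric] VS ..
  finally show ?thesis .
qed

end

theorem theorem1:
  fixes p :: "nat \<Rightarrow> nat"
    and \<mu>\<^sub>0 :: "nat \<Rightarrow> (nat \<Rightarrow> real) measure"
    and M :: "nat \<Rightarrow> 'a measure"
    and X :: "nat \<Rightarrow> nat \<Rightarrow> 'a \<Rightarrow> (nat \<Rightarrow> real)"
    and N :: "'b measure"
    and B :: "real \<Rightarrow> 'b \<Rightarrow> real"
  assumes "\<And>n. uniform_on_sphere (p n) (\<mu>\<^sub>0 n)"
    and "\<And>n. prob_space (M n)"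
    and "\<And>n. prob_space.indep_vars (M n) (\<lambda>_. rspace (p n)) (X n) {1..n}"
    and "\<And>n i. i \<in> {1..n} \<Longrightarrow> distr (M n) (rspace (p n)) (X n i) = \<mu>\<^sub>0 n"
    and "brownian_bridge N B"
    and "filterlim (\<lambda>n. min n (p n)) at_top sequentially"
  shows "weak_conv_m
           (\<lambda>n. distr (M n) borel
              (\<lambda>\<omega>. sqrt (real n * (real n - 1) / 2) * T_stat n (p n) (\<mu>\<^sub>0 n) (\<lambda>i. X n i \<omega>)))
           (distr N borel (\<lambda>\<omega>. SUP t\<in>{0..1}. \<bar>B t \<omega>\<bar>))"
proof -
  \<comment> \<open>From some n0 on there are at least two points, and the dimension is at least 2,
    so that inner products have no atoms. The earlier indices are cut off by a shift.\<close>
  have "\<forall>\<^sub>F n in sequentially. 2 \<le> min n (p n)"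
    using assms(6) unfolding filterlim_at_top by blast
  then obtain n0 where n0: "\<And>n. n \<ge> n0 \<Longrightarrow> 2 \<le> min n (p n)"
    unfolding eventually_sequentially by blast
  have us: "uniform_sphere (p (n + n0)) (\<mu>\<^sub>0 (n + n0))" for n
    using n0[of "n + n0"] assms(1) by unfold_locales auto
  have "\<forall>n. \<exists>q. quantile_sphere (p (n + n0)) (\<mu>\<^sub>0 (n + n0)) q"
  proof
    fix n
    interpret uniform_sphere "p (n + n0)" "\<mu>\<^sub>0 (n + n0)" by (rule us)
    obtain q where "q 0 = - 1" "q 1 = 1" "\<forall>u\<in>{0..1}. q u \<in> {-1..1} \<and> cdf_kern (q u) = u"
      using ex_quantile by blast
    then show "\<exists>q. quantile_sphere (p (n + n0)) (\<mu>\<^sub>0 (n + n0)) q"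
      by (intro exI[of _ q]) (unfold_locales, auto)
  qed
  from choice[OF this] obtain q where q: "\<And>n. quantile_sphere (p (n + n0)) (\<mu>\<^sub>0 (n + n0)) (q n)" by blast
  have lim: "filterlim (\<lambda>n. min (n + n0) (p (n + n0))) at_top sequentially"
    using filterlim_compose[OF assms(6) filterlim_add_const_nat_at_top] .
  \<comment> \<open>The sample size is a parameter of the locale precisely so that it can be shifted
    together with the dimension.\<close>
  interpret sample_sequence "\<lambda>n. p (n + n0)" "\<lambda>n. \<mu>\<^sub>0 (n + n0)" q "\<lambda>n. n + n0"
  proof (intro sample_sequence.intro sphere_sequence.intro sample_sequence_axioms.intro)
    show "quantile_sphere (p (n + n0)) (\<mu>\<^sub>0 (n + n0)) (q n)" for n by (rule q)
    show "filterlim (\<lambda>n. p (n + n0)) at_top sequentially"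
      by (rule filterlim_at_top_mono[OF lim]) simp
    show "filterlim (\<lambda>n. n + n0) at_top sequentially"
      by (rule filterlim_at_top_mono[OF lim]) simp
    show "2 \<le> n + n0" for n using n0[of "n + n0"] by simp
  qed
  have eq: "distr (M (n + n0)) borel (\<lambda>\<omega>. sqrt (real (n + n0) * (real (n + n0) - 1) / 2)
      * T_stat (n + n0) (p (n + n0)) (\<mu>\<^sub>0 (n + n0)) (\<lambda>i. X (n + n0) i \<omega>)) = distr (sample n) borel (stat n)" for n
    using distr_stat[where n = n and M = "M (n + n0)" and X = "X (n + n0)", OF assms(2) assms(3) assms(4)] unfolding stat_def root_pairs_def by simp
  \<comment> \<open>Weak convergence is convergence of distribution functions at each continuity
    point, so the shift by n0 can be undone point by point.\<close>
  show ?thesis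
    using weak_conv_stat[OF assms(5)] unfolding eq[symmetric] weak_conv_m_def weak_conv_def
    by (blast intro: LIMSEQ_offset[of _ n0])
qed

end
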